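(* Let $q$ be a prime power not divisible by $3$, and let $\epsilon=\left(\frac{q}{3}\right)$. Let $B\subset\mathbb{P}^4$ be the quartic threefold over $\mathbb{F}_q$ defined by $$y_0(y_0^3+y_1^3+y_2^3+y_3^3+y_4^3)+3y_1y_2y_3y_4=0,$$ and let $\tilde{B}$ be the desingularization of $B$ obtained by blowing up the singularities on $B$. Then $$Z(\tilde{B}/\mathbb{F}_q,T)=\frac{1}{(1-T)(1-qT)^{36}(1-\epsilon qT)^{25}(1-\epsilon q^2T)^{25}(1-q^2T)^{36}(1-q^3T)}.$$
   Context: For an algebraic variety $X$ over $\mathbb{F}_q$, the zeta function is the formal power series $Z(X/\mathbb{F}_q,T)=\exp\left(\sum_{n=1}^\infty \#X(\mathbb{F}_{q^n})\frac{T^n}{n}\right)$. The symbol $\left(\frac{q}{3}\right)$ is the Legendre symbol: it equals $1$ if $q\equiv1\pmod 3$ and $-1$ if $q\equiv 2\pmod 3$. The singular locus of $B$ consists (geometrically) of $45$ nodes. *)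

theory Defs
  imports
    "HOL-Computational_Algebra.Formal_Power_Series"
    "HOL-Library.Poly_Mapping"
    "HOL-Library.Numeral_Type"
    "HOL-Algebra.Algebraic_Closure_Type"
    "HOL-Number_Theory.Quadratic_Reciprocity"
begin

type_synonym ('v, 'a) mpoly = "('v \<Rightarrow>\<^sub>0 nat) \<Rightarrow>\<^sub>0 'a"

definition Const :: "'a::comm_ring_1 \<Rightarrow> ('v, 'a) mpoly" where
  "Const c = Poly_Mapping.single 0 c"

definition Var :: "'v \<Rightarrow> ('v, 'a::comm_ring_1) mpoly" where
  "Var i = Poly_Mapping.single (Poly_Mapping.single i 1) 1"

definition homogeneous :: "nat \<Rightarrow> ('v::finite, 'a::comm_ring_1) mpoly \<Rightarrow> bool" where
  "homogeneous d p \<longleftrightarrow>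
     (\<forall>m \<in> Poly_Mapping.keys p. (\<Sum>i\<in>UNIV. Poly_Mapping.lookup m i) = d)"

text \<open>In the next definition the exponent of \<open>Var i\<close> is truncated at 0, but the coefficient
  of such a term is 0.\<close>

definition partial_deriv :: "'v \<Rightarrow> ('v, 'a::comm_ring_1) mpoly \<Rightarrow> ('v, 'a) mpoly" where
  "partial_deriv i p = (\<Sum>m \<in> Poly_Mapping.keys p.
     Poly_Mapping.single (m - Poly_Mapping.single i 1)
       (of_nat (Poly_Mapping.lookup m i) * Poly_Mapping.lookup p m))"

definition eval_ac ::
  "('v::finite \<Rightarrow> 'a alg_closure) \<Rightarrow> ('v, 'a::field) mpoly \<Rightarrow> 'a alg_closure" where
  "eval_ac x p = (\<Sum>m \<in> Poly_Mapping.keys p.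
     to_ac (Poly_Mapping.lookup p m) * (\<Prod>i\<in>UNIV. x i ^ Poly_Mapping.lookup m i))"

lemma module_mult: "Modules.module ((*) :: 'a::comm_ring_1 \<Rightarrow> 'a \<Rightarrow> 'a)"
  by unfold_locales (simp_all add: algebra_simps)

abbreviation ideal_hull :: "'a::comm_ring_1 set \<Rightarrow> 'a set" where
  "ideal_hull \<equiv> Modules.module.span (*)"

fun ideal_power :: "'a::comm_ring_1 set \<Rightarrow> nat \<Rightarrow> 'a set" where
  "ideal_power I 0 = UNIV"
| "ideal_power I (Suc n) = ideal_hull {f * g | f g. f \<in> I \<and> g \<in> ideal_power I n}"

text \<open>The subfield with \<open>CARD('a) ^ n\<close> elements of the algebraic closure, as the fixed field of
  the \<open>n\<close>-th power of Frobenius.\<close>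

definition Fq :: "nat \<Rightarrow> ('a::{field, finite}) alg_closure set" where
  "Fq n = {a. a ^ (CARD('a) ^ n) = a}"

text \<open>The affine cone (without its vertex) over the geometric singular points of \<open>F = 0\<close>.
  The equation \<open>F = 0\<close> is not implied by the others when the characteristic divides the
  degree.\<close>

definition singular_cone :: "('v::finite, 'a::field) mpoly \<Rightarrow> ('v \<Rightarrow> 'a alg_closure) set" where
  "singular_cone F = {x. (\<exists>i. x i \<noteq> 0) \<and> eval_ac x F = 0 \<and>
     (\<forall>i. eval_ac x (partial_deriv i F) = 0)}"

definition vanishing_ideal ::
  "('v::finite \<Rightarrow> 'a alg_closure) set \<Rightarrow> ('v, 'a::field) mpoly set" where
  "vanishing_ideal Z = {g. \<forall>x\<in>Z. eval_ac x g = 0}"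

text \<open>
  Let \<open>S\<close> be the polynomial ring over a field \<open>k\<close>, and let \<open>J\<close> and \<open>I\<close> be homogeneous ideals of
  \<open>S\<close>. Let \<open>X\<close> be the projective scheme defined by \<open>J\<close>. The blow-up of \<open>X\<close> along the closed
  subscheme cut out by \<open>I\<close> is the relative Proj over \<open>X\<close> of the Rees algebra, i.e. the biprojective
  spectrum of the bigraded ring
    \<open>R = (\<Oplus>n. I^n / (I^n \<inter> J))\<close>,
  which is the Rees algebra of the image of \<open>I\<close> in \<open>S / J\<close>; a form of degree \<open>d\<close> in \<open>I^n\<close> has
  bidegree \<open>(d, n)\<close>. For an extension field \<open>L\<close> of \<open>k\<close>, its \<open>L\<close>-points are the \<open>k\<close>-algebra
  homomorphisms \<open>R \<rightarrow> L\<close> that vanish neither on all variables (in \<open>n = 0\<close>) nor on all of \<open>I\<close>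
  (in \<open>n = 1\<close>), taken modulo the action of the torus \<open>L\<^sup>* \<times> L\<^sup>*\<close> that comes from the bigrading.
  A homomorphism is given by its restrictions \<open>\<psi> n\<close> to the summands \<open>I^n\<close>; outside \<open>I^n\<close> we set
  \<open>\<psi> n\<close> to 0, so that equal homomorphisms are equal functions.
\<close>

definition rees_homs ::
  "('v::finite, 'a::field) mpoly set \<Rightarrow> ('v, 'a) mpoly set \<Rightarrow> 'a alg_closure set
     \<Rightarrow> (nat \<Rightarrow> ('v, 'a) mpoly \<Rightarrow> 'a alg_closure) set" where
  "rees_homs J I L = {\<psi>.
     (\<forall>n. \<forall>f \<in> ideal_power I n. \<psi> n f \<in> L) \<and>
     (\<forall>n. \<forall>f. f \<notin> ideal_power I n \<longrightarrow> \<psi> n f = 0) \<and>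
     (\<forall>n. \<forall>f \<in> ideal_power I n. \<forall>g \<in> ideal_power I n. \<psi> n (f + g) = \<psi> n f + \<psi> n g) \<and>
     (\<forall>m n. \<forall>f \<in> ideal_power I m. \<forall>g \<in> ideal_power I n. \<psi> (m + n) (f * g) = \<psi> m f * \<psi> n g) \<and>
     (\<forall>c. \<psi> 0 (Const c) = to_ac c) \<and>
     (\<forall>n. \<forall>f \<in> ideal_power I n \<inter> J. \<psi> n f = 0) \<and>
     (\<exists>i. \<psi> 0 (Var i) \<noteq> 0) \<and>
     (\<exists>f \<in> ideal_power I 1. \<psi> 1 f \<noteq> 0)}"

definition torus_rel ::
  "('v::finite, 'a::field) mpoly set \<Rightarrow> ('v, 'a) mpoly set \<Rightarrow> 'a alg_closure set
     \<Rightarrow> (nat \<Rightarrow> ('v, 'a) mpoly \<Rightarrow> 'a alg_closure) rel" where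
  "torus_rel J I L = {(\<psi>, \<phi>). \<psi> \<in> rees_homs J I L \<and> \<phi> \<in> rees_homs J I L \<and>
     (\<exists>s \<in> L - {0}. \<exists>t \<in> L - {0}. \<forall>n d. \<forall>f \<in> ideal_power I n.
        homogeneous d f \<longrightarrow> \<phi> n f = s ^ d * t ^ n * \<psi> n f)}"

definition blowup_points ::
  "('v::finite, 'a::field) mpoly set \<Rightarrow> ('v, 'a) mpoly set \<Rightarrow> 'a alg_closure set
     \<Rightarrow> (nat \<Rightarrow> ('v, 'a) mpoly \<Rightarrow> 'a alg_closure) set set" where
  "blowup_points J I L = rees_homs J I L // torus_rel J I L"

text \<open>The hypersurface \<open>F = 0\<close> blown up along its singular locus, which carries the reduced scheme
  structure.\<close>

definition sing_blowup_points ::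
  "('v::finite, 'a::field) mpoly \<Rightarrow> 'a alg_closure set
     \<Rightarrow> (nat \<Rightarrow> ('v, 'a) mpoly \<Rightarrow> 'a alg_closure) set set" where
  "sing_blowup_points F L = blowup_points (ideal_hull {F}) (vanishing_ideal (singular_cone F)) L"

text \<open>\<open>V n\<close> stands for the set of points rational over the field \<open>Fq n\<close>.\<close>

definition zeta :: "(nat \<Rightarrow> 'p set) \<Rightarrow> rat fps" where
  "zeta V = fps_compose (fps_exp 1) (Abs_fps (\<lambda>n. if n = 0 then 0 else of_nat (card (V n)) / of_nat n))"

definition burkhardt :: "(5, 'a::field) mpoly" where
  "burkhardt =
     Var 0 * (Var 0 ^ 3 + Var 1 ^ 3 + Var 2 ^ 3 + Var 3 ^ 3 + Var 4 ^ 3)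
       + 3 * Var 1 * Var 2 * Var 3 * Var 4"

end

theory Submission
  imports Defs
begin

text \<open>
  An \<open>L\<close>-point of the blow-up is a torus orbit of homomorphisms from the Rees algebra of the ideal \<open>I\<close>
  of the nodes to \<open>L\<close>. Over a smooth point of the quartic there is one orbit. At a node \<open>x\<close>, a
  homomorphism is the map \<open>f \<mapsto> [t^n] f (x + t v)\<close> on \<open>I^n\<close> for a nonzero tangent vector
  \<open>v\<close> modulo \<open>x\<close> on which the initial form of the quartic vanishes, so the fibre is a quadric surface.
  This needs that \<open>I\<close> is generated by local parameters at \<open>x\<close> although the coefficients of \<open>x\<close>
  need not lie in the base field.

  The quartic itself is counted on the hyperplane \<open>y\<^sub>0 = 0\<close> and on the affine part \<open>y\<^sub>0 = 1\<close>, which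
  is a family of cubic surfaces \<open>a^3 + b^3 + c^3 - 3 m a b c = m^3 - 1\<close>. If \<open>L\<close> contains no primitive
  cube root of unity, cubing is bijective on \<open>L\<close> and scaling gives the count; otherwise
  \<open>a^3 + b^3 + c^3 - 3 a b c\<close> splits into linear factors. With \<open>Q = card L\<close> the blow-up has
  \<open>Q^3 + 61 Q^2 + 61 Q + 1\<close> points in the split case and \<open>Q^3 + 11 Q^2 + 11 Q + 1\<close> in the other, which are
  the power sums of the claimed reciprocal roots.
\<close>

section \<open>Multivariate polynomials\<close>

text \<open>Orbits are counted through homomorphisms: the torus acts freely, so there are
  \<open>(card L - 1) ^ 2\<close> times as many homomorphisms as points, and points of the quartic
  are counted as nonzero vectors of its cone. Two obstacles shape the geometric part. The ideal of
  the nodes consists of polynomials over the finite base field, which cannot separate conjugate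
  nodes; that it is generated by local parameters is shown by comparing a form with its Frobenius
  power, which replaces the Nullstellensatz and descent. And a homomorphism must vanish on every
  multiple of the quartic that lies in \<open>I^n\<close>; this is controlled by orders of vanishing
  along lines. The quartic has 27 nodes with \<open>y\<^sub>0\<close> nonzero and 18 with
  \<open>y\<^sub>0 = 0\<close>. In the split case all 45 are rational with split quadrics. Otherwise
  1 + 6 are rational, and only the quadric at the first is nonsplit, with \<open>Q ^ 2 + 1\<close>
  points instead of \<open>(Q + 1) ^ 2\<close>. The coefficients 61 and 11 are 36 + 25 and 36 -
  25.\<close>

lemma poly_mapping_eq_sum_single:
  fixes p :: "'k \<Rightarrow>\<^sub>0 'b::comm_monoid_add"
  shows "p = (\<Sum>m \<in> Poly_Mapping.keys p. Poly_Mapping.single m (Poly_Mapping.lookup p m))"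
proof (rule poly_mapping_eqI)
  fix k
  have "Poly_Mapping.lookup (\<Sum>m \<in> Poly_Mapping.keys p. Poly_Mapping.single m (Poly_Mapping.lookup p m)) k
      = (\<Sum>m \<in> Poly_Mapping.keys p. if m = k then Poly_Mapping.lookup p m else 0)"
    by (simp add: lookup_sum lookup_single when_def)
  also have "\<dots> = Poly_Mapping.lookup p k"
    by (simp add: in_keys_iff)
  finally show "Poly_Mapping.lookup p k =
    Poly_Mapping.lookup (\<Sum>m \<in> Poly_Mapping.keys p. Poly_Mapping.single m (Poly_Mapping.lookup p m)) k" ..
qed

lemma poly_mapping_single_induct [case_names zero single add]:
  fixes p :: "'k \<Rightarrow>\<^sub>0 'b::comm_monoid_add"
  assumes "P 0" and "\<And>m c. P (Poly_Mapping.single m c)" and "\<And>p q. P p \<Longrightarrow> P q \<Longrightarrow> P (p + q)"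
  shows "P p"
proof -
  have "P (\<Sum>m \<in> S. Poly_Mapping.single m (Poly_Mapping.lookup p m))" if "finite S" for S
    using that by (induction S rule: finite_induct) (auto intro: assms)
  then show ?thesis
    using poly_mapping_eq_sum_single[of p] by (metis finite_keys)
qed

text \<open>The target ring is kept general: besides \<open>eval_ac\<close> (with
  \<open>h = to_ac\<close>), the same rules serve expansions along lines and planes, with values in
  polynomial rings, and substitution into the polynomial ring itself.\<close>

definition mp_eval :: "('a \<Rightarrow> 'b) \<Rightarrow> ('v \<Rightarrow> 'b) \<Rightarrow> ('v::finite, 'a::comm_ring_1) mpoly \<Rightarrow> 'b::comm_ring_1"
  where "mp_eval h x p = (\<Sum>m \<in> Poly_Mapping.keys p.
     h (Poly_Mapping.lookup p m) * (\<Prod>i\<in>UNIV. x i ^ Poly_Mapping.lookup m i))"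

lemma eval_ac_eq_mp_eval: "eval_ac x p = mp_eval to_ac x p"
  by (simp add: eval_ac_def mp_eval_def)

locale coeff_hom =
  fixes h :: "'a::comm_ring_1 \<Rightarrow> 'b::comm_ring_1"
  assumes hom_add [simp]: "h (a + b) = h a + h b"
    and hom_mult [simp]: "h (a * b) = h a * h b"
    and hom_one [simp]: "h 1 = 1"
begin

lemma hom_zero [simp]: "h 0 = 0"
  using hom_add[of 0 0] by simp

lemma mp_eval_superset:
  assumes "finite S" "Poly_Mapping.keys p \<subseteq> S"
  shows "mp_eval h x p =
    (\<Sum>m \<in> S. h (Poly_Mapping.lookup p m) * (\<Prod>i\<in>UNIV. x i ^ Poly_Mapping.lookup m i))"
  unfolding mp_eval_def
  by (rule sum.mono_neutral_left) (use assms in \<open>auto simp: in_keys_iff\<close>)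

lemma mp_eval_add [simp]: "mp_eval h x (p + q) = mp_eval h x p + mp_eval h x q"
proof -
  define S where "S = Poly_Mapping.keys p \<union> Poly_Mapping.keys q"
  have "finite S" "Poly_Mapping.keys p \<subseteq> S" "Poly_Mapping.keys q \<subseteq> S" "Poly_Mapping.keys (p + q) \<subseteq> S"
    using keys_add[of p q] by (auto simp: S_def)
  then show ?thesis
    by (simp add: mp_eval_superset[of S] lookup_add algebra_simps sum.distrib)
qed

lemma mp_eval_zero [simp]: "mp_eval h x 0 = 0"
  by (simp add: mp_eval_def)

lemma mp_eval_single:
  "mp_eval h x (Poly_Mapping.single m c) = h c * (\<Prod>i\<in>UNIV. x i ^ Poly_Mapping.lookup m i)"
  by (simp add: mp_eval_def)

lemma mp_eval_Const [simp]: "mp_eval h x (Const c) = h c"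
  by (simp add: Const_def mp_eval_single)

lemma mp_eval_one [simp]: "mp_eval h x 1 = 1"
  using mp_eval_Const[of x 1] by (simp add: Const_def)

lemma mp_eval_Var [simp]: "mp_eval h x (Var i) = x i"
proof -
  have "(\<Prod>j\<in>UNIV. x j ^ Poly_Mapping.lookup (Poly_Mapping.single i (1::nat)) j) =
    (\<Prod>j\<in>UNIV. if j = i then x j else 1)"
    by (rule prod.cong) (auto simp: lookup_single when_def)
  then show ?thesis
    by (simp add: Var_def mp_eval_single)
qed

lemma mp_eval_mult [simp]: "mp_eval h x (p * q) = mp_eval h x p * mp_eval h x q"
proof (induction p rule: poly_mapping_single_induct)
  case (single m c)
  show ?case
  proof (induction q rule: poly_mapping_single_induct)
    case (single m' c')
    then show ?case
      by (simp add: mult_single mp_eval_single lookup_add power_add prod.distrib mult_ac)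
  qed (simp_all add: algebra_simps)
qed (simp_all add: algebra_simps)

lemma mp_eval_uminus [simp]: "mp_eval h x (- p) = - mp_eval h x p"
  using mp_eval_add[of x p "- p"] by (simp add: eq_neg_iff_add_eq_0 add.commute del: mp_eval_add)

lemma mp_eval_diff [simp]: "mp_eval h x (p - q) = mp_eval h x p - mp_eval h x q"
  using mp_eval_add[of x p "- q"] by (simp del: mp_eval_add)

lemma mp_eval_power [simp]: "mp_eval h x (p ^ n) = mp_eval h x p ^ n"
  by (induction n) simp_all

lemma mp_eval_sum [simp]: "mp_eval h x (sum f S) = (\<Sum>i\<in>S. mp_eval h x (f i))"
  by (induction S rule: infinite_finite_induct) simp_all

lemma mp_eval_of_nat [simp]: "mp_eval h x (of_nat n) = of_nat n"
  by (induction n) simp_all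

lemma mp_eval_numeral [simp]: "mp_eval h x (numeral n) = numeral n"
  using mp_eval_of_nat[of x "numeral n"] by (simp del: mp_eval_of_nat)

end

text \<open>The universal property of the polynomial ring. Specialising a parameter, extracting a
  constant coefficient, composing with \<open>[:0, t:]\<close> and raising to a Frobenius power are
  all identified with evaluations through it.\<close>

lemma mp_eval_unique:
  fixes f :: "('v::finite, 'a::comm_ring_1) mpoly \<Rightarrow> 'b::comm_ring_1"
  assumes "\<And>p q. f (p + q) = f p + f q" and "\<And>p q. f (p * q) = f p * f q"
    and "\<And>c. f (Const c) = h c" and "h 0 = 0" and "h 1 = 1"
  shows "f p = mp_eval h (\<lambda>i. f (Var i)) p"
proof -
  have zero: "f 0 = 0"
    using assms(1)[of 0 0] by simp
  have one: "f 1 = 1"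
    using assms(3)[of 1] assms(5) by (simp add: Const_def)
  have pow: "f (p ^ n) = f p ^ n" for p n
    by (induction n) (simp_all add: one assms(2))
  have sm: "f (sum g S) = (\<Sum>i\<in>S. f (g i))" for g :: "'c \<Rightarrow> _" and S
    by (induction S rule: infinite_finite_induct) (simp_all add: zero assms(1))
  have pr: "f (prod g S) = (\<Prod>i\<in>S. f (g i))" for g :: "'c \<Rightarrow> _" and S
    by (induction S rule: infinite_finite_induct) (simp_all add: one assms(2))
  have mono: "Poly_Mapping.single m c = Const c * (\<Prod>i\<in>UNIV. Var i ^ Poly_Mapping.lookup m i)"
    for m :: "'v \<Rightarrow>\<^sub>0 nat" and c :: 'a
  proof -
    have var: "Var i ^ n = (Poly_Mapping.single (Poly_Mapping.single i n) 1 :: ('v, 'a) mpoly)" for i n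
      by (induction n) (simp_all add: Var_def mult_single flip: single_add)
    have "(\<Prod>i\<in>S. Var i ^ Poly_Mapping.lookup m i) =
      (Poly_Mapping.single (\<Sum>i\<in>S. Poly_Mapping.single i (Poly_Mapping.lookup m i)) 1 :: ('v, 'a) mpoly)"
      if "finite S" for S
      using that by (induction S rule: finite_induct) (simp_all add: var mult_single)
    moreover have "(\<Sum>i\<in>UNIV. Poly_Mapping.single i (Poly_Mapping.lookup m i)) = m"
      by (rule poly_mapping_eqI) (simp add: lookup_sum lookup_single when_def)
    ultimately show ?thesis
      by (simp add: Const_def mult_single)
  qed
  have "f p = f (\<Sum>m \<in> Poly_Mapping.keys p. Poly_Mapping.single m (Poly_Mapping.lookup p m))"
    by (subst poly_mapping_eq_sum_single[of p]) simp
  also have "\<dots> = mp_eval h (\<lambda>i. f (Var i)) p"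
    by (simp add: mp_eval_def sm mono assms(2,3) pr pow)
  finally show ?thesis .
qed

lemma coeff_hom_to_ac: "coeff_hom to_ac"
  by unfold_locales simp_all

subsection \<open>Partial derivatives\<close>

lemma partial_deriv_superset:
  assumes "finite S" "Poly_Mapping.keys p \<subseteq> S"
  shows "partial_deriv i p = (\<Sum>m \<in> S. Poly_Mapping.single (m - Poly_Mapping.single i 1)
       (of_nat (Poly_Mapping.lookup m i) * Poly_Mapping.lookup p m))"
  unfolding partial_deriv_def
  by (rule sum.mono_neutral_left) (use assms in \<open>auto simp: in_keys_iff\<close>)

lemma partial_deriv_add [simp]: "partial_deriv i (p + q) = partial_deriv i p + partial_deriv i q"
proof -
  define S where "S = Poly_Mapping.keys p \<union> Poly_Mapping.keys q"
  have "finite S" "Poly_Mapping.keys p \<subseteq> S" "Poly_Mapping.keys q \<subseteq> S" "Poly_Mapping.keys (p + q) \<subseteq> S"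
    using keys_add[of p q] by (auto simp: S_def)
  then show ?thesis
    by (simp add: partial_deriv_superset[of S] lookup_add algebra_simps sum.distrib single_add)
qed

lemma partial_deriv_zero [simp]: "partial_deriv i 0 = 0"
  by (simp add: partial_deriv_def)

lemma partial_deriv_single:
  "partial_deriv i (Poly_Mapping.single m c) =
    Poly_Mapping.single (m - Poly_Mapping.single i 1) (of_nat (Poly_Mapping.lookup m i) * c)"
  by (simp add: partial_deriv_def)

lemma partial_deriv_mult [simp]:
  "partial_deriv i (p * q) = partial_deriv i p * q + p * partial_deriv i q"
proof (induction p rule: poly_mapping_single_induct)
  case (single m c)
  show ?case
  proof (induction q rule: poly_mapping_single_induct)
    case (single m' c')
    \<comment> \<open>Subtraction of exponents truncates, so it commutes with addition only where
      the exponent of \<open>i\<close> is positive; where it is zero, both coefficients carry the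
      factor \<open>of_nat 0\<close>.\<close>
    have shift: "(m - Poly_Mapping.single i 1) + m' = m + m' - Poly_Mapping.single i 1"
      if "Poly_Mapping.lookup m i \<noteq> 0" for m m' :: "'a \<Rightarrow>\<^sub>0 nat"
      using that by (intro poly_mapping_eqI) (auto simp: lookup_add lookup_minus lookup_single when_def)
    have 1: "Poly_Mapping.single ((m - Poly_Mapping.single i 1) + m') (of_nat (Poly_Mapping.lookup m i) * c * c')
      = Poly_Mapping.single (m + m' - Poly_Mapping.single i 1) (of_nat (Poly_Mapping.lookup m i) * c * c')"
      using shift[of m m'] by (cases "Poly_Mapping.lookup m i = 0") (simp_all only:, simp_all)
    have 2: "Poly_Mapping.single (m + (m' - Poly_Mapping.single i 1)) (c * (of_nat (Poly_Mapping.lookup m' i) * c'))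
      = Poly_Mapping.single (m + m' - Poly_Mapping.single i 1) (c * (of_nat (Poly_Mapping.lookup m' i) * c'))"
      using shift[of m' m] by (cases "Poly_Mapping.lookup m' i = 0") (simp_all only: add.commute[of m], simp_all)
    show ?case
      by (simp only: mult_single partial_deriv_single 1 2 flip: single_add)
         (simp add: lookup_add algebra_simps)
  qed (simp_all add: algebra_simps)
qed (simp_all add: algebra_simps)

lemma partial_deriv_Const [simp]: "partial_deriv i (Const c) = 0"
  by (simp add: Const_def partial_deriv_single)

lemma partial_deriv_one [simp]: "partial_deriv i 1 = 0"
  using partial_deriv_Const[of i 1] by (simp add: Const_def)

lemma partial_deriv_numeral [simp]: "partial_deriv i (numeral n) = 0"
proof -
  have "partial_deriv i (of_nat k) = 0" for k
    by (induction k) simp_all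
  from this[of "numeral n"] show ?thesis by simp
qed

lemma partial_deriv_power [simp]:
  "partial_deriv i (p ^ Suc n) = of_nat (Suc n) * p ^ n * partial_deriv i p"
  by (induction n) (simp_all add: algebra_simps)

lemma partial_deriv_Var: "partial_deriv i (Var j) = (if i = j then 1 else 0)"
  by (auto simp: Var_def partial_deriv_single lookup_single when_def)

subsection \<open>Homogeneous components\<close>

abbreviation mdeg :: "('v::finite \<Rightarrow>\<^sub>0 nat) \<Rightarrow> nat" where
  "mdeg m \<equiv> \<Sum>i\<in>UNIV. Poly_Mapping.lookup m i"

lemma homogeneous_Var: "homogeneous 1 (Var i)"
proof -
  have "(\<Sum>j\<in>UNIV. Poly_Mapping.lookup (Poly_Mapping.single i (1::nat)) j) = (\<Sum>j\<in>UNIV. if j = i then 1 else 0)"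
    by (rule sum.cong) (auto simp: lookup_single when_def)
  then show ?thesis
    by (auto simp: homogeneous_def Var_def split: if_splits)
qed

lemma homogeneous_Const: "homogeneous 0 (Const c)"
  by (auto simp: homogeneous_def Const_def split: if_splits)

lemma homogeneous_one: "homogeneous 0 1"
  using homogeneous_Const[of 1] by (simp add: Const_def)

lemma homogeneous_add: "homogeneous d p \<Longrightarrow> homogeneous d q \<Longrightarrow> homogeneous d (p + q)"
  using keys_add[of p q] by (auto simp: homogeneous_def)

lemma homogeneous_zero: "homogeneous d 0"
  by (simp add: homogeneous_def)

lemma homogeneous_mult:
  assumes "homogeneous d p" "homogeneous e q"
  shows "homogeneous (d + e) (p * q)"
  unfolding homogeneous_def
proof
  fix m assume "m \<in> Poly_Mapping.keys (p * q)"
  with keys_mult[of p q] obtain a b where "m = a + b" "a \<in> Poly_Mapping.keys p" "b \<in> Poly_Mapping.keys q"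
    by blast
  with assms show "mdeg m = d + e"
    by (auto simp: homogeneous_def lookup_add sum.distrib)
qed

lemma homogeneous_power: "homogeneous d p \<Longrightarrow> homogeneous (n * d) (p ^ n)"
  by (induction n) (auto intro: homogeneous_one homogeneous_mult)

lemma homogeneous_numeral: "homogeneous 0 (numeral n)"
proof -
  have "homogeneous 0 (of_nat k)" for k
    by (induction k) (auto intro: homogeneous_add homogeneous_one homogeneous_zero)
  from this[of "numeral n"] show ?thesis by simp
qed

definition hcomp :: "nat \<Rightarrow> ('v::finite, 'a::comm_ring_1) mpoly \<Rightarrow> ('v, 'a) mpoly" where
  "hcomp d p = (\<Sum>m \<in> {m \<in> Poly_Mapping.keys p. mdeg m = d}. Poly_Mapping.single m (Poly_Mapping.lookup p m))"

lemma homogeneous_sum: "(\<And>i. i \<in> S \<Longrightarrow> homogeneous d (f i)) \<Longrightarrow> homogeneous d (sum f S)"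
  by (induction S rule: infinite_finite_induct) (auto intro: homogeneous_add homogeneous_zero)

lemma homogeneous_hcomp: "homogeneous d (hcomp d p)"
  unfolding hcomp_def by (rule homogeneous_sum) (auto simp: homogeneous_def split: if_splits)

lemma sum_hcomp: "\<exists>N. p = (\<Sum>d\<le>N. hcomp d p)"
proof
  let ?N = "Max (insert 0 (mdeg ` Poly_Mapping.keys p))"
  have *: "Poly_Mapping.keys p = (\<Union>d\<in>{..?N}. {m \<in> Poly_Mapping.keys p. mdeg m = d})"
    by auto
  have "p = (\<Sum>m \<in> (\<Union>d\<in>{..?N}. {m \<in> Poly_Mapping.keys p. mdeg m = d}). Poly_Mapping.single m (Poly_Mapping.lookup p m))"
    by (subst *[symmetric]) (rule poly_mapping_eq_sum_single)
  also have "\<dots> = (\<Sum>d\<le>?N. hcomp d p)"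
    unfolding hcomp_def by (rule sum.UNION_disjoint) auto
  finally show "p = (\<Sum>d\<le>?N. hcomp d p)" .
qed

lemma (in coeff_hom) mp_eval_homogeneous_scale:
  assumes "homogeneous d p"
  shows "mp_eval h (\<lambda>i. s * x i) p = s ^ d * mp_eval h x p"
proof -
  have "(\<Prod>i\<in>UNIV. (s * x i) ^ Poly_Mapping.lookup m i) = s ^ mdeg m * (\<Prod>i\<in>UNIV. x i ^ Poly_Mapping.lookup m i)" for m
    by (simp add: power_mult_distrib prod.distrib power_sum)
  then show ?thesis
    using assms unfolding mp_eval_def homogeneous_def sum_distrib_left
    by (intro sum.cong) (simp_all add: mult_ac)
qed

section \<open>Powers of ideals\<close>

interpretation ring_mod: Modules.module "(*) :: 'a::comm_ring_1 \<Rightarrow> 'a \<Rightarrow> 'a"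
  by (rule module_mult)

text \<open>For the multiplication of a ring, this rule undoes \<open>mult.assoc\<close>.\<close>

declare ring_mod.scale_scale [simp del]

abbreviation is_ideal :: "'a::comm_ring_1 set \<Rightarrow> bool" where
  "is_ideal \<equiv> Modules.module.subspace (*)"

declare ideal_power.simps(2) [simp del]

lemma is_ideal_power: "is_ideal (ideal_power I n)"
  by (cases n) (simp_all add: ideal_power.simps ring_mod.subspace_UNIV)

lemma is_ideal_mult_left: "is_ideal I \<Longrightarrow> f \<in> I \<Longrightarrow> g * f \<in> I"
  by (rule ring_mod.subspace_scale)

lemma is_ideal_mult_right: "is_ideal I \<Longrightarrow> f \<in> I \<Longrightarrow> f * g \<in> I"
  using is_ideal_mult_left[of I f g] by (simp add: mult.commute)

lemma ideal_power_1:
  assumes "is_ideal I"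
  shows "ideal_power I 1 = I"
proof -
  have "{f * g | f g. f \<in> I \<and> g \<in> (UNIV :: 'a set)} = I" (is "?A = I")
  proof
    show "?A \<subseteq> I" using assms by (auto intro: is_ideal_mult_right)
    show "I \<subseteq> ?A"
    proof
      fix f assume "f \<in> I"
      then have "f = f * 1 \<and> f \<in> I \<and> 1 \<in> (UNIV :: 'a set)" by simp
      then show "f \<in> ?A" by blast
    qed
  qed
  then show ?thesis
    using assms by (simp add: ideal_power.simps(2) ring_mod.span_eq_iff)
qed

lemma ideal_power_Suc_mult:
  "f \<in> I \<Longrightarrow> g \<in> ideal_power I n \<Longrightarrow> f * g \<in> ideal_power I (Suc n)"
  unfolding ideal_power.simps by (rule ring_mod.span_base) auto

text \<open>The scalar in a linear combination is absorbed into the first factor, since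
  \<open>I\<close> is an ideal; so no case for scalar multiples remains.\<close>

lemma ideal_power_Suc_induct [consumes 2, case_names zero mult add]:
  assumes "f \<in> ideal_power I (Suc n)" and "is_ideal I"
    and "P 0" and "\<And>a b. a \<in> I \<Longrightarrow> b \<in> ideal_power I n \<Longrightarrow> P (a * b)"
    and "\<And>a b. a \<in> ideal_power I (Suc n) \<Longrightarrow> b \<in> ideal_power I (Suc n) \<Longrightarrow> P a \<Longrightarrow> P b \<Longrightarrow> P (a + b)"
  shows "P f"
proof -
  have "f \<in> ideal_power I (Suc n) \<and> P f"
    using assms(1) unfolding ideal_power.simps
  proof (induction rule: ring_mod.span_induct_alt)
    case base
    show ?case by (intro conjI assms(3) ring_mod.span_zero)
  next
    case (step c x y)
    from step(1) obtain a b where ab: "x = a * b" "a \<in> I" "b \<in> ideal_power I n"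
      unfolding mem_Collect_eq by (elim exE conjE)
    have ca: "c * a \<in> I"
      using assms(2) ab(2) by (rule is_ideal_mult_left)
    have eq: "c * x = (c * a) * b"
      by (simp only: ab(1) mult.assoc)
    have cx: "P (c * x)" "c * x \<in> ideal_power I (Suc n)"
      unfolding eq by (rule assms(4)[OF ca ab(3)], rule ideal_power_Suc_mult[OF ca ab(3)])
    show ?case
    proof
      show "c * x + y \<in> ideal_hull {f * g | f g. f \<in> I \<and> g \<in> ideal_power I n}"
        using cx(2) step(2) unfolding ideal_power.simps by (intro ring_mod.span_add) simp_all
      show "P (c * x + y)"
        using step(2) by (intro assms(5)[OF cx(2) _ cx(1)]) (simp_all add: ideal_power.simps)
    qed
  qed
  then show ?thesis ..
qed

lemma ideal_power_mult:
  assumes "is_ideal I" "f \<in> ideal_power I m" "g \<in> ideal_power I n"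
  shows "f * g \<in> ideal_power I (m + n)"
  using assms(2)
proof (induction m arbitrary: f)
  case 0
  then show ?case using assms(3) is_ideal_mult_left[OF is_ideal_power] by simp
next
  case (Suc m)
  from Suc.prems assms(1) show ?case
  proof (induction rule: ideal_power_Suc_induct)
    case zero
    show ?case using ring_mod.subspace_0[OF is_ideal_power] by (simp del: ideal_power.simps)
  next
    case (mult a b)
    show ?case
      unfolding mult.assoc add_Suc by (rule ideal_power_Suc_mult[OF mult(1) Suc.IH[OF mult(2)]])
  next
    case (add a b)
    show ?case
      unfolding distrib_right by (rule ring_mod.subspace_add[OF is_ideal_power add(3,4)])
  qed
qed

text \<open>A generator of \<open>I^n\<close> is a product of \<open>n\<close> elements whose images
  are divisible by \<open>t\<close>. With \<open>\<Phi>\<close> the expansion along a line or plane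
  through a node, membership in a power of the ideal becomes an order of vanishing.\<close>

lemma ideal_power_dvd:
  fixes \<Phi> :: "'a::comm_ring_1 \<Rightarrow> 'b::comm_ring_1"
  assumes "is_ideal I" "f \<in> ideal_power I n"
    and "\<And>p q. \<Phi> (p + q) = \<Phi> p + \<Phi> q" "\<And>p q. \<Phi> (p * q) = \<Phi> p * \<Phi> q"
    and "\<And>p. p \<in> I \<Longrightarrow> t dvd \<Phi> p"
  shows "t ^ n dvd \<Phi> f"
  using assms(2)
proof (induction n arbitrary: f)
  case (Suc n)
  from Suc.prems assms(1) show ?case
  proof (induction rule: ideal_power_Suc_induct)
    case zero
    show ?case using assms(3)[of 0 0] by simp
  next
    case (mult a b)
    then show ?case using Suc.IH[of b] assms(4,5) by (simp add: mult_dvd_mono)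
  qed (simp add: assms(3))
qed simp

lemma ideal_hull_singleton: "ideal_hull {F} = {g * F | g. True}"
  by (auto simp: ring_mod.span_singleton)

section \<open>Finite fields\<close>

lemma card_power_eq_same: "(x :: 'k::{field, finite}) ^ CARD('k) = x"
proof (cases "x = 0")
  case False
  have "x * (\<Prod>y\<in>UNIV-{0}. x * y) = x * x ^ (CARD('k) - 1) * \<Prod>(UNIV-{0})"
    by (simp add: prod.distrib mult_ac)
  also have "x * x ^ (CARD('k) - 1) = x ^ Suc (CARD('k) - 1)"
    by (subst power_Suc) auto
  also have "Suc (CARD('k) - 1) = CARD('k)"
    using finite_UNIV_card_ge_0[where ?'a = 'k] by simp
  also have "(\<Prod>y\<in>UNIV-{0}. x * y) = (\<Prod>y\<in>UNIV-{0}. y)"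
    by (rule prod.reindex_bij_witness[of _ "\<lambda>y. y / x" "\<lambda>y. x * y"]) (use False in auto)
  finally show ?thesis
    by simp
qed (use finite_UNIV_card_ge_0[where ?'a = 'k] in auto)

lemma CARD_field_ge_2: "CARD('k::{field, finite}) \<ge> 2"
  using card_mono[of "UNIV :: 'k set" "{0, 1}"] by simp

text \<open>The polynomial \<open>(X + 1)^q - X^q - 1\<close> has degree less than \<open>q\<close> and \<open>q\<close> roots.\<close>

lemma of_nat_card_choose_eq_0:
  assumes "0 < i" "i < CARD('k)"
  shows "of_nat (CARD('k) choose i) = (0 :: 'k::{field, finite})"
proof -
  define q where "q = CARD('k)"
  have q: "q \<ge> 2" using CARD_field_ge_2[where 'k = 'k] by (simp add: q_def)
  define p :: "'k poly" where "p = [:1, 1:] ^ q - monom 1 q - 1"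
  have coeff: "coeff ([:1, 1:] ^ n) j = (of_nat (n choose j) :: 'k)" for n j
  proof (induction n arbitrary: j)
    case 0 show ?case by (cases j) simp_all
  next
    case (Suc n) then show ?case by (cases j) (simp_all add: coeff_pCons split: nat.splits)
  qed
  have c: "coeff p j = (if 0 < j \<and> j < q then of_nat (q choose j) else 0)" for j
    using q by (auto simp: p_def coeff coeff_1 not_less binomial_eq_0)
  have "p = 0"
  proof (rule ccontr)
    assume "p \<noteq> 0"
    then have "card {x. poly p x = 0} \<le> degree p"
      by (rule card_poly_roots_bound)
    moreover have "{x. poly p x = 0} = UNIV"
      by (auto simp: p_def poly_monom q_def card_power_eq_same)
    moreover have "degree p < q"
      using q by (intro degree_lessI) (auto simp: c)
    ultimately show False by (simp add: q_def)
  qed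
  with c[of i] assms show ?thesis by (simp add: q_def)
qed

text \<open>The inner binomial coefficients vanish in \<open>'k\<close>, hence in every ring of the
  same characteristic. It is applied to the algebraic closure and to the polynomial ring.\<close>

lemma frobenius_add:
  fixes x y :: "'b::comm_ring_1"
  assumes "CHAR('b) = CHAR('k::{field, finite})"
  shows "(x + y) ^ (CARD('k) ^ n) = x ^ (CARD('k) ^ n) + y ^ (CARD('k) ^ n)"
proof (induction n)
  case (Suc n)
  have "(a + b) ^ CARD('k) = a ^ CARD('k) + b ^ CARD('k)" for a b :: 'b
  proof -
    have "(a + b) ^ CARD('k) = (\<Sum>i\<le>CARD('k). of_nat (CARD('k) choose i) * a ^ i * b ^ (CARD('k) - i))"
      by (rule binomial_ring)
    also have "\<dots> = (\<Sum>i\<in>{0, CARD('k)}. of_nat (CARD('k) choose i) * a ^ i * b ^ (CARD('k) - i))"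
    proof (rule sum.mono_neutral_right)
      show "\<forall>i\<in>{..CARD('k)} - {0, CARD('k)}. of_nat (CARD('k) choose i) * a ^ i * b ^ (CARD('k) - i) = 0"
      proof
        fix i assume "i \<in> {..CARD('k)} - {0, CARD('k)}"
        then have "of_nat (CARD('k) choose i) = (0 :: 'k)"
          by (intro of_nat_card_choose_eq_0) auto
        then have "of_nat (CARD('k) choose i) = (0 :: 'b)"
          by (simp add: of_nat_eq_0_iff_char_dvd assms)
        then show "of_nat (CARD('k) choose i) * a ^ i * b ^ (CARD('k) - i) = 0" by simp
      qed
    qed auto
    finally show ?thesis by (simp add: add.commute)
  qed
  with Suc show ?case by (simp only: power_Suc2 power_mult)
qed simp

text \<open>A field as a set and not as a type, because the fields \<open>Fq n\<close> for all
  \<open>n\<close> are subsets of one algebraic closure.\<close>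

locale finite_subfield =
  fixes L :: "'b::field set"
  assumes finite_L: "finite L"
    and zero_L [simp]: "0 \<in> L" and one_L [simp]: "1 \<in> L"
    and add_L [simp]: "a \<in> L \<Longrightarrow> b \<in> L \<Longrightarrow> a + b \<in> L"
    and mult_L [simp]: "a \<in> L \<Longrightarrow> b \<in> L \<Longrightarrow> a * b \<in> L"
    and uminus_L [simp]: "a \<in> L \<Longrightarrow> - a \<in> L"
    and inverse_L [simp]: "a \<in> L \<Longrightarrow> inverse a \<in> L"
begin

lemma diff_L [simp]: "a \<in> L \<Longrightarrow> b \<in> L \<Longrightarrow> a - b \<in> L"
  using add_L[of a "- b"] by simp

lemma divide_L [simp]: "a \<in> L \<Longrightarrow> b \<in> L \<Longrightarrow> a / b \<in> L"
  by (simp add: divide_inverse)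

lemma power_L [simp]: "a \<in> L \<Longrightarrow> a ^ n \<in> L"
  by (induction n) simp_all

lemma of_nat_L [simp]: "of_nat n \<in> L"
  by (induction n) simp_all

lemma numeral_L [simp]: "numeral n \<in> L"
  using of_nat_L[of "numeral n"] by (simp del: of_nat_L)

lemma sum_L: "(\<And>i. i \<in> S \<Longrightarrow> f i \<in> L) \<Longrightarrow> sum f S \<in> L"
  by (induction S rule: infinite_finite_induct) simp_all

lemma prod_L: "(\<And>i. i \<in> S \<Longrightarrow> f i \<in> L) \<Longrightarrow> prod f S \<in> L"
  by (induction S rule: infinite_finite_induct) simp_all

lemma card_L_ge_2: "card L \<ge> 2"
  using card_mono[OF finite_L, of "{0, 1}"] by simp

end

context
  fixes n :: nat
  assumes n: "n > 0"
begin

text \<open>\<open>Fq n\<close> is the root set of \<open>X^Q - X\<close>. The derivative of this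
  polynomial is -1, so none of its \<open>Q\<close> linear factors over the closure is
  repeated.\<close>

lemma finite_subfield_Fq: "finite_subfield (Fq n :: 'k::{field, finite} alg_closure set)"
  and card_Fq: "card (Fq n :: 'k alg_closure set) = CARD('k) ^ n"
proof -
  define Q where "Q = CARD('k) ^ n"
  have "Q > 1"
    using CARD_field_ge_2[where 'k = 'k] n one_less_power[of "CARD('k)" n] by (simp add: Q_def)
  have add: "(x + y) ^ Q = x ^ Q + y ^ Q" for x y :: "'k alg_closure"
    by (simp add: Q_def frobenius_add)
  have "CHAR('k alg_closure) = CHAR('k)" by simp
  have CHAR: "of_nat CARD('k) = (0 :: 'k alg_closure)"
  proof -
    have "of_nat (CARD('k) choose 1) = (0 :: 'k)"
      by (rule of_nat_card_choose_eq_0) (use CARD_field_ge_2[where 'k = 'k] in auto)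
    then have "to_ac (of_nat CARD('k)) = (0 :: 'k alg_closure)" by simp
    then show ?thesis by (simp del: to_ac_eq_0_iff)
  qed
  define p :: "'k alg_closure poly" where "p = monom 1 Q - monom 1 1"
  have coeff: "coeff p j = (if j = Q then 1 else if j = 1 then -1 else 0)" for j
    using \<open>Q > 1\<close> by (auto simp: p_def)
  then have "p \<noteq> 0" by (metis coeff_0 one_neq_zero)
  have "degree p = Q"
    using \<open>Q > 1\<close> by (intro antisym degree_le le_degree) (auto simp: coeff)
  have roots: "poly p x = 0 \<longleftrightarrow> x \<in> Fq n" for x
    by (simp add: p_def poly_monom Fq_def Q_def)
  show fin: "finite_subfield (Fq n :: 'k alg_closure set)"
  proof
    show "finite (Fq n :: 'k alg_closure set)"
      using poly_roots_finite[OF \<open>p \<noteq> 0\<close>] by (simp add: roots)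
    show "- a \<in> Fq n" if "a \<in> Fq n" for a :: "'k alg_closure"
    proof -
      have "(a + - a) ^ Q = 0" using \<open>Q > 1\<close> by simp
      then have "a ^ Q + (- a) ^ Q = 0" by (simp only: add)
      then show ?thesis using that by (simp add: Fq_def Q_def add_eq_0_iff)
    qed
  qed (use add \<open>Q > 1\<close> in \<open>auto simp: Fq_def Q_def power_mult_distrib power_inverse power_0_left\<close>)
  have "of_nat Q = (0 :: 'k alg_closure)"
    using CHAR n by (simp add: Q_def)
  then have "pderiv p = -1"
    by (simp add: p_def pderiv_diff pderiv_monom monom_0 one_pCons)
  obtain A where A: "size A = degree p" "p = smult (lead_coeff p) (\<Prod>x\<in>#A. [:-x, 1:])"
    using alg_closed_imp_factorization[OF \<open>p \<noteq> 0\<close>] by blast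
  have lc: "lead_coeff p = 1" by (simp add: \<open>degree p = Q\<close> coeff)
  have pA: "p = (\<Prod>x\<in>#A. [:-x, 1:])" using A(2) lc by simp
  have poly_prod: "poly (\<Prod>x\<in>#B. [:-x, 1:]) y = 0 \<longleftrightarrow> y \<in># B" for B and y :: "'k alg_closure"
  proof (induction B)
    case (add x B)
    have "poly (\<Prod>x\<in>#add_mset x B. [:-x, 1:]) y = (y - x) * poly (\<Prod>x\<in>#B. [:-x, 1:]) y"
      by (simp only: image_mset_add_mset prod_mset.add_mset poly_mult) simp
    with add show ?case by simp
  qed simp
  have "count A x = 1" if x: "x \<in># A" for x
  proof (rule ccontr)
    assume "count A x \<noteq> 1"
    obtain C where C: "A = add_mset x C"
      using multi_member_split[OF x] by blast
    have "x \<in># C"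
      using \<open>count A x \<noteq> 1\<close> by (simp add: C count_eq_zero_iff)
    from multi_member_split[OF this] obtain B where B: "C = add_mset x B" by blast
    have "p = [:-x, 1:] * ([:-x, 1:] * (\<Prod>x\<in>#B. [:-x, 1:]))"
      by (subst pA) (simp only: B C image_mset_add_mset prod_mset.add_mset)
    then have "poly (pderiv p) x = 0"
      by (simp add: pderiv_mult del: mult_pCons_left)
    then show False using \<open>pderiv p = -1\<close> by simp
  qed
  then have "size A = card (set_mset A)"
    by (simp add: size_multiset_overloaded_eq)
  also have "set_mset A = Fq n"
    using roots poly_prod[of A] pA by auto
  finally show "card (Fq n :: 'k alg_closure set) = CARD('k) ^ n"
    using A(1) \<open>degree p = Q\<close> by (simp add: Q_def)
qed

end

lemma to_ac_in_Fq: "to_ac (c :: 'k::{field, finite}) \<in> Fq n"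
proof -
  have "c ^ (CARD('k) ^ n) = c"
    by (induction n) (simp_all add: power_mult card_power_eq_same)
  then show ?thesis by (simp add: Fq_def flip: to_ac_power)
qed

text \<open>\<open>Fq N\<close> has more than \<open>N\<close> elements for every positive
  \<open>N\<close>. This allows a polynomial in a scaling factor to be read off from its
  values.\<close>

lemma infinite_alg_closure: "infinite (UNIV :: 'k::{field, finite} alg_closure set)"
proof
  assume fin: "finite (UNIV :: 'k alg_closure set)"
  define N where "N = Suc (card (UNIV :: 'k alg_closure set))"
  have "card (Fq N :: 'k alg_closure set) < N"
    using card_mono[OF fin, of "Fq N"] by (simp add: N_def)
  moreover have "N < CARD('k) ^ N"
    using CARD_field_ge_2[where 'k = 'k] by (metis less_exp order_less_le_trans power_mono zero_le)
  ultimately show False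
    using card_Fq[of N, where 'k = 'k] by (simp add: N_def)
qed

section \<open>Zeta functions with point counts that are sums of powers\<close>

text \<open>The series of \<open>- log (1 - a T)\<close>.\<close>

definition log_series :: "'a::field_char_0 \<Rightarrow> 'a fps" where
  "log_series a = Abs_fps (\<lambda>n. if n = 0 then 0 else a ^ n / of_nat n)"

lemma fps_deriv_compose_exp:
  assumes "g $ 0 = (0::'a::field_char_0)"
  shows "fps_deriv (fps_exp 1 oo g) = (fps_exp 1 oo g) * fps_deriv g"
  using assms by (simp add: fps_compose_deriv)

text \<open>The quotient \<open>e / f\<close> has derivative zero. The functional equation of the
  exponential and its value on \<open>log_series\<close> both follow from a common linear
  differential equation.\<close>

lemma fps_linear_ODE_unique:
  assumes "fps_deriv e = e * g" "fps_deriv f = f * g" "e $ 0 = 1" "f $ 0 = (1 :: 'a::field_char_0)"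
  shows "e = f"
proof -
  have "f * inverse f = 1"
    using assms by (simp add: inverse_mult_eq_1')
  have "fps_deriv (e * inverse f) = 0"
  proof -
    have "fps_deriv (e * inverse f) = e * g * inverse f - e * (f * g) * (inverse f)\<^sup>2"
      using assms by (simp add: fps_inverse_deriv algebra_simps)
    also have "\<dots> = e * g * inverse f * (1 - f * inverse f)"
      by (simp add: algebra_simps power2_eq_square)
    finally show ?thesis using \<open>f * inverse f = 1\<close> by simp
  qed
  then have "e * inverse f = fps_const ((e * inverse f) $ 0)"
    using fps_deriv_eq_0_iff by blast
  also have "(e * inverse f) $ 0 = 1"
    using assms by simp
  finally have "e * inverse f = 1" by simp
  then have "e * (inverse f * f) = f"
    by (metis mult.assoc mult_1)
  then show ?thesis
    using \<open>f * inverse f = 1\<close> by (simp add: mult.commute)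
qed

lemma fps_exp_compose_add:
  assumes "f $ 0 = (0::'a::field_char_0)" "g $ 0 = 0"
  shows "fps_exp 1 oo (f + g) = (fps_exp 1 oo f) * (fps_exp 1 oo g)"
proof (rule fps_linear_ODE_unique)
  show "fps_deriv (fps_exp 1 oo (f + g)) = (fps_exp 1 oo (f + g)) * (fps_deriv f + fps_deriv g)"
    using fps_deriv_compose_exp[of "f + g"] assms by simp
  show "fps_deriv ((fps_exp 1 oo f) * (fps_exp 1 oo g)) =
     ((fps_exp 1 oo f) * (fps_exp 1 oo g)) * (fps_deriv f + fps_deriv g)"
    using assms by (simp add: fps_deriv_compose_exp algebra_simps)
qed simp_all

lemma fps_exp_compose_log_series:
  "fps_exp 1 oo log_series a = inverse (1 - fps_const (a::'a::field_char_0) * fps_X)"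
proof (rule fps_linear_ODE_unique)
  let ?i = "inverse (1 - fps_const a * fps_X)"
  have inv: "?i = Abs_fps (\<lambda>n. a ^ n)"
  proof (rule fps_inverse_unique)
    have "(fps_const a * (fps_X * Abs_fps (\<lambda>n. a ^ n))) $ n = (if n = 0 then 0 else a ^ n)" for n
      by (cases n) simp_all
    then show "(1 - fps_const a * fps_X) * Abs_fps (\<lambda>n. a ^ n) = 1"
      by (auto simp: fps_eq_iff left_diff_distrib mult.assoc)
  qed
  have d: "fps_deriv (log_series a) = fps_const a * ?i"
    by (rule fps_ext) (simp add: log_series_def inv del: of_nat_Suc)
  show "fps_deriv (fps_exp 1 oo log_series a) = (fps_exp 1 oo log_series a) * (fps_const a * ?i)"
    by (subst d[symmetric], rule fps_deriv_compose_exp) (simp add: log_series_def)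
  show "fps_deriv ?i = ?i * (fps_const a * ?i)"
    by (simp add: fps_inverse_deriv power2_eq_square algebra_simps)
qed simp_all

text \<open>The exponential turns the sum of logarithm series into a product, and the multiplicities
  \<open>e i\<close> into exponents.\<close>

lemma zeta_power_sums:
  assumes "finite S"
    and "\<And>n. n > 0 \<Longrightarrow> of_nat (card (V n)) = (\<Sum>i\<in>S. of_nat (e i) * a i ^ n :: rat)"
  shows "zeta V = 1 / (\<Prod>i\<in>S. (1 - fps_const (a i) * fps_X) ^ e i)"
proof -
  define G where "G T = Abs_fps (\<lambda>n. if n = 0 then 0 else (\<Sum>i\<in>T. of_nat (e i) * a i ^ n :: rat) / of_nat n)"
    for T
  have one: "fps_exp 1 oo (fps_const (of_nat k) * log_series b) =
      inverse ((1 - fps_const (b::rat) * fps_X) ^ k)" for k b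
  proof (induction k)
    case (Suc k)
    have "fps_const (of_nat (Suc k)) * log_series b = log_series b + fps_const (of_nat k) * log_series b"
      by (auto simp: fps_eq_iff algebra_simps)
    moreover have "log_series b $ 0 = 0"
      by (simp add: log_series_def)
    ultimately show ?case
      using Suc by (simp add: fps_exp_compose_add fps_exp_compose_log_series fps_inverse_mult
        del: of_nat_Suc)
  qed simp
  have "fps_exp 1 oo G T = inverse (\<Prod>i\<in>T. (1 - fps_const (a i) * fps_X) ^ e i)" if "finite T" for T
    using that
  proof (induction T rule: finite_induct)
    case empty
    have "G {} = 0" by (simp add: G_def fps_eq_iff)
    then show ?case by simp
  next
    case (insert i T)
    have "G (insert i T) = fps_const (of_nat (e i)) * log_series (a i) + G T"
      using insert.hyps by (auto simp: G_def log_series_def fps_eq_iff add_divide_distrib)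
    moreover have "log_series (a i) $ 0 = 0" "G T $ 0 = 0"
      by (simp_all add: log_series_def G_def)
    ultimately show ?case
      using insert by (simp add: fps_exp_compose_add one fps_inverse_mult)
  qed
  moreover have "zeta V = fps_exp 1 oo G S"
    unfolding zeta_def G_def
    by (rule arg_cong[where f = "fps_compose (fps_exp 1)"]) (auto simp: fps_eq_iff assms(2))
  moreover have "(\<Prod>i\<in>S. (1 - fps_const (a i) * fps_X) ^ e i) $ 0 = 1"
    using assms(1) by (induction S rule: finite_induct) (simp_all add: fps_power_zeroth)
  ultimately show ?thesis
    using assms(1) by (simp add: fps_divide_unit)
qed

section \<open>Counting over finite fields\<close>

lemma int_card_Sigma:
  assumes "finite A" "\<And>x. x \<in> A \<Longrightarrow> finite (B x)"
  shows "int (card (SIGMA x:A. B x)) = (\<Sum>x\<in>A. int (card (B x)))"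
  using assms by (simp add: card_SigmaI)

lemma sum_if_int:
  assumes "finite A"
  shows "(\<Sum>x\<in>A. if P x then a else b) =
    a * int (card {x \<in> A. P x}) + b * (int (card A) - int (card {x \<in> A. P x}))"
proof -
  have "card A = card {x \<in> A. P x} + card {x \<in> A. \<not> P x}"
    using assms by (subst card_Un_disjoint[symmetric]) (auto intro: arg_cong[where f = card])
  then show ?thesis
    using assms by (simp add: sum.If_cases Int_def)
qed

lemma card_eq_witness:
  assumes "\<And>a. a \<in> A \<Longrightarrow> f a \<in> B \<and> g (f a) = a" "\<And>b. b \<in> B \<Longrightarrow> g b \<in> A \<and> f (g b) = b"
  shows "card A = card B"
  by (rule bij_betw_same_card[OF bij_betw_byWitness[where f = f and f' = g]]) (use assms in auto)

section \<open>Counts of quadrics and lines over a finite field of characteristic other than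
  3\<close>

locale counting = finite_subfield L for L :: "'b::field set" +
  assumes three: "(3 :: 'b) \<noteq> 0"
begin

abbreviation q :: int where "q \<equiv> int (card L)"

lemma card_L_minus: "a \<in> L \<Longrightarrow> int (card (L - {a})) = q - 1"
  using finite_L card_L_ge_2 by (simp add: of_nat_diff)

lemma card_L_minus2: "a \<in> L \<Longrightarrow> b \<in> L \<Longrightarrow> a \<noteq> b \<Longrightarrow> int (card (L - {a, b})) = q - 2"
  using finite_L card_L_ge_2 by (simp add: card_Diff_subset of_nat_diff)

lemma card_mult_eq:
  assumes "c \<in> L"
  shows "int (card {(a, b). a \<in> L \<and> b \<in> L \<and> a * b = c}) = (if c = 0 then 2 * q - 1 else q - 1)"
proof -
  have "{(a, b). a \<in> L \<and> b \<in> L \<and> a * b = c} = (SIGMA a:L. {b \<in> L. a * b = c})"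
    by auto
  then have "int (card {(a, b). a \<in> L \<and> b \<in> L \<and> a * b = c}) = (\<Sum>a\<in>L. int (card {b \<in> L. a * b = c}))"
    using finite_L by (simp add: int_card_Sigma)
  also have "\<dots> = (\<Sum>a\<in>L. if a = 0 then (if c = 0 then q else 0) else 1)"
  proof (rule sum.cong)
    fix a assume "a \<in> L"
    have "{b \<in> L. a * b = c} = {c / a}" if "a \<noteq> 0"
      using that \<open>a \<in> L\<close> assms by (auto simp: field_simps)
    then show "int (card {b \<in> L. a * b = c}) = (if a = 0 then (if c = 0 then q else 0) else 1)"
      by auto
  qed simp
  also have "\<dots> = (if c = 0 then 2 * q - 1 else q - 1)"
  proof -
    have "{x \<in> L. x = 0} = {0}" by auto
    then show ?thesis using finite_L by (subst sum_if_int) auto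
  qed
  finally show ?thesis .
qed

text \<open>The quadrics at the nodes are brought to the form \<open>a * b = f p\<close>, so that
  only the zeros of \<open>f\<close> have to be counted.\<close>

lemma card_mult_eq_on:
  assumes "finite P" "\<And>p. p \<in> P \<Longrightarrow> f p \<in> L"
  shows "int (card {(p, a, b). p \<in> P \<and> a \<in> L \<and> b \<in> L \<and> a * b = f p}) =
    (2 * q - 1) * int (card {p \<in> P. f p = 0}) + (q - 1) * (int (card P) - int (card {p \<in> P. f p = 0}))"
proof -
  have "{(p, a, b). p \<in> P \<and> a \<in> L \<and> b \<in> L \<and> a * b = f p} =
      (SIGMA p:P. {(a, b). a \<in> L \<and> b \<in> L \<and> a * b = f p})"
    by auto
  moreover have "finite {(a, b). a \<in> L \<and> b \<in> L \<and> a * b = c}" for c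
    by (rule finite_subset[of _ "L \<times> L"]) (use finite_L in auto)
  ultimately have "int (card {(p, a, b). p \<in> P \<and> a \<in> L \<and> b \<in> L \<and> a * b = f p}) =
      (\<Sum>p\<in>P. if f p = 0 then 2 * q - 1 else q - 1)"
    using assms by (simp add: int_card_Sigma card_mult_eq)
  then show ?thesis
    using assms(1) by (simp add: sum_if_int)
qed

text \<open>The affine cone over a split quadric surface: \<open>1 + (q - 1) * (q + 1) ^ 2\<close>
  vectors.\<close>

lemma card_hyperbolic:
  "int (card {((c, d), a, b). c \<in> L \<and> d \<in> L \<and> a \<in> L \<and> b \<in> L \<and> a * b = k * (c * d)}) = q ^ 3 + q ^ 2 - q"
  if k: "k \<in> L" "k \<noteq> 0"
proof -
  have Z: "{p \<in> L \<times> L. k * (fst p * snd p) = 0} = {(c, d). c \<in> L \<and> d \<in> L \<and> c * d = 0}"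
    using k by auto
  have "{((c, d), a, b). c \<in> L \<and> d \<in> L \<and> a \<in> L \<and> b \<in> L \<and> a * b = k * (c * d)} =
     {(p, a, b). p \<in> L \<times> L \<and> a \<in> L \<and> b \<in> L \<and> a * b = k * (fst p * snd p)}"
    by auto
  then have "int (card {((c, d), a, b). c \<in> L \<and> d \<in> L \<and> a \<in> L \<and> b \<in> L \<and> a * b = k * (c * d)}) =
     (2 * q - 1) * int (card {p \<in> L \<times> L. k * (fst p * snd p) = 0})
       + (q - 1) * (int (card (L \<times> L)) - int (card {p \<in> L \<times> L. k * (fst p * snd p) = 0}))"
    using card_mult_eq_on[of "L \<times> L" "\<lambda>p. k * (fst p * snd p)"] finite_L k by (simp only:) auto
  then show ?thesis
    unfolding Z card_mult_eq[OF zero_L]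
    by (simp add: card_cartesian_product algebra_simps power2_eq_square power3_eq_cube)
qed

lemma card_linear:
  assumes p: "p \<in> L" "p \<noteq> 0" and r: "r \<in> L" "r \<noteq> 0" and c: "c \<in> L"
  shows "int (card {(a, b). a \<in> L - {0} \<and> b \<in> L - {0} \<and> p * a + r * b = c}) = (if c = 0 then q - 1 else q - 2)"
proof -
  have "card {(a, b). a \<in> L - {0} \<and> b \<in> L - {0} \<and> p * a + r * b = c} = card (L - {0, c / p})"
    by (rule card_eq_witness[where f = fst and g = "\<lambda>a. (a, (c - p * a) / r)"])
      (use assms in \<open>auto simp: field_simps\<close>)
  then show ?thesis
    using c p card_L_minus[of 0] card_L_minus2[of 0 "c / p"] by auto
qed

text \<open>Three lines in the plane, which pass through one point exactly when
  \<open>s = 0\<close>.\<close>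

lemma card_triangle:
  assumes s: "s \<in> L"
  shows "int (card {(a, b). a \<in> L \<and> b \<in> L \<and> a * b * (s - a - b) = 0}) = (if s = 0 then 3 * q - 2 else 3 * q - 3)"
proof -
  have "{(a, b). a \<in> L \<and> b \<in> L \<and> a * b * (s - a - b) = 0} = (SIGMA a:L. {b \<in> L. a * b * (s - a - b) = 0})"
    by auto
  then have "int (card {(a, b). a \<in> L \<and> b \<in> L \<and> a * b * (s - a - b) = 0}) =
      (\<Sum>a\<in>L. int (card {b \<in> L. a * b * (s - a - b) = 0}))"
    using finite_L by (simp add: int_card_Sigma)
  also have "\<dots> = (\<Sum>a\<in>L. if a = 0 then q else if a = s then 1 else 2)"
  proof (rule sum.cong)
    fix a assume "a \<in> L"
    have "{b \<in> L. a * b * (s - a - b) = 0} = {0, s - a}" if "a \<noteq> 0"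
      using that \<open>a \<in> L\<close> s by auto
    then show "int (card {b \<in> L. a * b * (s - a - b) = 0}) = (if a = 0 then q else if a = s then 1 else 2)"
      by auto
  qed simp
  also have "\<dots> = q + (\<Sum>a\<in>L - {0}. if a = s then 1 else 2)"
    using finite_L by (subst sum.remove[of _ 0]) (auto intro!: sum.cong)
  also have "(\<Sum>a\<in>L - {0}. if a = s then 1 else 2 :: int) = (if s = 0 then 2 * q - 2 else 2 * q - 3)"
  proof -
    have "{a \<in> L - {0}. a = s} = (if s = 0 then {} else {s})" using s by auto
    then show ?thesis
      using finite_L card_L_minus[of 0] by (subst sum_if_int) auto
  qed
  finally show ?thesis by auto
qed

text \<open>The affine part \<open>y\<^sub>0 = 1\<close> of the Burkhardt quartic, with \<open>m = - y\<^sub>4\<close>.\<close>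

definition affine_pts :: "('b \<times> 'b \<times> 'b \<times> 'b) set" where
  "affine_pts = {(m, a, b, c). m \<in> L \<and> a \<in> L \<and> b \<in> L \<and> c \<in> L \<and>
     a ^ 3 + b ^ 3 + c ^ 3 - 3 * m * a * b * c = m ^ 3 - 1}"

end

section \<open>The affine part when \<open>L\<close> contains a primitive cube root of unity\<close>

locale counting_split = counting L for L :: "'b::field set" +
  fixes w :: 'b
  assumes w_L: "w \<in> L" and w: "w ^ 2 + w + 1 = 0"
begin

lemma w_cube: "w ^ 3 = 1"
  using w by Groebner_Basis.algebra

lemma w_ne: "w \<noteq> 1" "w ^ 2 \<noteq> 1" "w ^ 2 \<noteq> w" "w \<noteq> 0"
proof -
  show "w \<noteq> 1" using w three by auto
  show "w \<noteq> 0" using w by auto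
  show "w ^ 2 \<noteq> w"
  proof
    assume "w ^ 2 = w"
    then have "w * (w - 1) = 0" by (simp add: power2_eq_square algebra_simps)
    with \<open>w \<noteq> 1\<close> \<open>w \<noteq> 0\<close> show False by simp
  qed
  show "w ^ 2 \<noteq> 1"
  proof
    assume "w ^ 2 = 1"
    then have "w ^ 3 = w" by (simp add: power3_eq_cube power2_eq_square)
    with w_cube \<open>w \<noteq> 1\<close> show False by simp
  qed
qed

lemma card_cubes:
  assumes "e \<in> L" "e \<noteq> 0"
  shows "{z \<in> L. z ^ 3 = e ^ 3} = {e, w * e, w ^ 2 * e}" "card {z \<in> L. z ^ 3 = e ^ 3} = 3"
proof -
  show *: "{z \<in> L. z ^ 3 = e ^ 3} = {e, w * e, w ^ 2 * e}"
  proof (intro equalityI subsetI)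
    fix z assume "z \<in> {z \<in> L. z ^ 3 = e ^ 3}"
    then have "(z - e) * (z - w * e) * (z - w ^ 2 * e) = 0"
      using w by simp Groebner_Basis.algebra
    then show "z \<in> {e, w * e, w ^ 2 * e}" by auto
  next
    fix z assume "z \<in> {e, w * e, w ^ 2 * e}"
    moreover have "(w * e) ^ 3 = e ^ 3" "(w ^ 2 * e) ^ 3 = e ^ 3"
      using w by Groebner_Basis.algebra+
    ultimately show "z \<in> {z \<in> L. z ^ 3 = e ^ 3}"
      using assms w_L by auto
  qed
  show "card {z \<in> L. z ^ 3 = e ^ 3} = 3"
    unfolding * using assms w_ne by auto
qed

lemma card_norm_zero: "int (card {(a, b). a \<in> L \<and> b \<in> L \<and> a ^ 2 - a * b + b ^ 2 = 0}) = 2 * q - 1"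
proof -
  have "{(a, b). a \<in> L \<and> b \<in> L \<and> a ^ 2 - a * b + b ^ 2 = 0} = (SIGMA a:L. {b \<in> L. a ^ 2 - a * b + b ^ 2 = 0})"
    by auto
  then have "int (card {(a, b). a \<in> L \<and> b \<in> L \<and> a ^ 2 - a * b + b ^ 2 = 0}) =
      (\<Sum>a\<in>L. int (card {b \<in> L. a ^ 2 - a * b + b ^ 2 = 0}))"
    using finite_L by (simp add: int_card_Sigma)
  also have "\<dots> = (\<Sum>a\<in>L. if a = 0 then 1 else 2)"
  proof (rule sum.cong)
    fix a assume "a \<in> L"
    have "a ^ 2 - a * b + b ^ 2 = (b - - (w * a)) * (b - - (w ^ 2 * a))" for b
      using w by Groebner_Basis.algebra
    then have "{b \<in> L. a ^ 2 - a * b + b ^ 2 = 0} = {- (w * a), - (w ^ 2 * a)}"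
      using w_L \<open>a \<in> L\<close> by (simp only: mult_eq_0_iff right_minus_eq) auto
    then show "int (card {b \<in> L. a ^ 2 - a * b + b ^ 2 = 0}) = (if a = 0 then 1 else 2)"
      using w_ne by auto
  qed simp
  also have "\<dots> = 2 * q - 1"
  proof -
    have "{x \<in> L. x = 0} = {0}" by auto
    then show ?thesis using finite_L by (subst sum_if_int) auto
  qed
  finally show ?thesis .
qed

text \<open>With \<open>l\<^sub>i = m y + w^i b + w^(2i) c\<close> the equation of the affine part becomes
  \<open>l\<^sub>0 l\<^sub>1 l\<^sub>2 = (m^3 - 1) (y^3 + 1)\<close> with \<open>l\<^sub>0 + l\<^sub>1 + l\<^sub>2 = 3 m y\<close>.\<close>

definition norm_pts :: "('b \<times> 'b \<times> 'b \<times> 'b) set" where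
  "norm_pts = {(m, y, l, l'). m \<in> L \<and> y \<in> L \<and> l \<in> L \<and> l' \<in> L \<and>
     l * l' * (3 * m * y - l - l') = (m ^ 3 - 1) * (y ^ 3 + 1)}"

lemma card_affine_norm_pts: "card affine_pts = card norm_pts"
proof -
  \<comment> \<open>The change of variables is a discrete Fourier transform of length 3.
    \<open>g\<close> is the inverse transform, with the third value eliminated as
    \<open>3 * m * y - l - l'\<close>.\<close>
  define f where "f = (\<lambda>(m, y, b, c). (m, y, m * y + b + c, m * y + w * b + w ^ 2 * c))"
  define g where "g = (\<lambda>(m, y, l, l'). (m, y,
    (l + w ^ 2 * l' + w * (3 * m * y - l - l')) / 3, (l + w * l' + w ^ 2 * (3 * m * y - l - l')) / 3))"
  have fL: "f p \<in> L \<times> L \<times> L \<times> L" "g p \<in> L \<times> L \<times> L \<times> L" if "p \<in> L \<times> L \<times> L \<times> L" for p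
    using that w_L by (auto simp: f_def g_def)
  have gf: "g (f p) = p" for p
  proof -
    obtain m y b c where p: "p = (m, y, b, c)" by (cases p) blast
    have "(m * y + b + c) + w ^ 2 * (m * y + w * b + w ^ 2 * c)
        + w * (3 * m * y - (m * y + b + c) - (m * y + w * b + w ^ 2 * c)) = 3 * b"
      using w by Groebner_Basis.algebra
    moreover have "(m * y + b + c) + w * (m * y + w * b + w ^ 2 * c)
        + w ^ 2 * (3 * m * y - (m * y + b + c) - (m * y + w * b + w ^ 2 * c)) = 3 * c"
      using w by Groebner_Basis.algebra
    ultimately show ?thesis using three by (simp only: p f_def g_def prod.case) simp
  qed
  have fg: "f (g p) = p" for p
  proof -
    obtain m y l l' where p: "p = (m, y, l, l')" by (cases p) blast
    define t where "t = inverse (3 :: 'b)"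
    have t: "3 * t = 1" using three by (simp add: t_def)
    have "m * y + (l + w ^ 2 * l' + w * (3 * m * y - l - l')) * t + (l + w * l' + w ^ 2 * (3 * m * y - l - l')) * t = l"
      using w t by Groebner_Basis.algebra
    moreover have "m * y + w * ((l + w ^ 2 * l' + w * (3 * m * y - l - l')) * t) + w ^ 2 * ((l + w * l' + w ^ 2 * (3 * m * y - l - l')) * t) = l'"
      using w t by Groebner_Basis.algebra
    ultimately show ?thesis by (simp only: p f_def g_def prod.case divide_inverse t_def[symmetric])
  qed
  have eq: "f p \<in> norm_pts \<longleftrightarrow> p \<in> affine_pts" if "p \<in> L \<times> L \<times> L \<times> L" for p
  proof -
    obtain m y b c where p: "p = (m, y, b, c)" by (cases p) blast
    define G where "G = y ^ 3 + b ^ 3 + c ^ 3 - 3 * m * y * b * c"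
    have "(m * y + b + c) * (m * y + w * b + w ^ 2 * c) * (3 * m * y - (m * y + b + c) - (m * y + w * b + w ^ 2 * c))
        - (m ^ 3 - 1) * (y ^ 3 + 1) = G - (m ^ 3 - 1)"
      unfolding G_def using w by Groebner_Basis.algebra
    then have "(m * y + b + c) * (m * y + w * b + w ^ 2 * c) * (3 * m * y - (m * y + b + c) - (m * y + w * b + w ^ 2 * c))
        = (m ^ 3 - 1) * (y ^ 3 + 1) \<longleftrightarrow> G = m ^ 3 - 1"
      by (metis right_minus_eq)
    then show ?thesis
      using that fL(1)[OF that] by (simp add: p f_def norm_pts_def affine_pts_def G_def)
  qed
  show ?thesis
  proof (rule card_eq_witness[where f = f and g = g])
    fix p assume p: "p \<in> affine_pts"
    then have "p \<in> L \<times> L \<times> L \<times> L" by (auto simp: affine_pts_def)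
    with eq p gf show "f p \<in> norm_pts \<and> g (f p) = p" by blast
  next
    fix p assume p: "p \<in> norm_pts"
    then have "p \<in> L \<times> L \<times> L \<times> L" by (auto simp: norm_pts_def)
    then have "g p \<in> L \<times> L \<times> L \<times> L" by (rule fL)
    with eq[of "g p"] p fg[of p] show "g p \<in> affine_pts \<and> f (g p) = p" by simp
  qed
qed

definition M :: "'b set" where "M = {m \<in> L. m ^ 3 \<noteq> 1}"

lemma card_cube_minus_1: "card {z \<in> L. z ^ 3 = - 1} = 3"
  using card_cubes(2)[of "- 1"] by simp

lemma card_cube_1: "card {z \<in> L. z ^ 3 = 1} = 3"
  using card_cubes(2)[of 1] by simp

lemma finite_M: "finite M"
  using finite_L by (simp add: M_def)

lemma card_M: "int (card M) = q - 3"
proof -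
  have "card L = card M + card {z \<in> L. z ^ 3 = 1}"
    unfolding M_def using finite_L
    by (subst card_Un_disjoint[symmetric]) (auto intro: arg_cong[where f = card])
  then show ?thesis by (simp add: card_cube_1)
qed

lemma card_cube_not_minus_1: "int (card {y \<in> L. y ^ 3 \<noteq> - 1}) = q - 3"
proof -
  have "card L = card {y \<in> L. y ^ 3 \<noteq> - 1} + card {z \<in> L. z ^ 3 = - 1}"
    using finite_L by (subst card_Un_disjoint[symmetric]) (auto intro: arg_cong[where f = card])
  then show ?thesis by (simp add: card_cube_minus_1)
qed

text \<open>The right-hand side vanishes here, so \<open>(l, l')\<close> runs through a triangle of
  lines over each \<open>(m, y)\<close>. The base is a grid of 3 + 3 lines with 9 crossings, hence
  \<open>6 * q - 9\<close> points; at the 6 of them with \<open>m * y = 0\<close> the triangle is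
  concurrent.\<close>

lemma card_norm_pts_degenerate:
  "int (card {(m, y, l, l') \<in> norm_pts. m ^ 3 = 1 \<or> y ^ 3 = - 1}) = 18 * q ^ 2 - 45 * q + 33"
proof -
  define P where "P = {(m, y) \<in> L \<times> L. m ^ 3 = 1 \<or> y ^ 3 = - 1}"
  have fP: "finite P"
    unfolding P_def by (rule finite_subset[of _ "L \<times> L"]) (use finite_L in auto)
  have cP: "int (card P) = 6 * q - 9"
  proof -
    have "card (L \<times> L) = card P + card (M \<times> {y \<in> L. y ^ 3 \<noteq> - 1})"
    proof -
      have "L \<times> L = P \<union> M \<times> {y \<in> L. y ^ 3 \<noteq> - 1}" "P \<inter> M \<times> {y \<in> L. y ^ 3 \<noteq> - 1} = {}"
        by (auto simp: P_def M_def)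
      then show ?thesis using fP finite_M finite_L by (metis (no_types, lifting) card_Un_disjoint finite_SigmaI finite_subset mem_Collect_eq subsetI)
    qed
    then have "q * q = int (card P) + (q - 3) * (q - 3)"
      by (simp add: card_cartesian_product card_M card_cube_not_minus_1 flip: of_nat_mult)
        (metis card_M card_cube_not_minus_1 of_nat_add of_nat_mult)
    then show ?thesis by (simp add: algebra_simps)
  qed
  have c0: "card {p \<in> P. 3 * fst p * snd p = 0} = 6"
  proof -
    have "{p \<in> P. 3 * fst p * snd p = 0} = {0} \<times> {y \<in> L. y ^ 3 = - 1} \<union> {m \<in> L. m ^ 3 = 1} \<times> {0}"
      using three by (auto simp: P_def)
    moreover have "({0} \<times> {y \<in> L. y ^ 3 = - 1}) \<inter> ({m \<in> L. m ^ 3 = 1} \<times> {0}) = {}" by auto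
    ultimately show ?thesis
      using finite_L by (simp add: card_Un_disjoint card_cartesian_product card_cube_1 card_cube_minus_1)
  qed
  have im: "{(m, y, l, l') \<in> norm_pts. m ^ 3 = 1 \<or> y ^ 3 = - 1} =
     (\<lambda>(p, l, l'). (fst p, snd p, l, l')) ` (SIGMA p:P. {(l, l'). l \<in> L \<and> l' \<in> L \<and> l * l' * (3 * fst p * snd p - l - l') = 0})"
    (is "_ = ?f ` ?S")
  proof (intro equalityI subsetI)
    fix p assume "p \<in> {(m, y, l, l') \<in> norm_pts. m ^ 3 = 1 \<or> y ^ 3 = - 1}"
    then obtain m y l l' where p: "p = (m, y, l, l')" and "(m, y, l, l') \<in> norm_pts" "m ^ 3 = 1 \<or> y ^ 3 = - 1" by auto
    then have "((m, y), l, l') \<in> ?S" by (auto simp: norm_pts_def P_def)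
    then show "p \<in> ?f ` ?S" unfolding p by (rule rev_image_eqI) simp
  next
    fix p assume "p \<in> ?f ` ?S"
    then show "p \<in> {(m, y, l, l') \<in> norm_pts. m ^ 3 = 1 \<or> y ^ 3 = - 1}"
      by (auto simp: norm_pts_def P_def)
  qed
  have inj: "inj_on ?f ?S" by (auto simp: inj_on_def)
  have "finite {(l, l'). l \<in> L \<and> l' \<in> L \<and> l * l' * (s - l - l') = 0}" for s
    by (rule finite_subset[of _ "L \<times> L"]) (use finite_L in auto)
  then have "int (card ?S) = (\<Sum>p\<in>P. int (card {(l, l'). l \<in> L \<and> l' \<in> L \<and> l * l' * (3 * fst p * snd p - l - l') = 0}))"
    using fP by (simp only: int_card_Sigma)
  then have "int (card ?S) = (\<Sum>p\<in>P. if 3 * fst p * snd p = 0 then 3 * q - 2 else 3 * q - 3)"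
    unfolding P_def by (simp only:) (intro sum.cong refl card_triangle, auto)
  then have cS: "int (card ?S) = (3 * q - 2) * int (card {p \<in> P. 3 * fst p * snd p = 0})
      + (3 * q - 3) * (int (card P) - int (card {p \<in> P. 3 * fst p * snd p = 0}))"
    using fP by (simp add: sum_if_int)
  show ?thesis
    unfolding im card_image[OF inj] cS c0 cP by (simp add: algebra_simps power2_eq_square)
qed

definition third :: "'b \<times> 'b \<times> 'b \<Rightarrow> 'b" where
  "third = (\<lambda>(m, a, b). (m ^ 3 - 1) / (a * b))"

lemma third_third:
  assumes "m ^ 3 \<noteq> 1" "a \<noteq> 0" "b \<noteq> 0"
  shows "third (m, b, third (m, a, b)) = a" "third (m, a, third (m, a, b)) = b"
    "third (m, third (m, a, b), a) = b" "third (m, a, b) \<noteq> 0"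
proof -
  define k where "k = m ^ 3 - 1"
  have "k \<noteq> 0" using assms by (simp add: k_def)
  then show "third (m, b, third (m, a, b)) = a" "third (m, a, third (m, a, b)) = b"
    "third (m, third (m, a, b), a) = b" "third (m, a, b) \<noteq> 0"
    using assms by (simp_all add: third_def k_def[symmetric])
qed

definition E :: "('b \<times> 'b \<times> 'b) set" where
  "E = {(m, a, b). m \<in> M \<and> a \<in> L - {0} \<and> b \<in> L - {0}}"

text \<open>Write the three factors of \<open>(m ^ 3 - 1) * (y ^ 3 + 1)\<close> as
  \<open>a * (y + 1)\<close>, \<open>b * (y + w)\<close> and \<open>c * (y + w ^ 2)\<close> with
  \<open>c = third (m, a, b)\<close>. Their sum must be \<open>3 * m * y\<close>, and this is the
  equation \<open>y * D + B = 0\<close>, linear in \<open>y\<close>.\<close>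

definition D :: "'b \<times> 'b \<times> 'b \<Rightarrow> 'b" where
  "D = (\<lambda>(m, a, b). a + b + third (m, a, b) - 3 * m)"

definition B :: "'b \<times> 'b \<times> 'b \<Rightarrow> 'b" where
  "B = (\<lambda>(m, a, b). a + w * b + w ^ 2 * third (m, a, b))"

lemma E_L:
  assumes "e \<in> E"
  shows "third e \<in> L" "D e \<in> L" "B e \<in> L"
  using assms w_L by (auto simp: E_def third_def D_def B_def M_def)

lemma finite_E: "finite E"
  by (rule finite_subset[of _ "L \<times> L \<times> L"]) (use finite_L in \<open>auto simp: E_def M_def\<close>)

lemma card_E: "int (card E) = (q - 3) * (q - 1) ^ 2"
proof -
  have "E = M \<times> (L - {0}) \<times> (L - {0})" by (auto simp: E_def)
  then have "int (card E) = int (card M) * (int (card (L - {0})) * int (card (L - {0})))"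
    by (simp only: card_cartesian_product of_nat_mult)
  then show ?thesis
    using card_L_minus[of 0] by (simp only: card_M power2_eq_square zero_L)
qed

text \<open>Since \<open>y ^ 3\<close> is not -1, the factors \<open>y + 1\<close>,
  \<open>y + w\<close> and \<open>y + w ^ 2\<close> are nonzero. Dividing by them leaves
  \<open>y\<close> as the only unknown over \<open>E\<close>.\<close>

lemma card_norm_pts_generic:
  "card {(m, y, l, l') \<in> norm_pts. m ^ 3 \<noteq> 1 \<and> y ^ 3 \<noteq> - 1} =
   card (SIGMA e:E. {y \<in> L. y ^ 3 \<noteq> - 1 \<and> y * D e + B e = 0})"
proof -
  define f :: "'b \<times> 'b \<times> 'b \<times> 'b \<Rightarrow> ('b \<times> 'b \<times> 'b) \<times> 'b"
    where "f = (\<lambda>(m, y, l, l'). ((m, l / (y + 1), l' / (y + w)), y))"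
  define g :: "('b \<times> 'b \<times> 'b) \<times> 'b \<Rightarrow> 'b \<times> 'b \<times> 'b \<times> 'b"
    where "g = (\<lambda>((m, a, b), y). (m, y, a * (y + 1), b * (y + w)))"
  have fac: "(y + 1) * (y + w) * (y + w ^ 2) = y ^ 3 + 1" for y
    using w by Groebner_Basis.algebra
  have ne: "y + 1 \<noteq> 0" "y + w \<noteq> 0" "y + w ^ 2 \<noteq> 0" if "y ^ 3 \<noteq> - 1" for y
  proof -
    have "(y + 1) * (y + w) * (y + w ^ 2) \<noteq> 0"
      unfolding fac using that by (metis add_eq_0_iff2)
    then show "y + 1 \<noteq> 0" "y + w \<noteq> 0" "y + w ^ 2 \<noteq> 0" by auto
  qed
  have key: "a * (y + 1) * (b * (y + w)) * (3 * m * y - a * (y + 1) - b * (y + w)) = (m ^ 3 - 1) * (y ^ 3 + 1)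
     \<longleftrightarrow> y * D (m, a, b) + B (m, a, b) = 0" if y: "y ^ 3 \<noteq> - 1" and ab: "a \<noteq> 0" "b \<noteq> 0" for a b m y
  proof -
    define c where "c = third (m, a, b)"
    have c: "a * b * c = m ^ 3 - 1" using ab by (simp add: c_def third_def)
    have D: "D (m, a, b) = a + b + c - 3 * m" and B: "B (m, a, b) = a + w * b + w ^ 2 * c"
      by (simp_all add: D_def B_def c_def)
    have "a * (y + 1) * (b * (y + w)) * (3 * m * y - a * (y + 1) - b * (y + w)) - (m ^ 3 - 1) * (y ^ 3 + 1)
      = - (a * b * ((y + 1) * (y + w)) * (y * (a + b + c - 3 * m) + (a + w * b + w ^ 2 * c)))"
      unfolding c[symmetric] fac[symmetric] by (simp add: algebra_simps)
    then have "a * (y + 1) * (b * (y + w)) * (3 * m * y - a * (y + 1) - b * (y + w)) = (m ^ 3 - 1) * (y ^ 3 + 1)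
       \<longleftrightarrow> a * b * ((y + 1) * (y + w)) * (y * (a + b + c - 3 * m) + (a + w * b + w ^ 2 * c)) = 0"
      by (metis neg_equal_0_iff_equal right_minus_eq)
    then show ?thesis
      unfolding D B using ab ne[OF y] by simp
  qed
  show ?thesis
  proof (rule card_eq_witness[of _ f _ g])
  fix p assume "p \<in> {(m, y, l, l') \<in> norm_pts. m ^ 3 \<noteq> 1 \<and> y ^ 3 \<noteq> - 1}"
  then obtain m y l l' where p: "p = (m, y, l, l')" and in_L: "m \<in> L" "y \<in> L" "l \<in> L" "l' \<in> L"
    and eq: "l * l' * (3 * m * y - l - l') = (m ^ 3 - 1) * (y ^ 3 + 1)" and m: "m ^ 3 \<noteq> 1" and y: "y ^ 3 \<noteq> - 1"
    by (auto simp: norm_pts_def)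
  define a where "a = l / (y + 1)"
  define b where "b = l' / (y + w)"
  have l: "l = a * (y + 1)" "l' = b * (y + w)" using ne[OF y] by (simp_all add: a_def b_def)
  have "(m ^ 3 - 1) * (y ^ 3 + 1) \<noteq> 0" using m y by (metis add_eq_0_iff2 mult_eq_0_iff right_minus_eq)
  then have ab: "a \<noteq> 0" "b \<noteq> 0" using eq l by auto
  have "y * D (m, a, b) + B (m, a, b) = 0" using key[OF y ab, of m] eq l by simp
  moreover have "a \<in> L" "b \<in> L" using in_L w_L by (simp_all add: a_def b_def)
  ultimately have "((m, a, b), y) \<in> (SIGMA e:E. {y \<in> L. y ^ 3 \<noteq> - 1 \<and> y * D e + B e = 0})"
    using in_L m y ab by (simp add: E_def M_def)
  moreover have "f p = ((m, a, b), y)" "g ((m, a, b), y) = p"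
    using ne[OF y] by (simp_all add: p f_def g_def l)
  ultimately show "f p \<in> (SIGMA e:E. {y \<in> L. y ^ 3 \<noteq> - 1 \<and> y * D e + B e = 0}) \<and> g (f p) = p"
    by simp
next
  fix e assume "e \<in> (SIGMA e:E. {y \<in> L. y ^ 3 \<noteq> - 1 \<and> y * D e + B e = 0})"
  then obtain m a b y where e: "e = ((m, a, b), y)" and E: "(m, a, b) \<in> E" and y: "y \<in> L" "y ^ 3 \<noteq> - 1"
    and eq: "y * D (m, a, b) + B (m, a, b) = 0"
    by auto
  note ne = ne[OF y(2)]
  have ab: "a \<in> L" "b \<in> L" "a \<noteq> 0" "b \<noteq> 0" "m \<in> L" "m ^ 3 \<noteq> 1" using E by (auto simp: E_def M_def)
  define c where "c = third (m, a, b)"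
  have c: "a * b * c = m ^ 3 - 1" using ab by (simp add: c_def third_def)
  have "3 * m * y - a * (y + 1) - b * (y + w) = c * (y + w ^ 2)"
    using eq by (simp add: D_def B_def c_def[symmetric] algebra_simps)
  then have "a * (y + 1) * (b * (y + w)) * (3 * m * y - a * (y + 1) - b * (y + w)) = (m ^ 3 - 1) * (y ^ 3 + 1)"
    unfolding c[symmetric] fac[symmetric] by (simp add: algebra_simps)
  then show "g e \<in> {(m, y, l, l') \<in> norm_pts. m ^ 3 \<noteq> 1 \<and> y ^ 3 \<noteq> - 1} \<and> f (g e) = e"
    using ab y ne w_L by (simp add: e norm_pts_def f_def g_def)
  qed
qed

lemma card_fibre:
  assumes "e \<in> E"
  shows "int (card {y \<in> L. y ^ 3 \<noteq> - 1 \<and> y * D e + B e = 0}) =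
    (if D e = 0 then if B e = 0 then q - 3 else 0 else if B e ^ 3 = D e ^ 3 then 0 else 1)"
proof (cases "D e = 0")
  case True
  then show ?thesis using card_cube_not_minus_1 by auto
next
  case False
  have "y * D e + B e = 0 \<longleftrightarrow> y = - B e / D e" for y
    using False by (auto simp: field_simps add_eq_0_iff2)
  moreover have "(- B e / D e) ^ 3 = - 1 \<longleftrightarrow> B e ^ 3 = D e ^ 3"
    using False by (simp add: power_divide field_simps)
  ultimately have "{y \<in> L. y ^ 3 \<noteq> - 1 \<and> y * D e + B e = 0} = (if B e ^ 3 = D e ^ 3 then {} else {- B e / D e})"
    using E_L[OF assms] by auto
  then show ?thesis using False by simp
qed

text \<open>The count is \<open>(q - 3) * (q - 2) + 1\<close>: each \<open>m\<close> in
  \<open>M\<close> contributes \<open>q - 2\<close> pairs, and \<open>m = 0\<close> one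
  more.\<close>

lemma card_lines:
  "int (card {(m, a, b). m \<in> M \<and> a \<in> L - {0} \<and> b \<in> L - {0} \<and> p * a + r * b = s * m}) = q ^ 2 - 5 * q + 7"
  if "p \<in> L" "p \<noteq> 0" "r \<in> L" "r \<noteq> 0" "s \<in> L" "s \<noteq> 0"
proof -
  have "{(m, a, b). m \<in> M \<and> a \<in> L - {0} \<and> b \<in> L - {0} \<and> p * a + r * b = s * m} =
      (SIGMA m:M. {(a, b). a \<in> L - {0} \<and> b \<in> L - {0} \<and> p * a + r * b = s * m})"
    by auto
  moreover have "finite {(a, b). a \<in> L - {0} \<and> b \<in> L - {0} \<and> p * a + r * b = c}" for c
    by (rule finite_subset[of _ "L \<times> L"]) (use finite_L in auto)
  ultimately have "int (card {(m, a, b). m \<in> M \<and> a \<in> L - {0} \<and> b \<in> L - {0} \<and> p * a + r * b = s * m}) =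
      (\<Sum>m\<in>M. int (card {(a, b). a \<in> L - {0} \<and> b \<in> L - {0} \<and> p * a + r * b = s * m}))"
    using finite_M by (simp only: int_card_Sigma)
  also have "\<dots> = (\<Sum>m\<in>M. if s * m = 0 then q - 1 else q - 2)"
    using that by (intro sum.cong card_linear) (auto simp: M_def)
  also have "{m \<in> M. s * m = 0} = {0}" using that by (auto simp: M_def)
  then have "(\<Sum>m\<in>M. if s * m = 0 then q - 1 else q - 2) = q ^ 2 - 5 * q + 7"
    by (simp only: sum_if_int[OF finite_M] card_M) (simp add: algebra_simps power2_eq_square)
  finally show ?thesis .
qed

text \<open>For each \<open>z\<close> one of \<open>a\<close>, \<open>b\<close> and
  \<open>third (m, a, b)\<close> cancels from \<open>B - z * D\<close>. Any two of the three
  determine the remaining one, so \<open>E\<close> is reparametrised by the two that survive, and a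
  count of points on lines is left.\<close>

lemma card_B_eq:
  assumes "z = 1 \<or> z = w \<or> z = w ^ 2"
  shows "int (card {e \<in> E. B e = z * D e}) = q ^ 2 - 5 * q + 7"
proof -
  have w3: "w ^ 3 = 1" by (rule w_cube)
  have m0: "m ^ 3 \<noteq> 1" "m \<in> L" if "m \<in> M" for m using that by (auto simp: M_def)
  from assms consider "z = 1" | "z = w" | "z = w ^ 2" by blast
  then show ?thesis
  proof cases
    case 1
    have "card {e \<in> E. B e = z * D e} =
      card {(m, a, b). m \<in> M \<and> a \<in> L - {0} \<and> b \<in> L - {0} \<and> (1 - w) * a + (1 - w ^ 2) * b = 3 * m}"
    proof (rule card_eq_witness[where f = "\<lambda>(m, a, b). (m, b, third (m, a, b))" and g = "\<lambda>(m, b, c). (m, third (m, b, c), b)"])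
      fix e assume "e \<in> {e \<in> E. B e = z * D e}"
      then obtain m a b where e: "e = (m, a, b)" "(m, a, b) \<in> E" "B (m, a, b) = D (m, a, b)" using 1 by (cases e) auto
      then have "m \<in> M" "a \<in> L - {0}" "b \<in> L - {0}" by (auto simp: E_def)
      then show "(case e of (m, a, b) \<Rightarrow> (m, b, third (m, a, b)))
         \<in> {(m, a, b). m \<in> M \<and> a \<in> L - {0} \<and> b \<in> L - {0} \<and> (1 - w) * a + (1 - w ^ 2) * b = 3 * m} \<and>
        (case (case e of (m, a, b) \<Rightarrow> (m, b, third (m, a, b))) of (m, b, c) \<Rightarrow> (m, third (m, b, c), b)) = e"
        using e(3) m0[of m] E_L(1)[OF e(2)] third_third[of m a b]
        by (simp add: e(1) B_def D_def) (simp add: algebra_simps)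
    next
      fix e assume "e \<in> {(m, a, b). m \<in> M \<and> a \<in> L - {0} \<and> b \<in> L - {0} \<and> (1 - w) * a + (1 - w ^ 2) * b = 3 * m}"
      then obtain m b c where e: "e = (m, b, c)" "m \<in> M" "b \<in> L - {0}" "c \<in> L - {0}" "(1 - w) * b + (1 - w ^ 2) * c = 3 * m"
        by auto
      have c: "third (m, third (m, b, c), b) = c" using e m0[of m] third_third[of m b c] by simp
      have "third (m, b, c) \<in> L - {0}" using e m0[of m] third_third[of m b c] by (simp add: third_def)
      then show "(case e of (m, b, c) \<Rightarrow> (m, third (m, b, c), b)) \<in> {e \<in> E. B e = z * D e} \<and>
        (case (case e of (m, b, c) \<Rightarrow> (m, third (m, b, c), b)) of (m, a, b) \<Rightarrow> (m, b, third (m, a, b))) = e"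
        using e(2-5) by (simp add: e(1) c E_def 1 B_def D_def) (simp add: algebra_simps)
    qed
    then show ?thesis using card_lines[of "1 - w" "1 - w ^ 2" 3] w_ne w_L three by simp
  next
    case 2
    have "card {e \<in> E. B e = z * D e} =
      card {(m, a, b). m \<in> M \<and> a \<in> L - {0} \<and> b \<in> L - {0} \<and> (w - 1) * a + (w - w ^ 2) * b = (3 * w) * m}"
    proof (rule card_eq_witness[where f = "\<lambda>(m, a, b). (m, a, third (m, a, b))" and g = "\<lambda>(m, a, c). (m, a, third (m, a, c))"])
      fix e assume "e \<in> {e \<in> E. B e = z * D e}"
      then obtain m a b where e: "e = (m, a, b)" "(m, a, b) \<in> E" "B (m, a, b) = w * D (m, a, b)" using 2 by (cases e) auto
      then have "m \<in> M" "a \<in> L - {0}" "b \<in> L - {0}" by (auto simp: E_def)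
      then show "(case e of (m, a, b) \<Rightarrow> (m, a, third (m, a, b)))
         \<in> {(m, a, b). m \<in> M \<and> a \<in> L - {0} \<and> b \<in> L - {0} \<and> (w - 1) * a + (w - w ^ 2) * b = (3 * w) * m} \<and>
        (case (case e of (m, a, b) \<Rightarrow> (m, a, third (m, a, b))) of (m, a, c) \<Rightarrow> (m, a, third (m, a, c))) = e"
        using e(3) m0[of m] E_L(1)[OF e(2)] third_third[of m a b]
        by (simp add: e(1) B_def D_def) (simp add: algebra_simps)
    next
      fix e assume "e \<in> {(m, a, b). m \<in> M \<and> a \<in> L - {0} \<and> b \<in> L - {0} \<and> (w - 1) * a + (w - w ^ 2) * b = (3 * w) * m}"
      then obtain m a c where e: "e = (m, a, c)" "m \<in> M" "a \<in> L - {0}" "c \<in> L - {0}" "(w - 1) * a + (w - w ^ 2) * c = (3 * w) * m"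
        by auto
      have c: "third (m, a, third (m, a, c)) = c" using e m0[of m] third_third[of m a c] by simp
      have "third (m, a, c) \<in> L - {0}" using e m0[of m] third_third[of m a c] by (simp add: third_def)
      then show "(case e of (m, a, c) \<Rightarrow> (m, a, third (m, a, c))) \<in> {e \<in> E. B e = z * D e} \<and>
        (case (case e of (m, a, c) \<Rightarrow> (m, a, third (m, a, c))) of (m, a, b) \<Rightarrow> (m, a, third (m, a, b))) = e"
        using e(2-5) by (simp add: e(1) c E_def 2 B_def D_def) (simp add: algebra_simps)
    qed
    then show ?thesis using card_lines[of "w - 1" "w - w ^ 2" "3 * w"] w_ne w_L three by simp
  next
    case 3
    have "B e = z * D e \<longleftrightarrow> (case e of (m, a, b) \<Rightarrow> (w ^ 2 - 1) * a + (w ^ 2 - w) * b = (3 * w ^ 2) * m)" for e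
      by (cases e) (auto simp: 3 B_def D_def algebra_simps)
    then have "{e \<in> E. B e = z * D e} =
      {(m, a, b). m \<in> M \<and> a \<in> L - {0} \<and> b \<in> L - {0} \<and> (w ^ 2 - 1) * a + (w ^ 2 - w) * b = (3 * w ^ 2) * m}"
      by (auto simp: E_def)
    then show ?thesis using card_lines[of "w ^ 2 - 1" "w ^ 2 - w" "3 * w ^ 2"] w_ne w_L three by simp
  qed
qed

text \<open>With \<open>a = m + x + y\<close> and \<open>b = m + w ^ 2 * x + w * y\<close> the
  left-hand side becomes \<open>m ^ 3 + x ^ 3 + y ^ 3 - 3 * m * x * y\<close>. Now
  \<open>m ^ 3\<close> cancels and the equation is linear in \<open>m\<close>: one solution for each
  of the \<open>(q - 1) ^ 2\<close> pairs with \<open>x * y\<close> nonzero, and all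
  \<open>q\<close> values of \<open>m\<close> at the 6 pairs with \<open>x * y = 0\<close> and
  \<open>x ^ 3 + y ^ 3 = - 1\<close>.\<close>

lemma card_D_zero_total:
  "int (card {(m, a, b). m \<in> L \<and> a \<in> L \<and> b \<in> L \<and> a * b * (3 * m - a - b) = m ^ 3 - 1}) = (q - 1) ^ 2 + 6 * q"
proof -
  define t where "t = inverse (3 :: 'b)"
  have t: "3 * t = 1" using three by (simp add: t_def)
  have tL: "t \<in> L" by (simp add: t_def)
  define f where "f = (\<lambda>(m, a, b). ((t * (a + w * b + w ^ 2 * (3 * m - a - b)), t * (a + w ^ 2 * b + w * (3 * m - a - b))), m))"
  define g where "g = (\<lambda>((b, c), m). (m, m + b + c, m + w ^ 2 * b + w * c))"
  define S where "S = (SIGMA p:L \<times> L. {m \<in> L. fst p ^ 3 + snd p ^ 3 - 3 * m * fst p * snd p = - 1})"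
  have "card {(m, a, b). m \<in> L \<and> a \<in> L \<and> b \<in> L \<and> a * b * (3 * m - a - b) = m ^ 3 - 1} = card S"
  proof (rule card_eq_witness[of _ f _ g])
    fix p assume "p \<in> {(m, a, b). m \<in> L \<and> a \<in> L \<and> b \<in> L \<and> a * b * (3 * m - a - b) = m ^ 3 - 1}"
    then obtain m a b where p: "p = (m, a, b)" and pL: "m \<in> L" "a \<in> L" "b \<in> L"
      and eq: "a * b * (3 * m - a - b) = m ^ 3 - 1" by auto
    define x where "x = t * (a + w * b + w ^ 2 * (3 * m - a - b))"
    define y where "y = t * (a + w ^ 2 * b + w * (3 * m - a - b))"
    have ab: "m + x + y = a" "m + w ^ 2 * x + w * y = b"
      unfolding x_def y_def using w t by Groebner_Basis.algebra+
    have c: "3 * m - a - b = m + w * x + w ^ 2 * y"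
      unfolding ab[symmetric] using w by Groebner_Basis.algebra
    have "(m + x + y) * (m + w ^ 2 * x + w * y) * (m + w * x + w ^ 2 * y) = m ^ 3 - 1"
      unfolding ab c[symmetric] by (rule eq)
    moreover have "(m + x + y) * (m + w ^ 2 * x + w * y) * (m + w * x + w ^ 2 * y) = m ^ 3 + (x ^ 3 + y ^ 3 - 3 * m * x * y)"
      using w by Groebner_Basis.algebra
    ultimately have "x ^ 3 + y ^ 3 - 3 * m * x * y = - 1"
      by (metis add_left_cancel diff_conv_add_uminus)
    moreover note ab
    moreover have "x \<in> L" "y \<in> L" using pL w_L tL by (simp_all add: x_def y_def)
    ultimately show "f p \<in> S \<and> g (f p) = p"
      using pL by (simp add: p f_def g_def S_def x_def[symmetric] y_def[symmetric])
  next
    fix p assume "p \<in> S"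
    then obtain m b c where p: "p = ((b, c), m)" and pL: "m \<in> L" "b \<in> L" "c \<in> L"
      and eq: "b ^ 3 + c ^ 3 - 3 * m * b * c = - 1" by (auto simp: S_def)
    define x where "x = m + b + c"
    define y where "y = m + w ^ 2 * b + w * c"
    have "t * (x + w * y + w ^ 2 * (3 * m - x - y)) = b" "t * (x + w ^ 2 * y + w * (3 * m - x - y)) = c"
      unfolding x_def y_def using w t by Groebner_Basis.algebra+
    moreover have "x * y * (3 * m - x - y) = m ^ 3 + (b ^ 3 + c ^ 3 - 3 * m * b * c)"
      unfolding x_def y_def using w by Groebner_Basis.algebra
    then have "x * y * (3 * m - x - y) = m ^ 3 - 1"
      using eq by simp
    moreover have "x \<in> L" "y \<in> L" using pL w_L by (simp_all add: x_def y_def)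
    ultimately show "g p \<in> {(m, a, b). m \<in> L \<and> a \<in> L \<and> b \<in> L \<and> a * b * (3 * m - a - b) = m ^ 3 - 1} \<and> f (g p) = p"
      using pL by (simp add: p f_def g_def x_def[symmetric] y_def[symmetric])
  qed
  also have "int (card S) = (\<Sum>p\<in>L \<times> L. int (card {m \<in> L. fst p ^ 3 + snd p ^ 3 - 3 * m * fst p * snd p = - 1}))"
    unfolding S_def using finite_L by (intro int_card_Sigma) auto
  also have "\<dots> = (\<Sum>p\<in>L \<times> L. if fst p * snd p = 0 then (if fst p ^ 3 + snd p ^ 3 = - 1 then q else 0) else 1)"
  proof (rule sum.cong[OF refl])
    fix p assume "p \<in> L \<times> L"
    then obtain b c where p: "p = (b, c)" "b \<in> L" "c \<in> L" by auto
    show "int (card {m \<in> L. fst p ^ 3 + snd p ^ 3 - 3 * m * fst p * snd p = - 1}) =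
      (if fst p * snd p = 0 then (if fst p ^ 3 + snd p ^ 3 = - 1 then q else 0) else 1)"
    proof (cases "b * c = 0")
      case True
      then have "{m \<in> L. b ^ 3 + c ^ 3 - 3 * m * b * c = - 1} = (if b ^ 3 + c ^ 3 = - 1 then L else {})"
        by auto
      then show ?thesis
        unfolding p fst_conv snd_conv using True by simp
    next
      case False
      have "b ^ 3 + c ^ 3 - 3 * m * b * c = - 1 \<longleftrightarrow> m = (b ^ 3 + c ^ 3 + 1) / (3 * b * c)" for m
        using False three by (auto simp: field_simps eq_neg_iff_add_eq_0)
      then have "{m \<in> L. b ^ 3 + c ^ 3 - 3 * m * b * c = - 1} = {(b ^ 3 + c ^ 3 + 1) / (3 * b * c)}"
        using p by auto
      then show ?thesis using False by (simp add: p)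
    qed
  qed
  also have "\<dots> = (\<Sum>p\<in>L \<times> L. if fst p * snd p = 0 then (if fst p ^ 3 + snd p ^ 3 = - 1 then q else 0) else 0)
      + (\<Sum>p\<in>L \<times> L. if fst p * snd p = 0 then 0 else 1)"
    unfolding sum.distrib[symmetric] by (rule sum.cong) auto
  also have "(\<Sum>p\<in>L \<times> L. if fst p * snd p = 0 then (if fst p ^ 3 + snd p ^ 3 = - 1 then q else 0) else 0)
      = (\<Sum>p\<in>L \<times> L. if fst p * snd p = 0 \<and> fst p ^ 3 + snd p ^ 3 = - 1 then q else 0)"
    by (rule sum.cong) auto
  also have "\<dots> = 6 * q"
  proof -
    have "{p \<in> L \<times> L. fst p * snd p = 0 \<and> fst p ^ 3 + snd p ^ 3 = - 1} =
      {0} \<times> {z \<in> L. z ^ 3 = - 1} \<union> {z \<in> L. z ^ 3 = - 1} \<times> {0}"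
      by auto
    moreover have "({0} \<times> {z \<in> L. z ^ 3 = - 1}) \<inter> ({z \<in> L. z ^ 3 = - 1} \<times> {0}) = {}"
      by auto
    ultimately have "card {p \<in> L \<times> L. fst p * snd p = 0 \<and> fst p ^ 3 + snd p ^ 3 = - 1} = 6"
      using finite_L by (simp add: card_Un_disjoint card_cartesian_product card_cube_minus_1)
    then show ?thesis using finite_L by (subst sum_if_int) auto
  qed
  also have "(\<Sum>p\<in>L \<times> L. if fst p * snd p = 0 then 0 else 1) = (q - 1) ^ 2"
  proof -
    have "{p \<in> L \<times> L. fst p * snd p = 0} = {(a, b). a \<in> L \<and> b \<in> L \<and> a * b = 0}" by auto
    then show ?thesis
      using finite_L by (subst sum_if_int) (simp_all only: card_mult_eq[OF zero_L] finite_SigmaI card_cartesian_product,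
        simp_all add: algebra_simps power2_eq_square)
  qed
  finally show ?thesis by simp
qed

text \<open>From the total one removes the part with \<open>m ^ 3 = 1\<close>: for each of the three
  \<open>m\<close> a triangle of lines that is not concurrent, since \<open>3 * m\<close> is
  nonzero.\<close>

lemma card_D_zero: "int (card {e \<in> E. D e = 0}) = q ^ 2 - 5 * q + 10"
proof -
  define S where "S = {(m, a, b). m \<in> L \<and> a \<in> L \<and> b \<in> L \<and> a * b * (3 * m - a - b) = m ^ 3 - 1}"
  define T where "T = (SIGMA m:{m \<in> L. m ^ 3 = 1}. {(a, b). a \<in> L \<and> b \<in> L \<and> a * b * (3 * m - a - b) = 0})"
  have fS: "finite S"
    unfolding S_def by (rule finite_subset[of _ "L \<times> L \<times> L"]) (use finite_L in auto)
  have "D (m, a, b) = 0 \<longleftrightarrow> a * b * (3 * m - a - b) = m ^ 3 - 1" if "(m, a, b) \<in> E" for m a b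
    using that by (auto simp: E_def D_def third_def field_simps)
  moreover have "(m, a, b) \<in> E" if "(m, a, b) \<in> S" "m ^ 3 \<noteq> 1" for m a b
    using that by (auto simp: S_def E_def M_def)
  ultimately have "{e \<in> E. D e = 0} = {e \<in> S. fst e ^ 3 \<noteq> 1}"
    by (auto simp: E_def M_def S_def)
  moreover have "{e \<in> S. fst e ^ 3 = 1} = T"
    by (auto simp: S_def T_def)
  moreover have "card S = card {e \<in> S. fst e ^ 3 \<noteq> 1} + card {e \<in> S. fst e ^ 3 = 1}"
    using fS by (subst card_Un_disjoint[symmetric]) (auto intro: arg_cong[where f = card])
  moreover have "int (card T) = 9 * q - 9"
  proof -
    have "finite {(a, b). a \<in> L \<and> b \<in> L \<and> a * b * (3 * m - a - b) = 0}" for m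
      by (rule finite_subset[of _ "L \<times> L"]) (use finite_L in auto)
    then have "int (card T) = (\<Sum>m\<in>{m \<in> L. m ^ 3 = 1}. int (card {(a, b). a \<in> L \<and> b \<in> L \<and> a * b * (3 * m - a - b) = 0}))"
      unfolding T_def using finite_L by (intro int_card_Sigma) auto
    also have "\<dots> = (\<Sum>m\<in>{m \<in> L. m ^ 3 = 1}. 3 * q - 3)"
    proof (rule sum.cong[OF refl])
      fix m assume "m \<in> {m \<in> L. m ^ 3 = 1}"
      then have "3 * m \<in> L" "3 * m \<noteq> 0" using three by auto
      then show "int (card {(a, b). a \<in> L \<and> b \<in> L \<and> a * b * (3 * m - a - b) = 0}) = 3 * q - 3"
        using card_triangle[of "3 * m"] by (simp only: if_False)
    qed
    finally show ?thesis by (simp add: card_cube_1)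
  qed
  ultimately show ?thesis
    using card_D_zero_total unfolding S_def[symmetric] by (simp add: algebra_simps power2_eq_square)
qed

text \<open>The two linear equations force the three cofactors to be \<open>m + c\<close>,
  \<open>m + w * c\<close> and \<open>m + w ^ 2 * c\<close>. Their product is
  \<open>m ^ 3 + c ^ 3\<close>, so \<open>c\<close> is one of the three cube roots of -1.\<close>

lemma card_D_B_zero: "int (card {e \<in> E. D e = 0 \<and> B e = 0}) = 3 * (q - 3)"
proof -
  have "card {e \<in> E. D e = 0 \<and> B e = 0} = card (M \<times> {z \<in> L. z ^ 3 = - 1})"
  proof (rule card_eq_witness[of _ "\<lambda>(m, a, b). (m, a - m)" _ "\<lambda>(m, c). (m, m + c, m + w * c)"])
    fix e assume "e \<in> {e \<in> E. D e = 0 \<and> B e = 0}"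
    then obtain m a b where e: "e = (m, a, b)" and "(m, a, b) \<in> E" and DB: "D (m, a, b) = 0" "B (m, a, b) = 0"
      by (cases e) auto
    then have L': "m \<in> M" "m \<in> L" "a \<in> L" "b \<in> L" "a \<noteq> 0" "b \<noteq> 0" by (auto simp: E_def M_def)
    define c where "c = third (m, a, b)"
    have 1: "a * b * c = m ^ 3 - 1" using L' by (simp add: c_def third_def)
    have 2: "a + b + c - 3 * m = 0" "a + w * b + w ^ 2 * c = 0"
      using DB by (simp_all add: D_def B_def c_def)
    define t where "t = inverse (3 :: 'b)"
    have t: "3 * t = 1" using three by (simp add: t_def)
    \<comment> \<open>The factor \<open>t * (1 - w ^ 2) * w ^ 2\<close> is the inverse of
      \<open>w * (1 - w)\<close>, the coefficient of \<open>b\<close> that remains once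
      \<open>c\<close> is eliminated.\<close>
    have "b - (m + w * (a - m)) = t * (1 - w ^ 2) * w ^ 2 * ((a + w * b + w ^ 2 * c) - w ^ 2 * (a + b + c - 3 * m))"
      using w t by Groebner_Basis.algebra
    then have b: "b = m + w * (a - m)"
      using 2 by simp
    have "c = 3 * m - a - b"
      using 2(1) by (simp add: algebra_simps)
    also have "\<dots> = m + w ^ 2 * (a - m)"
      unfolding b using w by Groebner_Basis.algebra
    finally have c: "c = m + w ^ 2 * (a - m)" .
    have "a * (m + w * (a - m)) * (m + w ^ 2 * (a - m)) = m ^ 3 + (a - m) ^ 3"
      using w by Groebner_Basis.algebra
    then have "m ^ 3 + (a - m) ^ 3 = m ^ 3 - 1"
      using 1 b c by simp
    then have "(a - m) ^ 3 = - 1"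
      by (metis add_left_cancel diff_conv_add_uminus)
    moreover have "m + w * (a - m) = b" using b by simp
    ultimately show "(case e of (m, a, b) \<Rightarrow> (m, a - m)) \<in> M \<times> {z \<in> L. z ^ 3 = - 1} \<and>
      (case (case e of (m, a, b) \<Rightarrow> (m, a - m)) of (m, c) \<Rightarrow> (m, m + c, m + w * c)) = e"
      using L' by (simp add: e)
  next
    fix p assume "p \<in> M \<times> {z \<in> L. z ^ 3 = - 1}"
    then obtain m c where p: "p = (m, c)" "m \<in> M" "c \<in> L" and c: "c ^ 3 = - 1" by auto
    then have m: "m \<in> L" "m ^ 3 \<noteq> 1" by (auto simp: M_def)
    have pr: "(m + c) * (m + w * c) * (m + w ^ 2 * c) = m ^ 3 - 1"
      using w c by Groebner_Basis.algebra
    then have "(m + c) * (m + w * c) * (m + w ^ 2 * c) \<noteq> 0" using m by simp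
    then have nz: "m + c \<noteq> 0" "m + w * c \<noteq> 0" by auto
    then have "third (m, m + c, m + w * c) = m + w ^ 2 * c"
      unfolding third_def prod.case pr[symmetric] by simp
    moreover have "m + c + (m + w * c) + (m + w ^ 2 * c) - 3 * m = 0"
      using w by Groebner_Basis.algebra
    moreover have "m + c + w * (m + w * c) + w ^ 2 * (m + w ^ 2 * c) = 0"
      using w by Groebner_Basis.algebra
    ultimately have "D (m, m + c, m + w * c) = 0" "B (m, m + c, m + w * c) = 0"
      by (simp_all add: D_def B_def)
    then show "(case p of (m, c) \<Rightarrow> (m, m + c, m + w * c)) \<in> {e \<in> E. D e = 0 \<and> B e = 0} \<and>
      (case (case p of (m, c) \<Rightarrow> (m, m + c, m + w * c)) of (m, a, b) \<Rightarrow> (m, a - m)) = p"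
      using p m nz w_L by (simp add: E_def)
  qed
  then show ?thesis
    using card_M by (simp add: card_cartesian_product card_cube_minus_1)
qed

text \<open>Equal cubes mean \<open>B e = z * D e\<close> for one of three \<open>z\<close>. From
  each of these sets the part \<open>D e = B e = 0\<close> is removed, which leaves
  \<open>(q - 4) ^ 2\<close> elements and makes the three sets disjoint.\<close>

lemma card_cube_eq: "int (card {e \<in> E. D e \<noteq> 0 \<and> B e ^ 3 = D e ^ 3}) = 3 * (q - 4) ^ 2"
proof -
  define Z where "Z = {1, w, w ^ 2}"
  have 1: "int (card {e \<in> E. D e \<noteq> 0 \<and> B e = z * D e}) = (q - 4) ^ 2" if "z \<in> Z" for z
  proof -
    have "{e \<in> E. B e = z * D e} = {e \<in> E. D e \<noteq> 0 \<and> B e = z * D e} \<union> {e \<in> E. D e = 0 \<and> B e = 0}"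
      by auto
    moreover have "{e \<in> E. D e \<noteq> 0 \<and> B e = z * D e} \<inter> {e \<in> E. D e = 0 \<and> B e = 0} = {}" by auto
    ultimately have "card {e \<in> E. B e = z * D e} = card {e \<in> E. D e \<noteq> 0 \<and> B e = z * D e} + card {e \<in> E. D e = 0 \<and> B e = 0}"
      using finite_E by (simp add: card_Un_disjoint)
    moreover have "int (card {e \<in> E. B e = z * D e}) = q ^ 2 - 5 * q + 7"
      using that by (intro card_B_eq) (auto simp: Z_def)
    ultimately show ?thesis
      using card_D_B_zero by (simp add: algebra_simps power2_eq_square)
  qed
  have "{e \<in> E. D e \<noteq> 0 \<and> B e ^ 3 = D e ^ 3} = (\<Union>z\<in>Z. {e \<in> E. D e \<noteq> 0 \<and> B e = z * D e})"
  proof -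
    have "B e ^ 3 = D e ^ 3 \<longleftrightarrow> (\<exists>z\<in>Z. B e = z * D e)" if "e \<in> E" "D e \<noteq> 0" for e
      using card_cubes(1)[of "D e"] E_L[OF that(1)] that(2) by (auto simp: Z_def set_eq_iff)
    then show ?thesis by auto
  qed
  moreover have "card (\<Union>z\<in>Z. {e \<in> E. D e \<noteq> 0 \<and> B e = z * D e}) = (\<Sum>z\<in>Z. card {e \<in> E. D e \<noteq> 0 \<and> B e = z * D e})"
    using finite_E by (intro card_UN_disjoint) (auto simp: Z_def)
  moreover have "int (\<Sum>z\<in>Z. card {e \<in> E. D e \<noteq> 0 \<and> B e = z * D e}) = (\<Sum>z\<in>Z. (q - 4) ^ 2)"
    using 1 by simp
  moreover have "card Z = 3"
    using w_ne by (auto simp: Z_def)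
  ultimately show ?thesis by simp
qed

theorem card_affine_split: "int (card affine_pts) = q ^ 3 + 12 * q ^ 2 - 27 * q - 1"
proof -
  have fin: "finite norm_pts"
    unfolding norm_pts_def by (rule finite_subset[of _ "L \<times> L \<times> L \<times> L"]) (use finite_L in auto)
  have fL: "finite {y \<in> L. y ^ 3 \<noteq> - 1 \<and> y * D e + B e = 0}" for e using finite_L by simp
  have "norm_pts = {(m, y, l, l') \<in> norm_pts. m ^ 3 = 1 \<or> y ^ 3 = - 1} \<union> {(m, y, l, l') \<in> norm_pts. m ^ 3 \<noteq> 1 \<and> y ^ 3 \<noteq> - 1}"
    by auto
  moreover have "{(m, y, l, l') \<in> norm_pts. m ^ 3 = 1 \<or> y ^ 3 = - 1} \<inter> {(m, y, l, l') \<in> norm_pts. m ^ 3 \<noteq> 1 \<and> y ^ 3 \<noteq> - 1} = {}"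
    by auto
  ultimately have "card norm_pts = card {(m, y, l, l') \<in> norm_pts. m ^ 3 = 1 \<or> y ^ 3 = - 1}
      + card {(m, y, l, l') \<in> norm_pts. m ^ 3 \<noteq> 1 \<and> y ^ 3 \<noteq> - 1}"
    using fin by (metis (no_types, lifting) card_Un_disjoint finite_Un)
  then have "int (card norm_pts) = 18 * q ^ 2 - 45 * q + 33
      + (\<Sum>e\<in>E. int (card {y \<in> L. y ^ 3 \<noteq> - 1 \<and> y * D e + B e = 0}))"
    by (simp only: of_nat_add card_norm_pts_degenerate card_norm_pts_generic int_card_Sigma[OF finite_E fL])
  also have "(\<Sum>e\<in>E. int (card {y \<in> L. y ^ 3 \<noteq> - 1 \<and> y * D e + B e = 0})) =
     (\<Sum>e\<in>E. 1 + (if D e = 0 \<and> B e = 0 then q - 3 else 0) - (if D e = 0 then 1 else 0) - (if D e \<noteq> 0 \<and> B e ^ 3 = D e ^ 3 then 1 else 0))"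
  proof (rule sum.cong[OF refl])
    fix e assume "e \<in> E"
    then show "int (card {y \<in> L. y ^ 3 \<noteq> - 1 \<and> y * D e + B e = 0}) =
      1 + (if D e = 0 \<and> B e = 0 then q - 3 else 0) - (if D e = 0 then 1 else 0) - (if D e \<noteq> 0 \<and> B e ^ 3 = D e ^ 3 then 1 else 0)"
      unfolding card_fibre[OF \<open>e \<in> E\<close>] by (cases "D e = 0"; cases "B e = 0"; cases "B e ^ 3 = D e ^ 3") simp_all
  qed
  also have "\<dots> = (\<Sum>e\<in>E. 1) + (\<Sum>e\<in>E. if D e = 0 \<and> B e = 0 then q - 3 else 0)
      - (\<Sum>e\<in>E. if D e = 0 then 1 else 0) - (\<Sum>e\<in>E. if D e \<noteq> 0 \<and> B e ^ 3 = D e ^ 3 then 1 else 0)"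
    by (simp only: sum_subtractf sum.distrib)
  also have "\<dots> = int (card E) + (q - 3) * (3 * (q - 3)) - (q ^ 2 - 5 * q + 10) - 3 * (q - 4) ^ 2"
    unfolding sum_if_int[OF finite_E] card_D_zero card_D_B_zero card_cube_eq by simp
  finally show ?thesis
    unfolding card_affine_norm_pts card_E by (simp add: algebra_simps power2_eq_square power3_eq_cube)
qed

end

section \<open>The affine part when cubing is bijective on \<open>L\<close>\<close>

locale counting_nonsplit = counting L for L :: "'b::field set" +
  assumes cube_bij: "\<And>a. a \<in> L \<Longrightarrow> \<exists>!b. b \<in> L \<and> b ^ 3 = a"
begin

lemma cube_inj:
  assumes "a \<in> L" "b \<in> L" "a ^ 3 = b ^ 3"
  shows "a = b"
  by (rule ex1E[OF cube_bij[OF power_L[OF assms(1), of 3]]]) (use assms in metis)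

text \<open>The Hesse pencil of plane cubics with parameter \<open>m\<close>.\<close>

definition form :: "'b \<Rightarrow> 'b \<times> 'b \<times> 'b \<Rightarrow> 'b" where
  "form m = (\<lambda>(a, b, c). a ^ 3 + b ^ 3 + c ^ 3 - 3 * m * a * b * c)"

abbreviation L3 :: "('b \<times> 'b \<times> 'b) set" where "L3 \<equiv> L \<times> L \<times> L"

lemma finite_L3: "finite L3"
  using finite_L by simp

lemma card_L3: "int (card L3) = q ^ 3"
  by (simp add: card_cartesian_product power3_eq_cube)

lemma form_L: "m \<in> L \<Longrightarrow> p \<in> L3 \<Longrightarrow> form m p \<in> L"
  by (auto simp: form_def)

text \<open>Since cubing is bijective, every point outside the cone \<open>form m = 0\<close> has a unique
  scalar multiple on \<open>form m = c\<close>.\<close>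

lemma card_form_eq:
  assumes "m \<in> L" "c \<in> L" "c \<noteq> 0"
  shows "(q - 1) * int (card {p \<in> L3. form m p = c}) = q ^ 3 - int (card {p \<in> L3. form m p = 0})"
proof -
  have hom: "form m (s * x, s * y, s * z) = s ^ 3 * form m (x, y, z)" for s x y z
    by (simp add: form_def power_mult_distrib power3_eq_cube algebra_simps)
  define root where "root a = (THE b. b \<in> L \<and> b ^ 3 = a)" for a
  have root: "root a \<in> L" "root a ^ 3 = a" if "a \<in> L" for a
    using theI'[OF cube_bij[OF that]] by (auto simp: root_def)
  define f where "f = (\<lambda>(s, x, y, z). (s * x, s * y, s * (z :: 'b)))"
  define g where "g = (\<lambda>(x, y, z). let s = root (form m (x, y, z) / c) in (s, x / s, y / s, z / s))"
  have "card ((L - {0}) \<times> {p \<in> L3. form m p = c}) = card {p \<in> L3. form m p \<noteq> 0}"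
  proof (rule card_eq_witness[of _ f _ g])
    fix p assume "p \<in> (L - {0}) \<times> {p \<in> L3. form m p = c}"
    then obtain s x y z where p: "p = (s, x, y, z)" "s \<in> L" "s \<noteq> 0" "x \<in> L" "y \<in> L" "z \<in> L" "form m (x, y, z) = c"
      by (cases p) auto
    have "s ^ 3 \<in> L" by (rule power_L[OF p(2)])
    from cube_inj[OF root(1)[OF this] p(2) root(2)[OF this]] have "root (s ^ 3) = s" .
    then show "f p \<in> {p \<in> L3. form m p \<noteq> 0} \<and> g (f p) = p"
      using p(2-7) assms(3) by (simp add: p(1) f_def g_def hom Let_def)
  next
    fix p assume "p \<in> {p \<in> L3. form m p \<noteq> 0}"
    then obtain x y z where p: "p = (x, y, z)" "x \<in> L" "y \<in> L" "z \<in> L" "form m (x, y, z) \<noteq> 0"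
      by (cases p) auto
    define s where "s = root (form m (x, y, z) / c)"
    have s: "s \<in> L" "s ^ 3 = form m (x, y, z) / c"
      using root[of "form m (x, y, z) / c"] p assms form_L[OF assms(1), of "(x, y, z)"] by (auto simp: s_def)
    have "s \<noteq> 0" using s p assms by auto
    have "s ^ 3 * form m (x / s, y / s, z / s) = form m (x, y, z)"
      using hom[of s "x / s" "y / s" "z / s"] \<open>s \<noteq> 0\<close> by simp
    then have "form m (x, y, z) * form m (x / s, y / s, z / s) = form m (x, y, z) * c"
      unfolding s(2) using assms(3) by (simp only: times_divide_eq_left divide_eq_eq if_True not_False_eq_True)
    then have "form m (x / s, y / s, z / s) = c"
      using p(5) by (simp only: mult_cancel_left) simp
    then show "g p \<in> (L - {0}) \<times> {p \<in> L3. form m p = c} \<and> f (g p) = p"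
      using p s \<open>s \<noteq> 0\<close> by (simp add: f_def g_def s_def[symmetric] Let_def)
  qed
  moreover have "card L3 = card {p \<in> L3. form m p = 0} + card {p \<in> L3. form m p \<noteq> 0}"
    using finite_L3 by (subst card_Un_disjoint[symmetric]) (auto intro: arg_cong[where f = card])
  ultimately have "int (card L3) = int (card {p \<in> L3. form m p = 0}) + int (card (L - {0})) * int (card {p \<in> L3. form m p = c})"
    by (simp add: card_cartesian_product flip: of_nat_mult of_nat_add)
  then show ?thesis
    unfolding card_L3 using card_L_minus[of 0] by simp
qed

lemma cube_eq_minus:
  assumes "a \<in> L" "b \<in> L"
  shows "a ^ 3 + b ^ 3 = 0 \<longleftrightarrow> b = - a"
proof
  assume ab: "a ^ 3 + b ^ 3 = 0"
  then have "b ^ 3 = (- a) ^ 3" by (simp add: eq_neg_iff_add_eq_0 add.commute)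
  then show "b = - a" using cube_inj[of b "- a"] assms by simp
qed simp

text \<open>The vectors common to all members of the pencil. Where one coordinate vanishes, the
  other two are opposite because cubing is injective; this gives three lines through the
  origin.\<close>

lemma card_base_locus:
  "int (card {(a, b, c). a \<in> L \<and> b \<in> L \<and> c \<in> L \<and> a * b * c = 0 \<and> a ^ 3 + b ^ 3 + c ^ 3 = 0}) = 3 * q - 2"
proof -
  define S where "S = {(a, b, c). a \<in> L \<and> b \<in> L \<and> c \<in> L \<and> a * b * c = 0 \<and> a ^ 3 + b ^ 3 + c ^ 3 = 0}"
  define T where "T = (SIGMA a:L. if a = 0 then (\<lambda>b. (b, - b)) ` L else {(0, - a), (- a, 0)})"
  have "S = T"
  proof (rule Set.set_eqI)
    fix p :: "'b \<times> 'b \<times> 'b"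
    obtain a b c where p: "p = (a, b, c)" by (cases p) blast
    show "p \<in> S \<longleftrightarrow> p \<in> T"
    proof (cases "a \<in> L \<and> b \<in> L \<and> c \<in> L")
      case True
      then show ?thesis
        using cube_eq_minus[of a b] cube_eq_minus[of a c] cube_eq_minus[of b c] by (auto simp: p S_def T_def)
    next
      case False
      then show ?thesis by (auto simp: p S_def T_def split: if_splits)
    qed
  qed
  moreover have "card ((\<lambda>b. (b, - b)) ` L) = card L"
    by (rule card_image) (auto simp: inj_on_def)
  then have "int (card T) = (\<Sum>a\<in>L. if a = 0 then q else 2)"
    unfolding T_def using finite_L by (subst int_card_Sigma) (auto intro!: sum.cong)
  moreover have "{a \<in> L. a = 0} = {0}" by auto
  ultimately show ?thesis
    unfolding S_def[symmetric] using finite_L by (simp add: sum_if_int)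
qed

text \<open>Double counting: a vector with \<open>a * b * c\<close> nonzero lies on exactly one
  member of the pencil, a base vector on all \<open>q\<close> of them, and any other vector on
  none.\<close>

lemma card_form_zero_total:
  "(\<Sum>m\<in>L. int (card {p \<in> L3. form m p = 0})) = (q - 1) ^ 3 + q * (3 * q - 2)"
proof -
  define P where "P = (\<lambda>(a, b, c). a * b * (c :: 'b))"
  have "(\<Sum>m\<in>L. int (card {p \<in> L3. form m p = 0})) = (\<Sum>m\<in>L. \<Sum>p\<in>L3. if form m p = 0 then 1 else 0)"
    using finite_L3 by (intro sum.cong) (simp_all add: sum_if_int)
  also have "\<dots> = (\<Sum>p\<in>L3. \<Sum>m\<in>L. if form m p = 0 then 1 else 0)"
    by (rule sum.swap)
  also have "\<dots> = (\<Sum>p\<in>L3. (if P p = 0 then 0 else 1) + (if P p = 0 \<and> form 0 p = 0 then q else 0))"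
  proof (rule sum.cong[OF refl])
    fix p assume "p \<in> L3"
    then obtain a b c where p: "p = (a, b, c)" "a \<in> L" "b \<in> L" "c \<in> L" by auto
    show "(\<Sum>m\<in>L. if form m p = 0 then 1 else 0) = (if P p = 0 then 0 else 1) + (if P p = 0 \<and> form 0 p = 0 then q else 0)"
    proof (cases "P p = 0")
      case True
      then have "form m p = form 0 p" for m by (auto simp: form_def p P_def)
      then have "(\<Sum>m\<in>L. if form m p = 0 then 1 else 0) = (\<Sum>m\<in>L. if form 0 p = 0 then 1 else 0 :: int)"
        by (metis (no_types, lifting))
      then show ?thesis using True by simp
    next
      case False
      then have "form m p = 0 \<longleftrightarrow> m = (a ^ 3 + b ^ 3 + c ^ 3) / (3 * a * b * c)" for m
        using three by (auto simp: form_def p P_def field_simps)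
      then have "{m \<in> L. form m p = 0} = {(a ^ 3 + b ^ 3 + c ^ 3) / (3 * a * b * c)}"
        using p by auto
      then show ?thesis using False finite_L by (simp add: sum_if_int)
    qed
  qed
  also have "\<dots> = (q - 1) ^ 3 + q * (3 * q - 2)"
  proof -
    have 1: "{p \<in> L3. P p = 0 \<and> form 0 p = 0} =
      {(a, b, c). a \<in> L \<and> b \<in> L \<and> c \<in> L \<and> a * b * c = 0 \<and> a ^ 3 + b ^ 3 + c ^ 3 = 0}"
      by (auto simp: form_def P_def)
    have "{p \<in> L3. \<not> P p = 0} = (L - {0}) \<times> (L - {0}) \<times> (L - {0})"
      by (auto simp: P_def)
    then have "int (card {p \<in> L3. \<not> P p = 0}) = (q - 1) ^ 3"
      using card_L_minus[of 0] by (simp add: card_cartesian_product power3_eq_cube)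
    moreover have "card L3 = card {p \<in> L3. P p = 0} + card {p \<in> L3. \<not> P p = 0}"
      using finite_L3 by (subst card_Un_disjoint[symmetric]) (auto intro: arg_cong[where f = card])
    ultimately have "int (card L3) - int (card {p \<in> L3. P p = 0}) = (q - 1) ^ 3" by simp
    then show ?thesis
      unfolding sum.distrib sum_if_int[OF finite_L3] 1 card_base_locus by simp
  qed
  finally show ?thesis .
qed

lemma norm_zero:
  assumes "a \<in> L" "b \<in> L" "a ^ 2 - a * b + b ^ 2 = 0"
  shows "a = 0 \<and> b = 0"
proof -
  have "a ^ 3 + b ^ 3 = (a + b) * (a ^ 2 - a * b + b ^ 2)"
    by (simp add: power2_eq_square power3_eq_cube algebra_simps)
  then have b: "b = - a" using assms cube_eq_minus[of a b] by simp
  then have "3 * a ^ 2 = 0" using assms(3) by (simp add: power2_eq_square)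
  then show ?thesis using three b by simp
qed

lemma card_norm_zero: "card {(a, b). a \<in> L \<and> b \<in> L \<and> a ^ 2 - a * b + b ^ 2 = 0} = 1"
proof -
  have "{(a, b). a \<in> L \<and> b \<in> L \<and> a ^ 2 - a * b + b ^ 2 = 0} = {(0, 0)}"
    using norm_zero by auto
  then show ?thesis by simp
qed

text \<open>The member \<open>m = 1\<close> is the plane \<open>a + b + c = 0\<close> together with
  the zeros of a norm form in \<open>a - c\<close> and \<open>b - c\<close>, which over
  \<open>L\<close> is only the diagonal. The plane and the diagonal meet in the origin because 3 is
  nonzero.\<close>

lemma card_form_1: "int (card {p \<in> L3. form 1 p = 0}) = q ^ 2 + q - 1"
proof -
  have "form 1 (a, b, c) = 0 \<longleftrightarrow> c = - a - b \<or> (a = c \<and> b = c)" if "a \<in> L" "b \<in> L" "c \<in> L" for a b c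
  proof -
    have "form 1 (a, b, c) = (a + b + c) * ((a - c) ^ 2 - (a - c) * (b - c) + (b - c) ^ 2)"
      by (simp add: form_def power2_eq_square power3_eq_cube algebra_simps)
    then have "form 1 (a, b, c) = 0 \<longleftrightarrow> a + b + c = 0 \<or> (a - c) ^ 2 - (a - c) * (b - c) + (b - c) ^ 2 = 0"
      by simp
    also have "a + b + c = 0 \<longleftrightarrow> c = - a - b"
      by (metis add_eq_0_iff minus_add_distrib diff_conv_add_uminus)
    also have "(a - c) ^ 2 - (a - c) * (b - c) + (b - c) ^ 2 = 0 \<longleftrightarrow> a = c \<and> b = c"
      using norm_zero[of "a - c" "b - c"] that by auto
    finally show ?thesis .
  qed
  then have "{p \<in> L3. form 1 p = 0} = (\<lambda>(a, b). (a, b, - a - b)) ` (L \<times> L) \<union> (\<lambda>a. (a, a, a)) ` (L - {0})"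
    by (fastforce simp: image_iff)
  moreover have "(\<lambda>(a, b). (a, b, - a - b)) ` (L \<times> L) \<inter> (\<lambda>a. (a, a, a)) ` (L - {0}) = {}"
  proof -
    have False if "a = - a - a" "a \<noteq> 0" for a :: 'b
    proof -
      have "3 * a = 0" using that(1) by (simp add: algebra_simps eq_diff_eq)
      with that(2) three show False by (simp only: mult_eq_0_iff) simp
    qed
    then show ?thesis using three by auto
  qed
  moreover have "card ((\<lambda>(a, b). (a, b, - a - b)) ` (L \<times> L)) = card (L \<times> L)"
    by (rule card_image) (auto simp: inj_on_def)
  moreover have "card ((\<lambda>a. (a, a, a)) ` (L - {0})) = card (L - {0})"
    by (rule card_image) (auto simp: inj_on_def)
  ultimately have "int (card {p \<in> L3. form 1 p = 0}) = int (card (L \<times> L)) + int (card (L - {0}))"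
    using finite_L by (simp add: card_Un_disjoint)
  then show ?thesis
    using card_L_minus[of 0] by (simp add: card_cartesian_product power2_eq_square)
qed

theorem card_affine_nonsplit: "int (card affine_pts) = q ^ 3 + q - 1"
proof -
  have "affine_pts = (SIGMA m:L. {p \<in> L3. form m p = m ^ 3 - 1})"
    by (auto simp: affine_pts_def form_def)
  then have "int (card affine_pts) = (\<Sum>m\<in>L. int (card {p \<in> L3. form m p = m ^ 3 - 1}))"
    using finite_L finite_L3 by (simp add: int_card_Sigma)
  then have "(q - 1) * int (card affine_pts) = (\<Sum>m\<in>L. (q - 1) * int (card {p \<in> L3. form m p = m ^ 3 - 1}))"
    by (simp add: sum_distrib_left)
  \<comment> \<open>\<open>m = 1\<close> is the only parameter with \<open>m ^ 3 - 1 = 0\<close>,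
    where \<open>card_form_eq\<close> does not apply; the last summand corrects for it.\<close>
  also have "\<dots> = (\<Sum>m\<in>L. (q ^ 3 - int (card {p \<in> L3. form m p = 0}))
      + (if m = 1 then q * int (card {p \<in> L3. form 1 p = 0}) - q ^ 3 else 0))"
  proof (rule sum.cong[OF refl])
    fix m assume "m \<in> L"
    show "(q - 1) * int (card {p \<in> L3. form m p = m ^ 3 - 1}) = (q ^ 3 - int (card {p \<in> L3. form m p = 0}))
      + (if m = 1 then q * int (card {p \<in> L3. form 1 p = 0}) - q ^ 3 else 0)"
    proof (cases "m = 1")
      case False
      then have "m ^ 3 - 1 \<noteq> 0" using cube_inj[of m 1] \<open>m \<in> L\<close> by auto
      then show ?thesis using card_form_eq[of m "m ^ 3 - 1"] \<open>m \<in> L\<close> False by simp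
    qed (simp add: algebra_simps)
  qed
  also have "\<dots> = q * q ^ 3 - ((q - 1) ^ 3 + q * (3 * q - 2)) + (q * (q ^ 2 + q - 1) - q ^ 3)"
  proof -
    have "{m \<in> L. m = 1} = {1}" by auto
    then show ?thesis
      unfolding sum.distrib sum_subtractf card_form_zero_total sum_if_int[OF finite_L] card_form_1 by simp
  qed
  also have "\<dots> = (q - 1) * (q ^ 3 + q - 1)"
    by (simp add: algebra_simps power2_eq_square power3_eq_cube)
  finally show ?thesis
    using card_L_ge_2 by simp
qed

end

section \<open>Coordinates indexed by the type \<open>5\<close>, and the characteristic of
  polynomial rings\<close>

lemma UNIV_5: "(UNIV :: 5 set) = {0, 1, 2, 3, 4}"
  by (rule card_subset_eq[symmetric]) simp_all

lemma UNIV_5_distinct: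
  assumes "distinct [0 :: 5, i, j, k, l]"
  shows "UNIV = {0, i, j, k, l}" "UNIV - {0} = {i, j, k, l}"
proof -
  show *: "UNIV = {0, i, j, k, l}"
    using assms by (intro card_subset_eq[symmetric]) auto
  show "UNIV - {0} = {i, j, k, l}"
    by (subst *) (use assms in auto)
qed

interpretation ac: coeff_hom to_ac
  by (rule coeff_hom_to_ac)

lemma CHAR_mpoly: "CHAR(('v, 'k::comm_ring_1) mpoly) = CHAR('k)"
proof (rule CHAR_eqI)
  show "of_nat CHAR('k) = (0 :: ('v, 'k) mpoly)"
    by (metis of_nat_CHAR single_of_nat single_zero)
next
  fix n assume "of_nat n = (0 :: ('v, 'k) mpoly)"
  then have "Poly_Mapping.lookup (of_nat n :: ('v, 'k) mpoly) 0 = 0" by simp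
  then have "of_nat n = (0 :: 'k)" by (simp add: lookup_of_nat)
  then show "CHAR('k) dvd n" by (simp add: of_nat_eq_0_iff_char_dvd)
qed

lemma homogeneous_partial_deriv:
  assumes "homogeneous (Suc d) p"
  shows "homogeneous d (partial_deriv i p)"
  unfolding partial_deriv_def
proof (rule homogeneous_sum)
  fix m assume m: "m \<in> Poly_Mapping.keys p"
  show "homogeneous d (Poly_Mapping.single (m - Poly_Mapping.single i 1)
       (of_nat (Poly_Mapping.lookup m i) * Poly_Mapping.lookup p m))"
  proof (cases "Poly_Mapping.lookup m i = 0")
    case False
    have "m = (m - Poly_Mapping.single i 1) + Poly_Mapping.single i 1"
      using False by (intro poly_mapping_eqI) (auto simp: lookup_add lookup_minus lookup_single when_def)
    then have "mdeg m = mdeg (m - Poly_Mapping.single i 1) + mdeg (Poly_Mapping.single i 1)"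
      by (metis (no_types, lifting) lookup_add sum.cong sum.distrib)
    also have "mdeg (Poly_Mapping.single i 1) = 1"
    proof -
      have "homogeneous 1 (Var i :: ('a, int) mpoly)" by (rule homogeneous_Var)
      then show ?thesis by (simp add: homogeneous_def Var_def)
    qed
    finally show ?thesis
      using assms m by (auto simp: homogeneous_def)
  qed (simp add: homogeneous_zero)
qed

section \<open>The Burkhardt quartic and its nodes\<close>

lemma sum_UNIV_5_minus_0:
  fixes f :: "5 \<Rightarrow> 'b::comm_monoid_add"
  assumes "distinct [0, i, j, k, l]"
  shows "(\<Sum>m\<in>UNIV - {0}. f m) = f i + f j + f k + f l"
  unfolding UNIV_5_distinct(2)[OF assms] using assms by (simp add: add.assoc)

lemma prod_UNIV_5_minus_0:
  fixes f :: "5 \<Rightarrow> 'b::comm_monoid_mult"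
  assumes "distinct [0, i, j, k, l]"
  shows "(\<Prod>m\<in>UNIV - {0}. f m) = f i * f j * f k * f l"
  unfolding UNIV_5_distinct(2)[OF assms] using assms by (simp add: mult.assoc)

lemma distinct_1234: "distinct [0 :: 5, 1, 2, 3, 4]"
  by simp

text \<open>The quartic is symmetric in the four coordinates other than \<open>y\<^sub>0\<close>. An
  arbitrary ordering \<open>i, j, k, l\<close> of their indices then replaces case distinctions over
  indices.\<close>

lemma burkhardt_perm:
  assumes "distinct [0 :: 5, i, j, k, l]"
  shows "burkhardt = Var 0 * (Var 0 ^ 3 + Var i ^ 3 + Var j ^ 3 + Var k ^ 3 + Var l ^ 3)
    + 3 * Var i * Var j * Var k * Var l"
proof -
  have "burkhardt = Var 0 * (Var 0 ^ 3 + (\<Sum>i\<in>UNIV - {0}. Var i ^ 3)) + 3 * (\<Prod>i\<in>UNIV - {0}. Var i)"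
    unfolding burkhardt_def sum_UNIV_5_minus_0[OF distinct_1234] prod_UNIV_5_minus_0[OF distinct_1234]
    by (simp only: add.assoc mult.assoc)
  then show ?thesis
    unfolding sum_UNIV_5_minus_0[OF assms] prod_UNIV_5_minus_0[OF assms]
    by (simp only: add.assoc mult.assoc)
qed

lemma homogeneous_burkhardt: "homogeneous 4 burkhardt"
proof -
  have c: "homogeneous 3 (Var i ^ 3)" for i :: 5
    using homogeneous_power[OF homogeneous_Var[of i], of 3] by simp
  have "homogeneous (1 + 3) (Var 0 * (Var 0 ^ 3 + Var 1 ^ 3 + Var 2 ^ 3 + Var 3 ^ 3 + Var (4::5) ^ 3))"
    by (intro homogeneous_mult homogeneous_add c homogeneous_Var)
  moreover have "homogeneous (0 + 1 + 1 + 1 + 1) (3 * Var 1 * Var 2 * Var 3 * Var (4::5))"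
    by (intro homogeneous_mult homogeneous_Var homogeneous_numeral)
  moreover have "(0::nat) + 1 + 1 + 1 + 1 = 4" "(1::nat) + 3 = 4"
    by simp_all
  ultimately show ?thesis
    unfolding burkhardt_def by (metis homogeneous_add)
qed

lemma partial_deriv_cube: "partial_deriv i (p ^ 3) = 3 * p ^ 2 * partial_deriv i p"
proof -
  have "partial_deriv i (p ^ Suc 2) = of_nat (Suc 2) * p ^ 2 * partial_deriv i p"
    by (rule partial_deriv_power)
  moreover have "Suc 2 = 3" by simp
  ultimately show ?thesis by (simp only: of_nat_numeral)
qed

lemma eval_partial_0:
  fixes x :: "5 \<Rightarrow> 'k::field alg_closure"
  assumes "distinct [0 :: 5, i, j, k, l]"
  shows "eval_ac x (partial_deriv 0 burkhardt) = 4 * x 0 ^ 3 + x i ^ 3 + x j ^ 3 + x k ^ 3 + x l ^ 3"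
proof -
  have ne: "0 \<noteq> i" "0 \<noteq> j" "0 \<noteq> k" "0 \<noteq> l"
    using assms by auto
  have "partial_deriv 0 (burkhardt :: (5, 'k) mpoly) = Var 0 ^ 3 + Var i ^ 3 + Var j ^ 3 + Var k ^ 3 + Var l ^ 3 + Var 0 * (3 * Var 0 ^ 2)"
    unfolding burkhardt_perm[OF assms]
    by (simp only: partial_deriv_add partial_deriv_mult partial_deriv_cube partial_deriv_numeral
      partial_deriv_Var ne refl if_True if_False) (simp only: mult_zero_left mult_zero_right add_0 add_0_right mult_1 mult_1_right)
  then have "eval_ac x (partial_deriv 0 burkhardt) = x 0 ^ 3 + x i ^ 3 + x j ^ 3 + x k ^ 3 + x l ^ 3 + x 0 * (3 * x 0 ^ 2)"
    by (simp only: eval_ac_eq_mp_eval ac.mp_eval_add ac.mp_eval_mult ac.mp_eval_power ac.mp_eval_Var ac.mp_eval_numeral)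
  also have "\<dots> = 4 * x 0 ^ 3 + x i ^ 3 + x j ^ 3 + x k ^ 3 + x l ^ 3"
    by (simp add: power2_eq_square power3_eq_cube)
  finally show ?thesis .
qed

lemma eval_partial_i:
  fixes x :: "5 \<Rightarrow> 'k::field alg_closure"
  assumes "distinct [0 :: 5, i, j, k, l]"
  shows "eval_ac x (partial_deriv i burkhardt) = 3 * (x 0 * x i ^ 2 + x j * x k * x l)"
proof -
  have ne: "i \<noteq> 0" "i \<noteq> j" "i \<noteq> k" "i \<noteq> l"
    using assms by auto
  have "partial_deriv i (burkhardt :: (5, 'k) mpoly) = Var 0 * (3 * Var i ^ 2) + 3 * Var j * Var k * Var l"
    unfolding burkhardt_perm[OF assms]
    by (simp only: partial_deriv_add partial_deriv_mult partial_deriv_cube partial_deriv_numeral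
      partial_deriv_Var ne refl if_True if_False)
      (simp only: mult_zero_left mult_zero_right add_0 add_0_right mult_1 mult_1_right)
  then have "eval_ac x (partial_deriv i burkhardt) = x 0 * (3 * x i ^ 2) + 3 * x j * x k * x l"
    by (simp only: eval_ac_eq_mp_eval ac.mp_eval_add ac.mp_eval_mult ac.mp_eval_power ac.mp_eval_Var ac.mp_eval_numeral)
  also have "\<dots> = 3 * (x 0 * x i ^ 2 + x j * x k * x l)"
    by (simp only: distrib_left mult.assoc mult.left_commute)
  finally show ?thesis .
qed

lemma eval_burkhardt:
  fixes x :: "5 \<Rightarrow> 'k::field alg_closure"
  assumes "distinct [0 :: 5, i, j, k, l]"
  shows "eval_ac x burkhardt = x 0 * (x 0 ^ 3 + x i ^ 3 + x j ^ 3 + x k ^ 3 + x l ^ 3) + 3 * x i * x j * x k * x l"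
  unfolding burkhardt_perm[OF assms]
  by (simp only: eval_ac_eq_mp_eval ac.mp_eval_add ac.mp_eval_mult ac.mp_eval_power ac.mp_eval_Var ac.mp_eval_numeral)

text \<open>The coordinates are \<open>- x 0\<close> times four cube roots of unity with product 1:
  projectively 27 nodes over the closure.\<close>

definition node_A :: "(5 \<Rightarrow> 'b::field) \<Rightarrow> bool" where
  "node_A x \<longleftrightarrow> x 0 \<noteq> 0 \<and> (\<forall>i. i \<noteq> 0 \<longrightarrow> x i ^ 3 = - (x 0 ^ 3)) \<and> x 1 * x 2 * x 3 * x 4 = x 0 ^ 4"

text \<open>The nodes on \<open>y\<^sub>0 = 0\<close>: three for each of the six pairs of indices,
  18 in all.\<close>

definition node_B :: "5 \<Rightarrow> 5 \<Rightarrow> (5 \<Rightarrow> 'b::field) \<Rightarrow> bool" where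
  "node_B i j x \<longleftrightarrow> i \<noteq> 0 \<and> j \<noteq> 0 \<and> i \<noteq> j \<and> x i \<noteq> 0 \<and> x j ^ 3 = - (x i ^ 3) \<and> (\<forall>k. k \<noteq> i \<longrightarrow> k \<noteq> j \<longrightarrow> x k = 0)"

lemma prod_perm:
  fixes x :: "5 \<Rightarrow> 'b::comm_monoid_mult"
  assumes "distinct [0, i, j, k, l]"
  shows "x i * x j * x k * x l = x 1 * x 2 * x 3 * x 4"
  using prod_UNIV_5_minus_0[OF assms, of x] prod_UNIV_5_minus_0[OF distinct_1234, of x] by (rule trans[OF sym])

lemma ex_perm: 
  assumes "i \<noteq> 0" "j \<noteq> (0::5)" "i \<noteq> j"
  obtains k l where "distinct [0 :: 5, i, j, k, l]"
proof -
  have "card (UNIV - {0, i, j}) = 2"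
    using assms by (simp add: card_Diff_subset)
  then obtain k l where "UNIV - {0, i, j} = {k, l}" "k \<noteq> l"
    by (auto simp: card_2_iff)
  then have "k \<in> UNIV - {0, i, j}" "l \<in> UNIV - {0, i, j}" by blast+
  with \<open>k \<noteq> l\<close> assms that[of k l] show ?thesis by auto
qed

lemma ex_other: "\<exists>j::5. j \<noteq> 0 \<and> j \<noteq> i"
  by (cases "i = 1") (auto intro: exI[of _ 1] exI[of _ 2])

text \<open>If \<open>x 0\<close> is nonzero, multiplying the \<open>i\<close>-th derivative by
  \<open>x i\<close> gives \<open>x 0 * x i ^ 3 = - P\<close> with \<open>P\<close> the product of
  the other four coordinates, and the quartic itself becomes \<open>x 0 ^ 4 - P\<close>. If
  \<open>x 0 = 0\<close>, any three of the other coordinates have product zero, so at most two are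
  nonzero, and the derivative in \<open>y\<^sub>0\<close> relates their cubes.\<close>

lemma singular_cone_iff:
  fixes x :: "5 \<Rightarrow> 'k::field alg_closure"
  assumes three: "(3 :: 'k) \<noteq> 0"
  shows "x \<in> singular_cone burkhardt \<longleftrightarrow> node_A x \<or> (\<exists>i j. node_B i j x)"
proof -
  have three': "(3 :: 'k alg_closure) \<noteq> 0"
    using three by (metis to_ac_eq_0_iff to_ac_numeral)
  show ?thesis
  proof
    assume "x \<in> singular_cone burkhardt"
    then have nz: "\<exists>i. x i \<noteq> 0" and F: "eval_ac x burkhardt = 0"
      and D: "\<And>i. eval_ac x (partial_deriv i burkhardt) = 0"
      by (auto simp: singular_cone_def)
    have D0: "4 * x 0 ^ 3 + x i ^ 3 + x j ^ 3 + x k ^ 3 + x l ^ 3 = 0" if "distinct [0 :: 5, i, j, k, l]" for i j k l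
      using D eval_partial_0[OF that] by metis
    have Di: "x 0 * x i ^ 2 + x j * x k * x l = 0" if "distinct [0 :: 5, i, j, k, l]" for i j k l
      using D[of i] three' unfolding eval_partial_i[OF that] mult_eq_0_iff by blast
    show "node_A x \<or> (\<exists>i j. node_B i j x)"
    proof (cases "x 0 = 0")
      case False
      define P where "P = x 1 * x 2 * x 3 * x 4"
      have c: "x 0 * x i ^ 3 = - P" if i0: "i \<noteq> 0" for i
      proof -
        obtain j where "j \<noteq> 0" "j \<noteq> i"
          using ex_other[of i] by blast
        then obtain k l where d: "distinct [0 :: 5, i, j, k, l]"
          using ex_perm[of i j] i0 by metis
        have "x 0 * x i ^ 3 + x i * x j * x k * x l = x i * (x 0 * x i ^ 2 + x j * x k * x l)"
          by (simp add: algebra_simps power2_eq_square power3_eq_cube)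
        also have "\<dots> = 0" using Di[OF d] by simp
        finally show ?thesis
          using prod_perm[OF d, of x] by (simp add: P_def eq_neg_iff_add_eq_0)
      qed
      have "eval_ac x burkhardt = x 0 ^ 4 + (x 0 * x 1 ^ 3 + x 0 * x 2 ^ 3 + x 0 * x 3 ^ 3 + x 0 * x 4 ^ 3) + 3 * P"
        by (subst eval_burkhardt[of 1 2 3 4]) (simp_all add: P_def algebra_simps power_numeral_reduce)
      then have P: "x 0 ^ 4 = P"
        using F by (simp add: c algebra_simps)
      have "x i ^ 3 = - (x 0 ^ 3)" if "i \<noteq> 0" for i
      proof -
        have "x 0 * (x i ^ 3 + x 0 ^ 3) = 0"
          using c[OF that] P by (simp add: algebra_simps power_numeral_reduce)
        then show ?thesis using False by (simp add: eq_neg_iff_add_eq_0)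
      qed
      with False P show ?thesis by (auto simp: node_A_def P_def)
    next
      case True
      with nz obtain i where i: "x i \<noteq> 0" "i \<noteq> 0" by auto
      have T: "x j * x k * x l = 0" if "distinct [0 :: 5, i, j, k, l]" for i j k l
        using Di[OF that] True by simp
      show ?thesis
      proof (cases "\<exists>j. j \<noteq> i \<and> x j \<noteq> 0")
        case False
        obtain j where "j \<noteq> 0" "j \<noteq> i"
          using ex_other[of i] by blast
        then obtain k l where d: "distinct [0 :: 5, i, j, k, l]"
          using ex_perm[of i j] i by metis
        then have "x j = 0" "x k = 0" "x l = 0"
          using False by auto
        with D0[OF d] True i have False by simp
        then show ?thesis ..
      next
        case True
        then obtain j where j: "j \<noteq> i" "x j \<noteq> 0" by blast
        with \<open>x 0 = 0\<close> have "j \<noteq> 0" by auto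
        then obtain k l where d: "distinct [0 :: 5, i, j, k, l]"
          using ex_perm[of i j] i j by metis
        have "x l = 0" "x k = 0"
          using T[of k i j l] T[of l i j k] d i j by auto
        moreover have "x i ^ 3 + x j ^ 3 = 0"
          using D0[OF d] \<open>x 0 = 0\<close> calculation by simp
        moreover have "x m = 0" if "m \<noteq> i" "m \<noteq> j" for m
        proof -
          have "m \<in> {0, i, j, k, l}" using UNIV_5_distinct(1)[OF d] by blast
          with that \<open>x 0 = 0\<close> calculation show ?thesis by auto
        qed
        ultimately have "node_B i j x"
          using i j \<open>j \<noteq> 0\<close> by (auto simp: node_B_def eq_neg_iff_add_eq_0 add.commute)
        then show ?thesis by blast
      qed
    qed
  next
    assume "node_A x \<or> (\<exists>i j. node_B i j x)"
    then show "x \<in> singular_cone burkhardt"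
    proof
      assume A: "node_A x"
      then have c: "x i ^ 3 = - (x 0 ^ 3)" if "i \<noteq> 0" for i
        using that by (simp add: node_A_def)
      have P: "x 1 * x 2 * x 3 * x 4 = x 0 ^ 4" and "x 0 \<noteq> 0" using A by (auto simp: node_A_def)
      have nzi: "x i \<noteq> 0" for i
        using c[of i] \<open>x 0 \<noteq> 0\<close> by (cases "i = 0") auto
      have "eval_ac x burkhardt = x 0 * (x 0 ^ 3 + x 1 ^ 3 + x 2 ^ 3 + x 3 ^ 3 + x 4 ^ 3) + 3 * (x 1 * x 2 * x 3 * x 4)"
        using eval_burkhardt[OF distinct_1234, of x] by (simp add: mult.assoc)
      also have "\<dots> = x 0 * (- (3 * x 0 ^ 3)) + 3 * x 0 ^ 4"
        unfolding P by (simp add: c)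
      finally have F: "eval_ac x burkhardt = 0"
        by (simp add: power_numeral_reduce)
      have D0: "eval_ac x (partial_deriv 0 burkhardt) = 0"
        by (subst eval_partial_0[of 1 2 3 4]) (simp_all add: c)
      have Di: "eval_ac x (partial_deriv i burkhardt) = 0" if i0: "i \<noteq> 0" for i
      proof -
        obtain j where "j \<noteq> 0" "j \<noteq> i"
          using ex_other[of i] by blast
        then obtain k l where d: "distinct [0 :: 5, i, j, k, l]"
          using ex_perm[of i j] i0 by metis
        have "x i * (x 0 * x i ^ 2 + x j * x k * x l) = x 0 * x i ^ 3 + x i * x j * x k * x l"
          by (simp add: algebra_simps power2_eq_square power3_eq_cube)
        also have "\<dots> = 0"
          using prod_perm[OF d, of x] c[OF that] P by (simp add: power_numeral_reduce)
        finally show ?thesis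
          using nzi[of i] by (simp add: eval_partial_i[OF d])
      qed
      have "eval_ac x (partial_deriv i burkhardt) = 0" for i
        using D0 Di by (cases "i = 0") auto
      then show ?thesis
        using F \<open>x 0 \<noteq> 0\<close> by (auto simp: singular_cone_def)
    next
      assume "\<exists>i j. node_B i j x"
      then obtain i j where B: "node_B i j x" by blast
      then obtain k l where d: "distinct [0 :: 5, i, j, k, l]"
        using ex_perm[of i j] by (auto simp: node_B_def)
      have z: "x 0 = 0" "x k = 0" "x l = 0" and c: "x j ^ 3 = - (x i ^ 3)" and "x i \<noteq> 0"
        using B d by (auto simp: node_B_def)
      have "eval_ac x (partial_deriv m burkhardt) = 0" for m
      proof -
        have "m \<in> {0, i, j, k, l}" using UNIV_5_distinct(1)[OF d] by blast
        then consider "m = 0" | "m = i" | "m = j" | "m = k" | "m = l" by blast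
        then show ?thesis
        proof cases
          case 1 then show ?thesis using eval_partial_0[OF d, of x] by (simp add: z c)
        next
          case 2 then show ?thesis using eval_partial_i[of i j k l x] d by (auto simp: z)
        next
          case 3
          have "distinct [0, j, i, k, l]" using d by auto
          from eval_partial_i[OF this, of x] 3 show ?thesis by (simp add: z)
        next
          case 4
          have "distinct [0, k, i, j, l]" using d by auto
          from eval_partial_i[OF this, of x] 4 show ?thesis by (simp add: z)
        next
          case 5
          have "distinct [0, l, i, j, k]" using d by auto
          from eval_partial_i[OF this, of x] 5 show ?thesis by (simp add: z)
        qed
      qed
      moreover have "eval_ac x burkhardt = 0"
        using eval_burkhardt[OF d, of x] by (simp add: z)
      ultimately show ?thesis
        using \<open>x i \<noteq> 0\<close> by (auto simp: singular_cone_def)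
    qed
  qed
qed

lemma singular_cone_scale:
  fixes x :: "5 \<Rightarrow> 'k::field alg_closure"
  assumes "x \<in> singular_cone burkhardt" "s \<noteq> 0"
  shows "(\<lambda>i. s * x i) \<in> singular_cone burkhardt"
proof -
  have "homogeneous 3 (partial_deriv i (burkhardt :: (5, 'k) mpoly))" for i
    by (rule homogeneous_partial_deriv) (use homogeneous_burkhardt in \<open>simp add: eval_nat_numeral\<close>)
  then show ?thesis
    using assms ac.mp_eval_homogeneous_scale[OF homogeneous_burkhardt[where 'a = 'k], of s x]
      ac.mp_eval_homogeneous_scale[of 3 "partial_deriv _ (burkhardt :: (5, 'k) mpoly)" s x]
    by (simp add: singular_cone_def eval_ac_eq_mp_eval)
qed

section \<open>The ideal of the nodes and its local generators\<close>

lemma is_ideal_add: "is_ideal I \<Longrightarrow> f \<in> I \<Longrightarrow> g \<in> I \<Longrightarrow> f + g \<in> I"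
  by (rule ring_mod.subspace_add)

lemma is_ideal_diff: "is_ideal I \<Longrightarrow> f \<in> I \<Longrightarrow> g \<in> I \<Longrightarrow> f - g \<in> I"
  by (rule ring_mod.subspace_diff)

lemma is_ideal_zero: "is_ideal I \<Longrightarrow> 0 \<in> I"
  by (rule ring_mod.subspace_0)

lemma is_ideal_sum: "is_ideal I \<Longrightarrow> (\<And>i. i \<in> S \<Longrightarrow> f i \<in> I) \<Longrightarrow> sum f S \<in> I"
  by (rule ring_mod.subspace_sum)

lemma is_idealI:
  assumes "0 \<in> I" "\<And>f g. f \<in> I \<Longrightarrow> g \<in> I \<Longrightarrow> f + g \<in> I" "\<And>f g. f \<in> I \<Longrightarrow> g * f \<in> I"
  shows "is_ideal I"
  using assms by (auto intro!: ring_mod.subspaceI)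

lemma ideal_hull_ideal: "is_ideal (ideal_hull S)"
  by (rule ring_mod.subspace_span)

lemma is_ideal_vanishing: "is_ideal (vanishing_ideal Z)"
  by (rule is_idealI) (simp_all add: vanishing_ideal_def eval_ac_eq_mp_eval)

lemma mult_mem_ideal_power_2:
  assumes "f \<in> I" "g \<in> I"
  shows "f * g \<in> ideal_power I 2"
proof -
  have "f * (g * 1) \<in> ideal_power I (Suc (Suc 0))"
    by (intro ideal_power_Suc_mult assms) simp
  then show ?thesis by (simp add: numeral_2_eq_2)
qed

abbreviation sing_ideal :: "(5, 'k::field) mpoly set" where
  "sing_ideal \<equiv> vanishing_ideal (singular_cone burkhardt)"

text \<open>For a node \<open>x\<close> the value of \<open>g\<close> at \<open>s * x\<close> is a
  polynomial in \<open>s\<close> whose coefficients are the values of the components at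
  \<open>x\<close>. It vanishes for every nonzero \<open>s\<close> in an infinite field.\<close>

lemma hcomp_sing_ideal:
  fixes g :: "(5, 'k::{field, finite}) mpoly"
  assumes "g \<in> sing_ideal"
  shows "hcomp d g \<in> sing_ideal"
  unfolding vanishing_ideal_def
proof safe
  fix x :: "5 \<Rightarrow> 'k alg_closure" assume x: "x \<in> singular_cone (burkhardt :: (5, 'k) mpoly)"
  obtain N where N: "g = (\<Sum>d\<le>N. hcomp d g)"
    using sum_hcomp by blast
  define p where "p = (\<Sum>d\<le>N. monom (eval_ac x (hcomp d g)) d)"
  have "poly p s = 0" if "s \<noteq> 0" for s
  proof -
    have "0 = eval_ac (\<lambda>i. s * x i) g"
      using assms singular_cone_scale[OF x that] by (simp add: vanishing_ideal_def)
    also have "\<dots> = (\<Sum>d\<le>N. eval_ac (\<lambda>i. s * x i) (hcomp d g))"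
      by (subst N) (simp add: eval_ac_eq_mp_eval)
    also have "\<dots> = (\<Sum>d\<le>N. s ^ d * eval_ac x (hcomp d g))"
      by (simp add: eval_ac_eq_mp_eval ac.mp_eval_homogeneous_scale[OF homogeneous_hcomp])
    also have "\<dots> = poly p s"
      by (simp add: p_def poly_sum poly_monom mult.commute)
    finally show ?thesis by simp
  qed
  then have "UNIV - {0} \<subseteq> {s. poly p s = 0}" by auto
  moreover have "infinite (UNIV - {0 :: 'k alg_closure})"
    using infinite_alg_closure by simp
  ultimately have "p = 0"
    using poly_roots_finite[of p] finite_subset by blast
  then have "coeff p d = 0" by simp
  moreover have "coeff p d = (if d \<le> N then eval_ac x (hcomp d g) else 0)"
    by (simp add: p_def coeff_sum)
  moreover have "hcomp d g = 0" if "d > N"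
  proof -
    have "hcomp d g = hcomp d (\<Sum>e\<le>N. hcomp e g)"
      using N by simp
    also have "\<dots> = 0"
    proof -
      have "Poly_Mapping.keys (\<Sum>e\<le>N. hcomp e g) \<subseteq> (\<Union>e\<in>{..N}. Poly_Mapping.keys (hcomp e g))"
        by (rule keys_sum)
      then have "{m \<in> Poly_Mapping.keys (\<Sum>e\<le>N. hcomp e g). mdeg m = d} = {}"
        using homogeneous_hcomp[of _ g] that by (auto simp: homogeneous_def)
      then show ?thesis by (subst hcomp_def) (simp only: sum.empty)
    qed
    finally show ?thesis .
  qed
  ultimately show "eval_ac x (hcomp d g) = 0"
    by (cases "d \<le> N") (auto simp: eval_ac_eq_mp_eval)
qed

text \<open>At a node, \<open>Var i ^ 3 + Var j ^ 3\<close> replaces the parameter \<open>x j * Var i - x i * Var j\<close>, whose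
  coefficients need not lie in the base field.\<close>

definition local_param :: "(5 \<Rightarrow> 'k alg_closure) \<Rightarrow> 5 \<Rightarrow> 5 \<Rightarrow> (5, 'k::field) mpoly" where
  "local_param x j i = (if x i = 0 then Var i else Var i ^ 3 + Var j ^ 3)"

text \<open>\<open>j\<close> picks the affine chart. The multiplier \<open>h\<close> stands in for
  localisation at \<open>x\<close>: it is nonzero at \<open>x\<close>, and it kills the nodes at
  which a local parameter does not vanish, so that the products lie in the global ideal.\<close>

locale node_chart =
  fixes x :: "5 \<Rightarrow> 'k::{field, finite} alg_closure" and j :: 5 and h :: "(5, 'k) mpoly"
  assumes card_not_3: "\<not> 3 dvd CARD('k)"
    and node: "x \<in> singular_cone (burkhardt :: (5, 'k) mpoly)"
    and pivot: "x j \<noteq> 0"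
    and cubes: "x i \<noteq> 0 \<Longrightarrow> i \<noteq> j \<Longrightarrow> x i ^ 3 = - (x j ^ 3)"
    and h_nz: "eval_ac x h \<noteq> 0"
    and h_param: "i \<noteq> j \<Longrightarrow> h * local_param x j i \<in> sing_ideal"
begin

definition param_ideal :: "(5, 'k) mpoly set" where
  "param_ideal = ideal_hull {h * local_param x j i | i. i \<noteq> j}"

text \<open>The contraction to the polynomial ring of the localisation of \<open>param_ideal\<close>
  at \<open>x\<close>.\<close>

definition germ_ideal :: "(5, 'k) mpoly set" where
  "germ_ideal = {f. \<exists>u. eval_ac x u \<noteq> 0 \<and> u * f \<in> param_ideal}"

lemma is_ideal_param: "is_ideal param_ideal"
  unfolding param_ideal_def by (rule ideal_hull_ideal)

lemma is_ideal_germ: "is_ideal germ_ideal"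
proof (rule is_idealI)
  show "0 \<in> germ_ideal"
    using h_nz is_ideal_zero[OF is_ideal_param] by (auto simp: germ_ideal_def)
next
  fix f g assume "f \<in> germ_ideal" "g \<in> germ_ideal"
  then obtain u v where u: "eval_ac x u \<noteq> 0" "u * f \<in> param_ideal"
    and v: "eval_ac x v \<noteq> 0" "v * g \<in> param_ideal"
    by (auto simp: germ_ideal_def)
  have "v * (u * f) + u * (v * g) \<in> param_ideal"
    using is_ideal_add[OF is_ideal_param] is_ideal_mult_left[OF is_ideal_param] u(2) v(2) by metis
  then have "(u * v) * (f + g) \<in> param_ideal"
    by (simp add: algebra_simps)
  moreover have "eval_ac x (u * v) \<noteq> 0"
    using u v by (simp add: eval_ac_eq_mp_eval)
  ultimately show "f + g \<in> germ_ideal"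
    unfolding germ_ideal_def by blast
next
  fix f g assume "f \<in> germ_ideal"
  then obtain u where u: "eval_ac x u \<noteq> 0" "u * f \<in> param_ideal"
    by (auto simp: germ_ideal_def)
  have "g * (u * f) \<in> param_ideal"
    using is_ideal_mult_left[OF is_ideal_param u(2)] .
  then show "g * f \<in> germ_ideal"
    using u by (auto simp: germ_ideal_def mult.left_commute)
qed

lemma germ_ideal_cancel:
  assumes "f * g \<in> germ_ideal" "eval_ac x g \<noteq> 0"
  shows "f \<in> germ_ideal"
proof -
  from assms(1) obtain u where u: "eval_ac x u \<noteq> 0" "u * (f * g) \<in> param_ideal"
    by (auto simp: germ_ideal_def)
  then have "(u * g) * f \<in> param_ideal" by (simp add: mult_ac)
  moreover have "eval_ac x (u * g) \<noteq> 0"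
    using u assms by (simp add: eval_ac_eq_mp_eval)
  ultimately show ?thesis unfolding germ_ideal_def by blast
qed

lemma germ_ideal_diff_mult:
  assumes "a - c \<in> germ_ideal" "b - d \<in> germ_ideal"
  shows "a * b - c * d \<in> germ_ideal"
proof -
  have "(a - c) * b + c * (b - d) \<in> germ_ideal"
    by (rule is_ideal_add[OF is_ideal_germ is_ideal_mult_right[OF is_ideal_germ assms(1)]
      is_ideal_mult_left[OF is_ideal_germ assms(2)]])
  then show ?thesis by (simp add: algebra_simps)
qed

lemma germ_ideal_diff_power: "a - c \<in> germ_ideal \<Longrightarrow> a ^ n - c ^ n \<in> germ_ideal"
  by (induction n) (simp_all add: is_ideal_zero[OF is_ideal_germ] germ_ideal_diff_mult)

lemma local_param_germ: "i \<noteq> j \<Longrightarrow> local_param x j i \<in> germ_ideal"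
  unfolding germ_ideal_def param_ideal_def
  using h_nz by (auto intro!: exI[of _ h] ring_mod.span_base)

text \<open>On the germ at the node, \<open>Var i / Var j\<close> is zero or the negative of a cube root of unity,
  hence it is fixed by the square of the Frobenius of the base field.\<close>

lemma frobenius_Var_germ:
  "Var i ^ (CARD('k) ^ 2) - Var j ^ (CARD('k) ^ 2 - 1) * Var i \<in> germ_ideal"
proof -
  define Q where "Q = CARD('k) ^ 2"
  have "CARD('k) mod 3 = 1 \<or> CARD('k) mod 3 = 2"
    using card_not_3 by (simp add: dvd_eq_mod_eq_0) linarith
  \<comment> \<open>The size of the base field may be 2 modulo 3. Its square is always 1, which
    makes \<open>(Q - 1) / 3\<close> available as an exponent.\<close>
  then have "Q mod 3 = 1"
    unfolding Q_def power2_eq_square by (auto simp: mod_mult_eq[symmetric, of "CARD('k)"])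
  define m where "m = Q div 3"
  have Q: "Q = Suc (3 * m)"
    using \<open>Q mod 3 = 1\<close> by (simp add: m_def) presburger
  show ?thesis
  proof (cases "i = j")
    case True
    then show ?thesis
      unfolding Q_def[symmetric] Q using is_ideal_zero[OF is_ideal_germ] by (simp add: mult.commute)
  next
    case ij: False
    show ?thesis
    proof (cases "x i = 0")
      case True
      then have "Var i \<in> germ_ideal"
        using local_param_germ[OF ij] by (simp add: local_param_def)
      then have "(Var i ^ (3 * m) - Var j ^ (3 * m)) * Var i \<in> germ_ideal"
        by (rule is_ideal_mult_left[OF is_ideal_germ])
      then show ?thesis
        unfolding Q_def[symmetric] Q by (simp add: algebra_simps)
    next
      case False
      then have g: "Var i ^ 3 + Var j ^ 3 \<in> germ_ideal"
        using local_param_germ[OF ij] by (simp add: local_param_def)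
      \<comment> \<open>The aim is \<open>(- 1) ^ m = 1\<close>. Deriving it from the fact that
        Frobenius fixes -1 treats odd and even characteristic alike.\<close>
      have "(- 1 :: 'k) ^ Q = - 1"
        by (simp add: Q_def power2_eq_square power_mult card_power_eq_same)
      then have "- ((- 1 :: 'k) ^ (3 * m)) = - 1"
        unfolding Q power_Suc by (simp only: mult_minus1)
      then have "((- 1 :: 'k) ^ 3) ^ m = 1"
        by (simp only: power_mult neg_equal_iff_equal)
      then have "(- 1 :: 'k) ^ m = 1"
        by (simp add: power3_eq_cube)
      then have m1: "(- 1 :: (5, 'k) mpoly) ^ m = 1"
      proof -
        have "(Const (- 1) :: (5, 'k) mpoly) ^ m = Const ((- 1) ^ m)"
          by (induction m) (simp_all add: Const_def mult_single)
        moreover have "(Const (- 1) :: (5, 'k) mpoly) = - 1"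
          by (simp add: Const_def single_uminus)
        ultimately show ?thesis
          using \<open>(- 1 :: 'k) ^ m = 1\<close> by (simp add: Const_def)
      qed
      have "(Var i ^ 3) ^ m - (- (Var j ^ 3)) ^ m \<in> germ_ideal"
        by (rule germ_ideal_diff_power) (simp add: g)
      moreover have "(- (Var j ^ 3)) ^ m = (Var j ^ (3 * m) :: (5, 'k) mpoly)"
        using power_minus[of "Var j ^ 3 :: (5, 'k) mpoly" m] m1 by (simp add: power_mult)
      ultimately have "Var i ^ (3 * m) - Var j ^ (3 * m) \<in> germ_ideal"
        by (simp add: power_mult)
      then have "Var i * (Var i ^ (3 * m) - Var j ^ (3 * m)) \<in> germ_ideal"
        by (rule is_ideal_mult_left[OF is_ideal_germ])
      then show ?thesis
        unfolding Q_def[symmetric] Q by (simp add: algebra_simps)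
    qed
  qed
qed

text \<open>The coefficients of \<open>g\<close> are fixed by Frobenius, so \<open>g ^ Q\<close> is
  \<open>g\<close> evaluated at the \<open>Q\<close>-th powers of the variables. Modulo the germ
  ideal these are \<open>Var j ^ (Q - 1) * Var i\<close>, and homogeneity turns \<open>g ^ Q\<close>
  into \<open>Var j ^ ((Q - 1) * d) * g\<close>. Hence \<open>g\<close> times
  \<open>g ^ (Q - 1) - Var j ^ ((Q - 1) * d)\<close> lies in the ideal. The second factor is nonzero
  at \<open>x\<close>, as \<open>g\<close> vanishes there and \<open>Var j\<close> does not, so it
  cancels.\<close>

lemma homogeneous_germ:
  assumes g: "homogeneous d g" and 0: "eval_ac x g = 0"
  shows "g \<in> germ_ideal"
proof -
  define Q where "Q = CARD('k) ^ 2"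
  have "Q > 1"
    using CARD_field_ge_2[where 'k = 'k] one_less_power[of "CARD('k)" 2] by (simp add: Q_def)
  interpret C: coeff_hom "Const :: 'k \<Rightarrow> (5, 'k) mpoly"
    by unfold_locales (simp_all add: Const_def single_add mult_single)
  have id: "mp_eval Const Var f = f" for f :: "(5, 'k) mpoly"
    using mp_eval_unique[of "\<lambda>p. p" Const f] by (simp add: Const_def)
  have frob: "g ^ Q = mp_eval Const (\<lambda>i. Var i ^ Q) g" for g :: "(5, 'k) mpoly"
  proof (rule trans[OF mp_eval_unique[of "\<lambda>p. p ^ Q" Const g]])
    show "(p + q) ^ Q = p ^ Q + q ^ Q" for p q :: "(5, 'k) mpoly"
      unfolding Q_def by (rule frobenius_add) (rule CHAR_mpoly)
    show "Const c ^ Q = (Const c :: (5, 'k) mpoly)" for c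
    proof -
      have "(Const c :: (5, 'k) mpoly) ^ n = Const (c ^ n)" for n
        by (induction n) simp_all
      then show ?thesis
        by (simp add: Q_def power2_eq_square power_mult card_power_eq_same)
    qed
  qed (simp_all add: power_mult_distrib)
  have cong: "mp_eval Const s f - mp_eval Const t f \<in> germ_ideal"
    if st: "\<And>i. s i - t i \<in> germ_ideal" for s t and f :: "(5, 'k) mpoly"
  proof -
    have prd: "(\<Prod>i\<in>S. u i) - (\<Prod>i\<in>S. v i) \<in> germ_ideal" if "\<And>i. u i - v i \<in> germ_ideal"
      for u v and S :: "5 set"
      by (induction S rule: infinite_finite_induct) (use that is_ideal_zero[OF is_ideal_germ] germ_ideal_diff_mult in simp_all)
    show ?thesis
      unfolding mp_eval_def sum_subtractf[symmetric] right_diff_distrib[symmetric]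
      by (intro is_ideal_sum is_ideal_mult_left is_ideal_germ prd germ_ideal_diff_power st)
  qed
  have "mp_eval Const (\<lambda>i. Var i ^ Q) g - mp_eval Const (\<lambda>i. Var j ^ (Q - 1) * Var i) g \<in> germ_ideal"
    by (rule cong) (unfold Q_def, rule frobenius_Var_germ)
  then have "g ^ Q - Var j ^ ((Q - 1) * d) * g \<in> germ_ideal"
    unfolding frob[of g, symmetric] C.mp_eval_homogeneous_scale[OF g] id power_mult[symmetric] .
  moreover have "g ^ Q = g * g ^ (Q - 1)"
    using \<open>Q > 1\<close> by (cases Q) simp_all
  ultimately have "g * (g ^ (Q - 1) - Var j ^ ((Q - 1) * d)) \<in> germ_ideal"
    by (simp add: algebra_simps)
  moreover have "eval_ac x (g ^ (Q - 1) - Var j ^ ((Q - 1) * d)) \<noteq> 0"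
    using 0 \<open>Q > 1\<close> pivot by (simp add: eval_ac_eq_mp_eval power_0_left)
  ultimately show ?thesis by (rule germ_ideal_cancel)
qed

end

lemma (in node_chart) sing_ideal_germ:
  assumes "g \<in> sing_ideal"
  shows "g \<in> germ_ideal"
proof -
  obtain N where N: "g = (\<Sum>d\<le>N. hcomp d g)"
    using sum_hcomp by blast
  have "hcomp d g \<in> germ_ideal" for d
    by (rule homogeneous_germ[OF homogeneous_hcomp])
      (use hcomp_sing_ideal[OF assms, of d] node in \<open>auto simp: vanishing_ideal_def\<close>)
  then show ?thesis
    by (subst N) (rule is_ideal_sum[OF is_ideal_germ])
qed

lemma three_neq_0:
  assumes "\<not> 3 dvd CARD('k)"
  shows "(3 :: 'k::{field, finite}) \<noteq> 0" "(3 :: 'k alg_closure) \<noteq> 0"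
proof -
  show *: "(3 :: 'k) \<noteq> 0"
  proof
    assume "(3 :: 'k) = 0"
    then have "of_nat 3 = (0 :: 'k)" by simp
    then have "CHAR('k) dvd 3" by (simp only: of_nat_eq_0_iff_char_dvd)
    moreover have "CHAR('k) dvd CARD('k)"
      using of_nat_card_choose_eq_0[of 1, where 'k = 'k] CARD_field_ge_2[where 'k = 'k]
      by (simp add: of_nat_eq_0_iff_char_dvd)
    moreover have "coprime 3 CARD('k)"
      using assms by (simp add: prime_imp_coprime)
    ultimately have "CHAR('k) = 1"
      by (meson coprime_common_divisor nat_dvd_1_iff_1)
    then show False
      using of_nat_CHAR[where 'a = 'k] by simp
  qed
  then show "(3 :: 'k alg_closure) \<noteq> 0"
    by (metis to_ac_eq_0_iff to_ac_numeral)
qed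

section \<open>Charts and square relations at the two kinds of nodes\<close>

lemma sing_ideal_iff:
  fixes g :: "(5, 'k::{field, finite}) mpoly"
  assumes "\<not> 3 dvd CARD('k)"
  shows "g \<in> sing_ideal \<longleftrightarrow> (\<forall>z. node_A z \<longrightarrow> eval_ac z g = 0) \<and> (\<forall>i j z. node_B i j z \<longrightarrow> eval_ac z g = 0)"
  using singular_cone_iff[OF three_neq_0(1)[OF assms]] by (auto simp: vanishing_ideal_def)

lemma node_A_cube: "node_A z \<Longrightarrow> i \<noteq> 0 \<Longrightarrow> z i ^ 3 = - (z 0 ^ 3)"
  by (simp add: node_A_def)

lemma node_B_0: "node_B i j z \<Longrightarrow> z 0 = 0"
  by (auto simp: node_B_def)

lemma node_B_support:
  assumes "node_B a b z" "z i \<noteq> 0" "z j \<noteq> 0" "i \<noteq> j"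
  shows "z j ^ 3 = - (z i ^ 3)" "k \<noteq> i \<Longrightarrow> k \<noteq> j \<Longrightarrow> z k = 0"
proof -
  have "i = a \<and> j = b \<or> i = b \<and> j = a"
    using assms unfolding node_B_def by metis
  then show "z j ^ 3 = - (z i ^ 3)" "k \<noteq> i \<Longrightarrow> k \<noteq> j \<Longrightarrow> z k = 0"
    using assms(1) by (auto simp: node_B_def)
qed

text \<open>\<open>Var 0\<close> vanishes at all nodes of the second kind, and
  \<open>Var i ^ 3 + Var 0 ^ 3\<close> at all of the first.\<close>

lemma node_chart_A:
  fixes x :: "5 \<Rightarrow> 'k::{field, finite} alg_closure"
  assumes "\<not> 3 dvd CARD('k)" "node_A x"
  shows "node_chart x 0 (Var 0)"
proof
  have x0: "x 0 \<noteq> 0" using assms(2) by (simp add: node_A_def)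
  show "x \<in> singular_cone (burkhardt :: (5, 'k) mpoly)"
    using singular_cone_iff[OF three_neq_0(1)[OF assms(1)]] assms(2) by blast
  from x0 show "x 0 \<noteq> 0" "eval_ac x (Var 0) \<noteq> 0"
    by (simp_all add: eval_ac_eq_mp_eval)
  show "\<And>i. x i \<noteq> 0 \<Longrightarrow> i \<noteq> 0 \<Longrightarrow> x i ^ 3 = - (x 0 ^ 3)"
    using node_A_cube[OF assms(2)] .
  fix i :: 5 assume "i \<noteq> 0"
  then have "x i \<noteq> 0"
    using node_A_cube[OF assms(2), of i] x0 by auto
  then show "Var 0 * local_param x 0 i \<in> sing_ideal"
    using \<open>i \<noteq> 0\<close> by (auto simp: sing_ideal_iff[OF assms(1)] local_param_def eval_ac_eq_mp_eval node_A_cube node_B_0)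
qed fact

text \<open>The last factor vanishes at the nodes of the first kind, for \<open>i\<close> nonzero,
  and the first two at the nodes of the second kind that are not supported on \<open>i\<close> and
  \<open>j\<close>. At those supported on \<open>i\<close> and \<open>j\<close> the product is
  nonzero.\<close>

abbreviation mult_B :: "5 \<Rightarrow> 5 \<Rightarrow> (5, 'k::field) mpoly" where
  "mult_B i j \<equiv> Var i * Var j * (Var i ^ 3 + Var 0 ^ 3)"

lemma eval_mult_B_node_A: "node_A z \<Longrightarrow> i \<noteq> 0 \<Longrightarrow> eval_ac z (mult_B i j) = 0"
  by (simp add: eval_ac_eq_mp_eval node_A_cube)

lemma mult_B_sing_ideal:
  fixes g :: "(5, 'k::{field, finite}) mpoly"
  assumes "\<not> 3 dvd CARD('k)" "i \<noteq> 0"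
    and "\<And>a b z. node_B a b z \<Longrightarrow> z i \<noteq> 0 \<Longrightarrow> z j \<noteq> 0 \<Longrightarrow> eval_ac z g = 0"
  shows "mult_B i j * g \<in> sing_ideal"
proof -
  have "eval_ac z (mult_B i j * g) = eval_ac z (mult_B i j) * eval_ac z g" for z
    by (simp only: eval_ac_eq_mp_eval ac.mp_eval_mult)
  moreover have "eval_ac z (mult_B i j) * eval_ac z g = 0" if "node_B a b z" for a b z
    using assms(3)[OF that] by (auto simp: eval_ac_eq_mp_eval)
  ultimately show ?thesis
    using eval_mult_B_node_A[of _ i j] assms(2) by (auto simp: sing_ideal_iff[OF assms(1)])
qed

lemma node_chart_B:
  fixes x :: "5 \<Rightarrow> 'k::{field, finite} alg_closure"
  assumes "\<not> 3 dvd CARD('k)" "node_B i j x"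
  shows "node_chart x i (mult_B i j)"
proof
  have B: "i \<noteq> 0" "j \<noteq> 0" "i \<noteq> j" "x i \<noteq> 0" "x j ^ 3 = - (x i ^ 3)" "\<And>k. k \<noteq> i \<Longrightarrow> k \<noteq> j \<Longrightarrow> x k = 0"
    using assms(2) by (auto simp: node_B_def)
  then have "x j \<noteq> 0" by auto
  show "x \<in> singular_cone (burkhardt :: (5, 'k) mpoly)"
    using singular_cone_iff[OF three_neq_0(1)[OF assms(1)]] assms(2) by blast
  from \<open>x j \<noteq> 0\<close> show "x i \<noteq> 0" "eval_ac x (mult_B i j) \<noteq> 0"
    using B by (simp_all add: eval_ac_eq_mp_eval node_B_0[OF assms(2)])
  show "x k ^ 3 = - (x i ^ 3)" if "x k \<noteq> 0" "k \<noteq> i" for k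
    using B that by metis
  fix k :: 5 assume "k \<noteq> i"
  show "mult_B i j * local_param x i k \<in> sing_ideal"
  proof (rule mult_B_sing_ideal[OF assms(1) B(1)])
    fix a b and z :: "5 \<Rightarrow> 'k alg_closure"
    assume z: "node_B a b z" "z i \<noteq> 0" "z j \<noteq> 0"
    show "eval_ac z (local_param x i k) = 0"
    proof (cases "k = j")
      case True
      then show ?thesis
        using \<open>x j \<noteq> 0\<close> node_B_support(1)[OF z B(3)] by (simp add: local_param_def eval_ac_eq_mp_eval)
    next
      case False
      then show ?thesis
        using B(6)[of k] \<open>k \<noteq> i\<close> node_B_support(2)[OF z B(3), of k] by (simp add: local_param_def eval_ac_eq_mp_eval)
    qed
  qed
qed fact

text \<open>The square of the ideal of the nodes contains a multiple of \<open>burkhardt\<close> by a form that does not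
  vanish at a given node. At a node of the first kind this rests on
  \<open>(p + t^4)^3 = \<Prod>i. (a i - t^3)\<close> for \<open>t = y\<^sub>0\<close>, \<open>a i = y\<^sub>i\<^sup>3 + t^3\<close>,
  \<open>p = y\<^sub>1 y\<^sub>2 y\<^sub>3 y\<^sub>4 - t^4\<close>.\<close>

lemma node_A_square_identity:
  fixes t p a b c d :: "'r::comm_ring_1"
  assumes "(p + t ^ 4) ^ 3 = (a - t ^ 3) * (b - t ^ 3) * (c - t ^ 3) * (d - t ^ 3)"
  shows "t ^ 10 * (t * (a + b + c + d) + 3 * p) =
    ((t * a) * (t * b)) * (c * d) - ((t * a) * (t * b)) * (t ^ 3 * c) - ((t * a) * (t * b)) * (t ^ 3 * d)
    - ((t * a) * (t * c)) * (t ^ 3 * d) - ((t * b) * (t * c)) * (t ^ 3 * d)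
    + ((t * a) * (t * b)) * t ^ 6 + ((t * a) * (t * c)) * t ^ 6 + ((t * a) * (t * d)) * t ^ 6
    + ((t * b) * (t * c)) * t ^ 6 + ((t * b) * (t * d)) * t ^ 6 + ((t * c) * (t * d)) * t ^ 6
    - ((t * p) * (t * p)) * p - ((t * p) * (t * p)) * (3 * t ^ 4)"
proof -
  \<comment> \<open>In the expansion the terms linear in \<open>a, b, c, d, p\<close> make up
    \<open>t ^ 8\<close> times the quartic, and every other surviving term has two such factors. The
    extra \<open>t ^ 2\<close> turns these two into elements \<open>t * a\<close> or
    \<open>t * p\<close> of the ideal.\<close>
  have "t ^ 2 * (p + t ^ 4) ^ 3 = t ^ 2 * ((a - t ^ 3) * (b - t ^ 3) * (c - t ^ 3) * (d - t ^ 3))"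
    using assms by simp
  then show ?thesis
    by (simp add: algebra_simps power_numeral_reduce)
qed

lemma burkhardt_square_A:
  fixes x :: "5 \<Rightarrow> 'k::{field, finite} alg_closure"
  assumes "\<not> 3 dvd CARD('k)" "node_A x"
  shows "Var 0 ^ 10 * burkhardt \<in> ideal_power (sing_ideal :: (5, 'k) mpoly set) 2"
proof -
  define t where "t = (Var 0 :: (5, 'k) mpoly)"
  define a where "a i = (Var i ^ 3 + t ^ 3 :: (5, 'k) mpoly)" for i
  define p where "p = (Var 1 * Var 2 * Var 3 * Var 4 - t ^ 4 :: (5, 'k) mpoly)"
  have "(p + t ^ 4) ^ 3 = (a 1 - t ^ 3) * (a 2 - t ^ 3) * (a 3 - t ^ 3) * (a 4 - t ^ 3)"
    by (simp add: p_def a_def power_mult_distrib)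
  note id = node_A_square_identity[OF this]
  have F: "burkhardt = t * (a 1 + a 2 + a 3 + a 4) + 3 * p"
    by (simp add: burkhardt_def a_def p_def t_def algebra_simps power_numeral_reduce)
  have ta: "t * a i \<in> sing_ideal" if "i \<noteq> 0" for i
    using that by (auto simp: sing_ideal_iff[OF assms(1)] t_def a_def eval_ac_eq_mp_eval node_A_cube node_B_0)
  have tp: "t * p \<in> sing_ideal"
    by (auto simp: sing_ideal_iff[OF assms(1)] t_def p_def eval_ac_eq_mp_eval node_A_def node_B_0)
  have sq: "(f * g) * u \<in> ideal_power sing_ideal 2" if "f \<in> sing_ideal" "g \<in> sing_ideal" for f g u :: "(5, 'k) mpoly"
    by (rule is_ideal_mult_right[OF is_ideal_power mult_mem_ideal_power_2[OF that]])
  have "t ^ 10 * (t * (a 1 + a 2 + a 3 + a 4) + 3 * p) \<in> ideal_power sing_ideal 2"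
    unfolding id
    by (intro is_ideal_add[OF is_ideal_power] is_ideal_diff[OF is_ideal_power] sq ta tp) simp_all
  then show ?thesis
    unfolding F[symmetric] by (simp only: t_def)
qed

text \<open>\<open>Var 0\<close>, the sum of cubes \<open>s\<close>, \<open>Var k\<close> and
  \<open>Var l\<close> all vanish at the nodes supported on \<open>i\<close> and \<open>j\<close>.
  So both terms of the quartic contain two elements of the local ideal, and each of the two takes
  one factor \<open>mult_B i j\<close>.\<close>

lemma burkhardt_square_B:
  assumes "\<not> 3 dvd CARD('k::{field, finite})" "distinct [0, i, j, k, l]"
  shows "(mult_B i j * mult_B i j) * burkhardt \<in> ideal_power (sing_ideal :: (5, 'k) mpoly set) 2"
proof -
  define h where "h = (mult_B i j :: (5, 'k) mpoly)"
  define s where "s = (Var 0 ^ 3 + Var i ^ 3 + Var j ^ 3 + Var k ^ 3 + Var l ^ 3 :: (5, 'k) mpoly)"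
  have "i \<noteq> 0" "i \<noteq> j" using assms(2) by auto
  note in_ideal = mult_B_sing_ideal[OF assms(1) \<open>i \<noteq> 0\<close>, of j, folded h_def]
  have z: "h * Var m \<in> sing_ideal" if "m \<noteq> i" "m \<noteq> j" for m
  proof (rule in_ideal)
    show "eval_ac z (Var m) = 0" if z: "node_B a b z" "z i \<noteq> 0" "z j \<noteq> 0" for a b and z :: "5 \<Rightarrow> 'k alg_closure"
      using node_B_support(2)[OF z \<open>i \<noteq> j\<close> \<open>m \<noteq> i\<close> \<open>m \<noteq> j\<close>] by (simp add: eval_ac_eq_mp_eval)
  qed
  have s: "h * s \<in> sing_ideal"
  proof (rule in_ideal)
    fix a b and z :: "5 \<Rightarrow> 'k alg_closure"
    assume zB: "node_B a b z" "z i \<noteq> 0" "z j \<noteq> 0"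
    have "z 0 = 0" "z k = 0" "z l = 0"
      using node_B_support(2)[OF zB \<open>i \<noteq> j\<close>] assms(2) by auto
    then show "eval_ac z s = 0"
      using node_B_support(1)[OF zB \<open>i \<noteq> j\<close>] by (simp add: s_def eval_ac_eq_mp_eval)
  qed
  have F: "burkhardt = Var 0 * s + 3 * Var i * Var j * Var k * Var l"
    unfolding s_def by (rule burkhardt_perm[OF assms(2)])
  have "(h * h) * burkhardt = (h * Var 0) * (h * s) + ((h * Var k) * (h * Var l)) * (3 * Var i * Var j)"
    by (subst F) (simp add: algebra_simps)
  also have "\<dots> \<in> ideal_power sing_ideal 2"
    by (intro is_ideal_add[OF is_ideal_power] is_ideal_mult_right[OF is_ideal_power] mult_mem_ideal_power_2 z s)
      (use assms(2) in auto)
  finally show ?thesis unfolding h_def .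
qed

section \<open>Expansion along lines and planes through a point\<close>

definition line_eval :: "('v \<Rightarrow> 'k alg_closure) \<Rightarrow> ('v \<Rightarrow> 'k alg_closure)
    \<Rightarrow> ('v::finite, 'k::field) mpoly \<Rightarrow> 'k alg_closure poly" where
  "line_eval x v = mp_eval (\<lambda>c. [:to_ac c:]) (\<lambda>i. [:x i, v i:])"

text \<open>Evaluation at \<open>x + t (v + s w)\<close>, as a polynomial in \<open>t\<close> over the polynomials in \<open>s\<close>.\<close>

definition plane_eval :: "('v \<Rightarrow> 'k alg_closure) \<Rightarrow> ('v \<Rightarrow> 'k alg_closure) \<Rightarrow> ('v \<Rightarrow> 'k alg_closure)
    \<Rightarrow> ('v::finite, 'k::field) mpoly \<Rightarrow> 'k alg_closure poly poly" where
  "plane_eval x v w = mp_eval (\<lambda>c. [:[:to_ac c:]:]) (\<lambda>i. [:[:x i:], [:v i, w i:]:])"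

interpretation line: coeff_hom "\<lambda>c. [:to_ac c:]"
  by unfold_locales (simp_all add: one_pCons)

interpretation plane: coeff_hom "\<lambda>c. [:[:to_ac c:]:]"
  by unfold_locales (simp_all add: one_pCons)

lemma coeff_line_eval_0 [simp]: "coeff (line_eval x v f) 0 = eval_ac x f"
proof -
  have "coeff (line_eval x v f) 0 = mp_eval to_ac (\<lambda>i. coeff (line_eval x v (Var i)) 0) f"
    by (rule mp_eval_unique) (simp_all add: line_eval_def coeff_mult)
  then show ?thesis
    by (simp add: line_eval_def eval_ac_eq_mp_eval)
qed

lemma poly_coeff_plane_eval:
  "poly (coeff (plane_eval x v w f) n) s = coeff (line_eval x (\<lambda>i. v i + s * w i) f) n"
proof -
  define \<phi> where "\<phi> p = map_poly (\<lambda>c. poly c s) p" for p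
  have coeff: "coeff (\<phi> p) n = poly (coeff p n) s" for p n
    by (simp add: \<phi>_def coeff_map_poly)
  have "\<phi> (plane_eval x v w f) = mp_eval (\<lambda>c. [:to_ac c:]) (\<lambda>i. \<phi> (plane_eval x v w (Var i))) f"
  proof (rule mp_eval_unique)
    show "\<phi> (plane_eval x v w (p + q)) = \<phi> (plane_eval x v w p) + \<phi> (plane_eval x v w q)" for p q
      by (simp add: plane_eval_def poly_eq_iff coeff)
    show "\<phi> (plane_eval x v w (p * q)) = \<phi> (plane_eval x v w p) * \<phi> (plane_eval x v w q)" for p q
      by (simp add: plane_eval_def poly_eq_iff coeff coeff_mult poly_sum)
    show "\<phi> (plane_eval x v w (Const c)) = [:to_ac c:]" for c
      by (simp add: plane_eval_def poly_eq_iff coeff coeff_pCons split: nat.splits)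
  qed (simp_all add: one_pCons)
  moreover have "\<phi> (plane_eval x v w (Var i)) = [:x i, v i + s * w i:]" for i
    by (simp add: plane_eval_def poly_eq_iff coeff coeff_pCons split: nat.splits)
  ultimately have "\<phi> (plane_eval x v w f) = line_eval x (\<lambda>i. v i + s * w i) f"
    by (simp add: line_eval_def)
  then show ?thesis
    by (metis coeff)
qed

lemma coeff_plane_eval_0: "coeff (plane_eval x v w f) 0 = [:eval_ac x f:]"
proof -
  have "coeff (plane_eval x v w f) 0 = mp_eval (\<lambda>c. [:to_ac c:]) (\<lambda>i. coeff (plane_eval x v w (Var i)) 0) f"
    by (rule mp_eval_unique) (simp_all add: plane_eval_def coeff_mult)
  also have "\<dots> = mp_eval (\<lambda>c. [:to_ac c:]) (\<lambda>i. [:x i:]) f"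
    by (simp add: plane_eval_def)
  also have "\<dots> = [:mp_eval to_ac x f:]"
    by (rule mp_eval_unique[symmetric, of "\<lambda>f. [:mp_eval to_ac x f:]" "\<lambda>c. [:to_ac c:]" f, simplified])
  finally show ?thesis by (simp add: eval_ac_eq_mp_eval)
qed

text \<open>A factor with nonzero constant term does not change the order of vanishing: the low
  coefficients of \<open>q\<close> are forced to zero one after another.\<close>

lemma monom_dvd_mult_cancel:
  fixes p q :: "'r::idom poly"
  assumes "monom 1 n dvd p * q" "coeff p 0 \<noteq> 0"
  shows "monom 1 n dvd q"
  unfolding monom_1_dvd_iff'
proof safe
  fix k assume "k < n"
  then show "coeff q k = 0"
  proof (induction k rule: less_induct)
    case (less k)
    have "0 = coeff (p * q) k"
      using assms(1) less.prems by (simp add: monom_1_dvd_iff')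
    also have "\<dots> = (\<Sum>i\<in>{0}. coeff p i * coeff q (k - i))"
      unfolding coeff_mult by (rule sum.mono_neutral_right) (use less in auto)
    finally show ?case using assms(2) by simp
  qed
qed

lemma monom_1_power: "monom 1 1 ^ n = monom (1 :: 'r::comm_ring_1) n"
  by (simp add: monom_power)

lemma ideal_power_line_eval:
  assumes "x \<in> Z" "f \<in> ideal_power (vanishing_ideal Z) n"
  shows "monom 1 n dvd line_eval x v f"
proof -
  have "monom 1 1 ^ n dvd line_eval x v f"
  proof (rule ideal_power_dvd[OF is_ideal_vanishing assms(2)])
    fix p assume "p \<in> vanishing_ideal Z"
    then have "coeff (line_eval x v p) 0 = 0"
      using assms(1) by (simp add: vanishing_ideal_def)
    then show "monom 1 1 dvd line_eval x v p"
      by (simp add: monom_1_dvd_iff')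
  qed (simp_all add: line_eval_def)
  then show ?thesis by (simp only: monom_1_power)
qed

lemma ideal_power_plane_eval:
  assumes "x \<in> Z" "f \<in> ideal_power (vanishing_ideal Z) n"
  shows "monom 1 n dvd plane_eval x v w f"
proof -
  have "monom 1 1 ^ n dvd plane_eval x v w f"
  proof (rule ideal_power_dvd[OF is_ideal_vanishing assms(2)])
    fix p assume "p \<in> vanishing_ideal Z"
    then have "coeff (plane_eval x v w p) 0 = 0"
      using assms(1) by (simp add: vanishing_ideal_def coeff_plane_eval_0)
    then show "monom 1 1 dvd plane_eval x v w p"
      by (simp add: monom_1_dvd_iff')
  qed (simp_all add: plane_eval_def)
  then show ?thesis by (simp only: monom_1_power)
qed

text \<open>The quadratic form comes from the expansion and not from second derivatives, so it
  remains correct in characteristic 2.\<close>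

lemma coeff_line_eval_burkhardt:
  fixes x v :: "5 \<Rightarrow> 'k::field alg_closure"
  assumes "distinct [0 :: 5, i, j, k, l]"
  shows "coeff (line_eval x v burkhardt) 2 = 6 * x 0 ^ 2 * v 0 ^ 2
     + 3 * v 0 * (x i ^ 2 * v i + x j ^ 2 * v j + x k ^ 2 * v k + x l ^ 2 * v l)
     + 3 * x 0 * (x i * v i ^ 2 + x j * v j ^ 2 + x k * v k ^ 2 + x l * v l ^ 2)
     + 3 * (v i * v j * x k * x l + v i * v k * x j * x l + v i * v l * x j * x k
          + v j * v k * x i * x l + v j * v l * x i * x k + v k * v l * x i * x j)"
proof -
  have cube: "[:a, b:] ^ 3 = [:a ^ 3, 3 * a ^ 2 * b, 3 * a * b ^ 2, b ^ 3:]" for a b :: "'k alg_closure"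
    by (simp add: power3_eq_cube power2_eq_square algebra_simps)
  show ?thesis
    by (simp add: line_eval_def burkhardt_perm[OF assms] cube numeral_2_eq_2 coeff_pCons numeral_poly
      algebra_simps power_numeral_reduce)
qed

text \<open>\<open>g\<close> shows that the quartic vanishes to order at least 2 at
  \<open>x\<close>, and \<open>u\<close> is a direction in which the order is exactly 2. Homogeneity
  of \<open>h\<close> makes the multiplied parameters homogeneous.\<close>

locale node = node_chart x j h for x :: "5 \<Rightarrow> 'k::{field, finite} alg_closure" and j h +
  fixes d :: nat and g u
  assumes homogeneous_h: "homogeneous d h"
    and square: "g * burkhardt \<in> ideal_power (sing_ideal :: (5, 'k) mpoly set) 2"
    and g_nz: "eval_ac x g \<noteq> 0"
    and u_nz: "coeff (line_eval x u (burkhardt :: (5, 'k) mpoly)) 2 \<noteq> 0"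

lemma ex_node_A:
  fixes x :: "5 \<Rightarrow> 'k::{field, finite} alg_closure"
  assumes "\<not> 3 dvd CARD('k)" "node_A x"
  shows "\<exists>h d g u. node x 0 h d g u"
proof -
  note three = three_neq_0[OF assms(1)]
  have x: "x 0 \<noteq> 0" "x 1 \<noteq> 0"
    using node_A_cube[OF assms(2), of 1] assms(2) by (auto simp: node_A_def)
  interpret node_chart x 0 "Var 0" by (rule node_chart_A[OF assms(1) assms(2)])
  \<comment> \<open>In this direction the quadratic term is \<open>3 * x 0 * x 1\<close>.\<close>
  have "node x 0 (Var 0) 1 (Var 0 ^ 10) (\<lambda>i. if i = 1 then 1 else 0)"
  proof
    show "homogeneous 1 (Var (0::5) :: (5, 'k) mpoly)" by (rule homogeneous_Var)
    show "Var 0 ^ 10 * burkhardt \<in> ideal_power (sing_ideal :: (5, 'k) mpoly set) 2"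
      by (rule burkhardt_square_A[OF assms(1) assms(2)])
    show "eval_ac x (Var 0 ^ 10) \<noteq> 0"
      using x by (simp add: eval_ac_eq_mp_eval)
    show "coeff (line_eval x (\<lambda>i. if i = 1 then 1 else 0) (burkhardt :: (5, 'k) mpoly)) 2 \<noteq> 0"
      using x three by (simp add: coeff_line_eval_burkhardt[OF distinct_1234])
  qed
  then show ?thesis by blast
qed

lemma ex_node_B:
  fixes x :: "5 \<Rightarrow> 'k::{field, finite} alg_closure"
  assumes "\<not> 3 dvd CARD('k)" "node_B i j x"
  shows "\<exists>h d g u. node x i h d g u"
proof -
  note three = three_neq_0[OF assms(1)]
  have B: "i \<noteq> 0" "j \<noteq> 0" "i \<noteq> j" "x i \<noteq> 0" "x j ^ 3 = - (x i ^ 3)"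
    using assms(2) by (auto simp: node_B_def)
  then have "x j \<noteq> 0" by auto
  obtain k l where d: "distinct [0 :: 5, i, j, k, l]"
    using ex_perm[OF B(1-3)] by blast
  have z: "x 0 = 0" "x k = 0" "x l = 0"
    using d assms(2) by (auto simp: node_B_def)
  interpret node_chart x i "mult_B i j" by (rule node_chart_B[OF assms(1) assms(2)])
  \<comment> \<open>In this direction only \<open>3 * x j ^ 2\<close> is left of the quadratic
    term.\<close>
  have "node x i (mult_B i j) (1 + 1 + 3) (mult_B i j * mult_B i j) (\<lambda>m. if m = 0 \<or> m = j then 1 else 0)"
  proof
    have c: "homogeneous 3 (Var i ^ 3 :: (5, 'k) mpoly)" for i
      using homogeneous_power[OF homogeneous_Var[of i], of 3] by simp
    show "homogeneous (1 + 1 + 3) (mult_B i j :: (5, 'k) mpoly)"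
      by (intro homogeneous_mult homogeneous_add homogeneous_Var c)
    show "(mult_B i j * mult_B i j) * burkhardt \<in> ideal_power (sing_ideal :: (5, 'k) mpoly set) 2"
      by (rule burkhardt_square_B[OF assms(1) d])
    show "eval_ac x (mult_B i j * mult_B i j) \<noteq> 0"
      using h_nz by (simp add: eval_ac_eq_mp_eval)
    show "coeff (line_eval x (\<lambda>m. if m = 0 \<or> m = j then 1 else 0) (burkhardt :: (5, 'k) mpoly)) 2 \<noteq> 0"
      using d z three B(4) \<open>x j \<noteq> 0\<close> by (auto simp: coeff_line_eval_burkhardt[OF d])
  qed
  then show ?thesis by blast
qed

lemma ex_node:
  fixes x :: "5 \<Rightarrow> 'k::{field, finite} alg_closure"
  assumes "\<not> 3 dvd CARD('k)" "x \<in> singular_cone (burkhardt :: (5, 'k) mpoly)"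
  shows "\<exists>j h d g u. node x j h d g u"
  using assms(2) singular_cone_iff[OF three_neq_0(1)[OF assms(1)]] ex_node_A[OF assms(1)] ex_node_B[OF assms(1)]
  by metis

context node
begin

lemma burkhardt_plane_eval: "monom 1 2 dvd plane_eval x v w (burkhardt :: (5, 'k) mpoly)"
proof (rule monom_dvd_mult_cancel)
  show "monom 1 2 dvd plane_eval x v w g * plane_eval x v w (burkhardt :: (5, 'k) mpoly)"
    using ideal_power_plane_eval[OF node square] by (simp add: plane_eval_def)
  show "coeff (plane_eval x v w g) 0 \<noteq> 0"
    using g_nz by (simp add: coeff_plane_eval_0)
qed

lemma burkhardt_line_eval: "monom 1 2 dvd line_eval x v (burkhardt :: (5, 'k) mpoly)"
proof (rule monom_dvd_mult_cancel)
  show "monom 1 2 dvd line_eval x v g * line_eval x v (burkhardt :: (5, 'k) mpoly)"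
    using ideal_power_line_eval[OF node square] by (simp add: line_eval_def)
  show "coeff (line_eval x v g) 0 \<noteq> 0"
    using g_nz by simp
qed

text \<open>The initial form of \<open>burkhardt\<close> at the node is a quadric, and the associated graded ring of
  the node is a domain. So if \<open>p * burkhardt\<close> vanishes to order \<open>n\<close> at the node, then \<open>p\<close> vanishes
  to order \<open>n - 2\<close>.\<close>

lemma coeff_line_eval_multiple:
  assumes f: "p * burkhardt \<in> ideal_power (sing_ideal :: (5, 'k) mpoly set) n"
    and v: "coeff (line_eval x v (burkhardt :: (5, 'k) mpoly)) 2 = 0"
  shows "coeff (line_eval x v (p * burkhardt)) n = 0"
proof -
  \<comment> \<open>The directions \<open>v + s * w\<close> join \<open>v\<close> (at
    \<open>s = 0\<close>) to \<open>u\<close> (at \<open>s = 1\<close>). Over the polynomials in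
    \<open>s\<close> the quartic has order exactly 2, because it does at \<open>s = 1\<close>; this
    gives \<open>p\<close> order at least \<open>n - 2\<close>. The bound specialises to
    \<open>s = 0\<close>, where the quartic itself has order 3.\<close>
  define w where "w i = u i - v i" for i
  obtain U where U: "plane_eval x v w (burkhardt :: (5, 'k) mpoly) = monom 1 2 * U"
    using burkhardt_plane_eval[of v w] unfolding dvd_def by blast
  have "coeff U 0 \<noteq> 0"
  proof
    assume "coeff U 0 = 0"
    then have "coeff (plane_eval x v w (burkhardt :: (5, 'k) mpoly)) 2 = 0"
      by (simp add: U coeff_monom_mult)
    then have "coeff (line_eval x (\<lambda>i. v i + 1 * w i) (burkhardt :: (5, 'k) mpoly)) 2 = 0"
      by (metis poly_coeff_plane_eval poly_0)
    then show False using u_nz by (simp add: w_def)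
  qed
  have "monom 1 (n - 2) dvd plane_eval x v w p"
  proof (rule monom_dvd_mult_cancel)
    show "monom 1 (n - 2) dvd U * plane_eval x v w p"
    proof -
      have "plane_eval x v w (p * burkhardt) = monom 1 2 * (U * plane_eval x v w p)"
        using U by (simp add: plane_eval_def mult_ac)
      then have dvd: "monom 1 n dvd monom 1 2 * (U * plane_eval x v w p)"
        using ideal_power_plane_eval[OF node f] by metis
      show ?thesis
        unfolding monom_1_dvd_iff'
      proof safe
        fix k assume "k < n - 2"
        then have "coeff (monom 1 2 * (U * plane_eval x v w p)) (k + 2) = 0"
          using dvd by (simp add: monom_1_dvd_iff')
        then show "coeff (U * plane_eval x v w p) k = 0"
          by (simp add: coeff_monom_mult)
      qed
    qed
  qed fact
  moreover have "coeff (line_eval x v p) k = poly (coeff (plane_eval x v w p) k) 0" for k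
    by (simp add: poly_coeff_plane_eval)
  ultimately have "monom 1 (n - 2) dvd line_eval x v p"
    by (simp add: monom_1_dvd_iff')
  moreover have "monom 1 3 dvd line_eval x v (burkhardt :: (5, 'k) mpoly)"
    unfolding monom_1_dvd_iff'
  proof safe
    fix k :: nat assume "k < 3"
    then consider "k < 2" | "k = 2" by linarith
    then show "coeff (line_eval x v (burkhardt :: (5, 'k) mpoly)) k = 0"
      using burkhardt_line_eval v by cases (auto simp: monom_1_dvd_iff')
  qed
  ultimately have "monom 1 (n - 2) * monom 1 3 dvd line_eval x v p * line_eval x v (burkhardt :: (5, 'k) mpoly)"
    by (rule mult_dvd_mono)
  \<comment> \<open>The subtraction \<open>n - 2\<close> may truncate, but
    \<open>n - 2 + 3 > n\<close> holds for every \<open>n\<close>, and this kills the coefficient at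
    \<open>n\<close>.\<close>
  moreover have "monom 1 (n - 2) * monom 1 3 = monom (1 :: 'k alg_closure) (n - 2 + 3)"
    by (simp add: mult_monom)
  ultimately show ?thesis
    by (simp add: monom_1_dvd_iff' line_eval_def)
qed

text \<open>The quartic has no terms of order below 2 along the line, so the coefficient for
  \<open>g * burkhardt\<close> is the value of \<open>g\<close> at \<open>x\<close> times that for
  the quartic. As \<open>g * burkhardt\<close> lies in the square of the ideal, a homomorphism must
  kill it, and its tangent vector lies on the quadric.\<close>

lemma quadric_of_hom:
  assumes "coeff (line_eval x v (g * burkhardt)) 2 = 0"
  shows "coeff (line_eval x v (burkhardt :: (5, 'k) mpoly)) 2 = 0"
proof -
  have "coeff (line_eval x v (g * burkhardt)) 2 =
     (\<Sum>i\<le>2. coeff (line_eval x v g) i * coeff (line_eval x v burkhardt) (2 - i))"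
    by (simp add: line_eval_def coeff_mult)
  also have "\<dots> = (\<Sum>i\<in>{0}. coeff (line_eval x v g) i * coeff (line_eval x v burkhardt) (2 - i))"
    by (rule sum.mono_neutral_right) (use burkhardt_line_eval[of v] in \<open>auto simp: monom_1_dvd_iff'\<close>)
  finally show ?thesis
    using assms g_nz by simp
qed

end

section \<open>Homomorphisms of the Rees algebra\<close>

lemma ideal_power_Suc_0: "is_ideal I \<Longrightarrow> ideal_power I (Suc 0) = I"
  using ideal_power_1[of I] by simp

lemma rees_homs_add:
  "\<psi> \<in> rees_homs J I L \<Longrightarrow> f \<in> ideal_power I n \<Longrightarrow> g \<in> ideal_power I n \<Longrightarrow> \<psi> n (f + g) = \<psi> n f + \<psi> n g"
  unfolding rees_homs_def by blast

lemma rees_homs_mult: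
  "\<psi> \<in> rees_homs J I L \<Longrightarrow> f \<in> ideal_power I m \<Longrightarrow> g \<in> ideal_power I n \<Longrightarrow> \<psi> (m + n) (f * g) = \<psi> m f * \<psi> n g"
  unfolding rees_homs_def by blast

lemma rees_homs_Const: "\<psi> \<in> rees_homs J I L \<Longrightarrow> \<psi> 0 (Const c) = to_ac c"
  unfolding rees_homs_def by blast

lemma rees_homs_outside: "\<psi> \<in> rees_homs J I L \<Longrightarrow> f \<notin> ideal_power I n \<Longrightarrow> \<psi> n f = 0"
  unfolding rees_homs_def by blast

lemma rees_homs_in_L: "\<psi> \<in> rees_homs J I L \<Longrightarrow> f \<in> ideal_power I n \<Longrightarrow> \<psi> n f \<in> L"
  unfolding rees_homs_def by blast

lemma rees_homs_vanish: "\<psi> \<in> rees_homs J I L \<Longrightarrow> f \<in> ideal_power I n \<Longrightarrow> f \<in> J \<Longrightarrow> \<psi> n f = 0"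
  unfolding rees_homs_def by blast

lemma rees_homs_eval:
  assumes "\<psi> \<in> rees_homs J I L"
  shows "\<psi> 0 f = eval_ac (\<lambda>i. \<psi> 0 (Var i)) f"
  unfolding eval_ac_eq_mp_eval
  by (rule mp_eval_unique)
    (use rees_homs_add[OF assms, of _ 0] rees_homs_mult[OF assms, of _ 0 _ 0] rees_homs_Const[OF assms] in simp_all)

lemma rees_homs_module:
  assumes "\<psi> \<in> rees_homs J I L" "f \<in> ideal_power I n"
  shows "\<psi> n (g * f) = eval_ac (\<lambda>i. \<psi> 0 (Var i)) g * \<psi> n f"
  using rees_homs_mult[OF assms(1) _ assms(2), of g 0] rees_homs_eval[OF assms(1), of g] by simp

lemma rees_homs_zero:
  assumes "\<psi> \<in> rees_homs J I L"
  shows "\<psi> n 0 = 0"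
  using rees_homs_module[OF assms is_ideal_zero[OF is_ideal_power[of I n]], of 0]
  by (simp add: eval_ac_eq_mp_eval)

text \<open>The Rees algebra is generated in degrees 0 and 1, and its degree 0 part by the
  variables. \<open>J\<close> and \<open>J'\<close> may differ, so a homomorphism can be compared
  with a map not yet known to vanish on \<open>J\<close>.\<close>

lemma rees_homs_eqI:
  assumes I: "is_ideal I" and \<phi>: "\<phi> \<in> rees_homs J I L" and \<psi>: "\<psi> \<in> rees_homs J' I L'"
    and Var: "\<And>i. \<phi> 0 (Var i) = \<psi> 0 (Var i)" and 1: "\<And>f. f \<in> I \<Longrightarrow> \<phi> 1 f = \<psi> 1 f"
  shows "\<phi> = \<psi>"
proof -
  have "\<phi> n f = \<psi> n f" if "f \<in> ideal_power I n" for n f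
    using that
  proof (induction n arbitrary: f)
    case 0
    show ?case using rees_homs_eval[OF \<phi>, of f] rees_homs_eval[OF \<psi>, of f] Var by simp
  next
    case (Suc n)
    from Suc.prems I show ?case
    proof (induction rule: ideal_power_Suc_induct)
      case zero
      show ?case by (simp add: rees_homs_zero[OF \<phi>] rees_homs_zero[OF \<psi>])
    next
      case (mult a b)
      have "a \<in> ideal_power I 1" using mult(1) ideal_power_1[OF I] by simp
      then show ?case
        using rees_homs_mult[OF \<phi>, of a 1 b n] rees_homs_mult[OF \<psi>, of a 1 b n] mult(2) 1[OF mult(1)] Suc.IH[OF mult(2)]
        by simp
    next
      case (add a b)
      then show ?case using rees_homs_add[OF \<phi>] rees_homs_add[OF \<psi>] by simp
    qed
  qed
  moreover have "\<phi> n f = \<psi> n f" if "f \<notin> ideal_power I n" for n f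
    using that rees_homs_outside[OF \<phi>] rees_homs_outside[OF \<psi>] by simp
  ultimately show ?thesis by blast
qed

section \<open>Homomorphisms from points and tangent vectors, and the torus action\<close>

definition smooth_hom :: "('v::finite, 'k::field) mpoly set \<Rightarrow> ('v \<Rightarrow> 'k alg_closure) \<Rightarrow> 'k alg_closure
    \<Rightarrow> nat \<Rightarrow> ('v, 'k) mpoly \<Rightarrow> 'k alg_closure" where
  "smooth_hom I x t n f = (if f \<in> ideal_power I n then t ^ n * eval_ac x f else 0)"

definition node_hom :: "('v::finite, 'k::field) mpoly set \<Rightarrow> ('v \<Rightarrow> 'k alg_closure) \<Rightarrow> ('v \<Rightarrow> 'k alg_closure)
    \<Rightarrow> nat \<Rightarrow> ('v, 'k) mpoly \<Rightarrow> 'k alg_closure" where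
  "node_hom I x v n f = (if f \<in> ideal_power I n then coeff (line_eval x v f) n else 0)"

text \<open>Coefficients of lowest order multiply. This is what makes \<open>node_hom\<close>
  multiplicative.\<close>

lemma coeff_mult_monom_dvd:
  fixes p q :: "'r::comm_ring_1 poly"
  assumes "monom 1 m dvd p" "monom 1 n dvd q"
  shows "coeff (p * q) (m + n) = coeff p m * coeff q n"
proof -
  from assms obtain a b where "p = monom 1 m * a" "q = monom 1 n * b"
    by (auto elim!: dvdE)
  moreover have "monom 1 m * a * (monom 1 n * b) = monom 1 (m + n) * (a * b)"
  proof -
    have "monom 1 m * a * (monom 1 n * b) = (monom 1 m * monom 1 n) * (a * b)"
      by (simp only: mult_ac)
    then show ?thesis by (simp add: mult_monom)
  qed
  ultimately show ?thesis
    by (simp add: coeff_monom_mult coeff_mult_0)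
qed

lemma smooth_hom_in_rees_homs:
  assumes L: "finite_subfield L" "range to_ac \<subseteq> L"
    and I: "is_ideal I" and x: "\<And>i. x i \<in> L" "x i \<noteq> 0" "\<And>f. f \<in> J \<Longrightarrow> eval_ac x f = 0"
    and t: "t \<in> L" "t \<noteq> 0" and f: "f \<in> I" "eval_ac x f \<noteq> 0"
  shows "smooth_hom I x t \<in> rees_homs J I L"
proof -
  interpret finite_subfield L by fact
  have L_eval: "eval_ac x f \<in> L" for f
    unfolding eval_ac_def using L(2) x by (intro sum_L mult_L prod_L power_L) auto
  have "\<exists>f\<in>ideal_power I (Suc 0). smooth_hom I x t (Suc 0) f \<noteq> 0"
    using f t by (intro bexI[of _ f]) (simp_all add: smooth_hom_def ideal_power_Suc_0[OF I])
  then show ?thesis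
    unfolding rees_homs_def
    using x t L_eval is_ideal_add[OF is_ideal_power[of I]] ideal_power_mult[OF I]
    by (auto simp: smooth_hom_def eval_ac_eq_mp_eval algebra_simps power_add)
qed

lemma node_hom_in_rees_homs:
  fixes x :: "'v::finite \<Rightarrow> 'k::field alg_closure"
  assumes L: "finite_subfield L" "range to_ac \<subseteq> L"
    and x: "\<And>i. x i \<in> L" "x i \<noteq> 0" "x \<in> Z" and v: "\<And>i. v i \<in> L"
    and J: "\<And>n f. f \<in> ideal_power (vanishing_ideal Z) n \<Longrightarrow> f \<in> J \<Longrightarrow> coeff (line_eval x v f) n = 0"
    and f: "f \<in> vanishing_ideal Z" "coeff (line_eval x v f) 1 \<noteq> 0"
  shows "node_hom (vanishing_ideal Z) x v \<in> rees_homs J (vanishing_ideal Z) L"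
proof -
  interpret finite_subfield L by fact
  define I where "I = vanishing_ideal Z"
  have I: "is_ideal I" unfolding I_def by (rule is_ideal_vanishing)
  have L_coeff: "\<forall>n. coeff (line_eval x v f) n \<in> L" for f
  proof -
    have mult: "\<forall>n. coeff (p * q) n \<in> L" if "\<forall>n. coeff p n \<in> L" "\<forall>n. coeff q n \<in> L" for p q
      unfolding coeff_mult using that by (auto intro!: sum_L)
    have pow: "\<forall>n. coeff (p ^ k) n \<in> L" if "\<forall>n. coeff p n \<in> L" for p k
      by (induction k) (use that mult in \<open>auto simp: coeff_1 \<close>)
    have prd: "\<forall>n. coeff (prod p S) n \<in> L" if "\<And>i. \<forall>n. coeff (p i) n \<in> L" for p and S :: "'v set"
      by (induction S rule: infinite_finite_induct) (use that mult in \<open>auto simp: coeff_1\<close>)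
    have lin: "\<forall>n. coeff [:a, b:] n \<in> L" if "a \<in> L" "b \<in> L" for a b
      using that by (auto simp: coeff_pCons split: nat.splits)
    have "\<forall>n. coeff ([:to_ac c:] * (\<Prod>i\<in>UNIV. [:x i, v i:] ^ e i)) n \<in> L" for c e
      by (rule mult[OF _ prd[OF pow[OF lin[OF x(1) v]]]]) (use lin[of "to_ac c" 0] L(2) in auto)
    then show ?thesis
      unfolding line_eval_def mp_eval_def coeff_sum by (auto intro!: sum_L)
  qed
  have mult: "node_hom I x v (m + n) (f * g) = node_hom I x v m f * node_hom I x v n g"
    if "f \<in> ideal_power I m" "g \<in> ideal_power I n" for m n f g
  proof -
    have "line_eval x v (f * g) = line_eval x v f * line_eval x v g"
      by (simp add: line_eval_def)
    then show ?thesis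
      using that ideal_power_mult[OF I that] coeff_mult_monom_dvd[of m "line_eval x v f" n "line_eval x v g"]
        ideal_power_line_eval[OF x(3)] by (simp add: node_hom_def I_def)
  qed
  have "\<exists>f\<in>ideal_power I (Suc 0). node_hom I x v (Suc 0) f \<noteq> 0"
    using f by (intro bexI[of _ f]) (simp_all add: node_hom_def ideal_power_Suc_0[OF is_ideal_vanishing] I_def)
  moreover have "line_eval x v (f + g) = line_eval x v f + line_eval x v g" for f g
    by (simp add: line_eval_def)
  ultimately show ?thesis
    unfolding rees_homs_def I_def[symmetric]
    using x J L_coeff is_ideal_add[OF is_ideal_power[of I]] mult
    by (auto simp: node_hom_def eval_ac_eq_mp_eval I_def[symmetric])
qed

text \<open>By homogeneity \<open>s\<close> comes out of the whole argument, and \<open>t\<close>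
  only rescales the variable of the expansion. So the torus element \<open>(s, t)\<close> moves the
  pair \<open>(x, v)\<close> to \<open>(s x, s t v)\<close>.\<close>

lemma line_eval_scale:
  assumes "homogeneous d f"
  shows "coeff (line_eval (\<lambda>i. s * x i) (\<lambda>i. s * t * v i) f) n = s ^ d * t ^ n * coeff (line_eval x v f) n"
proof -
  have "line_eval (\<lambda>i. s * x i) (\<lambda>i. s * t * v i) f = mp_eval (\<lambda>c. [:to_ac c:]) (\<lambda>i. [:s:] * [:x i, t * v i:]) f"
    by (simp add: line_eval_def mult_ac)
  also have "\<dots> = [:s:] ^ d * line_eval x (\<lambda>i. t * v i) f"
    unfolding line_eval_def by (rule line.mp_eval_homogeneous_scale[OF assms])
  also have "line_eval x (\<lambda>i. t * v i) f = pcompose (line_eval x v f) [:0, t:]"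
  proof -
    have "pcompose (line_eval x v f) [:0, t:] =
      mp_eval (\<lambda>c. [:to_ac c:]) (\<lambda>i. pcompose (line_eval x v (Var i)) [:0, t:]) f"
      by (rule mp_eval_unique) (simp_all add: line_eval_def pcompose_add pcompose_mult one_pCons)
    then show ?thesis
      by (simp add: line_eval_def pcompose_pCons mult.commute)
  qed
  also have "[:s:] ^ d = [:s ^ d:]"
    by (induction d) (simp_all add: one_pCons)
  finally show ?thesis
    by (simp add: coeff_pcompose_linear)
qed

text \<open>\<open>torus_rel\<close> compares homomorphisms on homogeneous elements only. These
  determine a homomorphism because \<open>I\<close> contains the homogeneous components of its
  elements.\<close>

locale torus =
  fixes J I :: "('v::finite, 'k::field) mpoly set" and L :: "'k alg_closure set"
  assumes subfield: "finite_subfield L"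
    and ideal_I: "is_ideal I"
    and hcomp_I: "f \<in> I \<Longrightarrow> hcomp d f \<in> I"
begin

sublocale finite_subfield L by (rule subfield)

definition related :: "'k alg_closure \<Rightarrow> 'k alg_closure \<Rightarrow> (nat \<Rightarrow> ('v, 'k) mpoly \<Rightarrow> 'k alg_closure)
    \<Rightarrow> (nat \<Rightarrow> ('v, 'k) mpoly \<Rightarrow> 'k alg_closure) \<Rightarrow> bool" where
  "related s t \<psi> \<phi> \<longleftrightarrow> (\<forall>n d. \<forall>f \<in> ideal_power I n. homogeneous d f \<longrightarrow> \<phi> n f = s ^ d * t ^ n * \<psi> n f)"

lemma relatedD: "related s t \<psi> \<phi> \<Longrightarrow> f \<in> ideal_power I n \<Longrightarrow> homogeneous d f \<Longrightarrow> \<phi> n f = s ^ d * t ^ n * \<psi> n f"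
  by (simp add: related_def)

lemma related_Var: "related s t \<psi> \<phi> \<Longrightarrow> \<phi> 0 (Var i) = s * \<psi> 0 (Var i)"
  using relatedD[OF _ _ homogeneous_Var, of s t \<psi> \<phi> i 0] by simp

lemma torus_rel_iff:
  "(\<psi>, \<phi>) \<in> torus_rel J I L \<longleftrightarrow> \<psi> \<in> rees_homs J I L \<and> \<phi> \<in> rees_homs J I L \<and>
    (\<exists>s\<in>L - {0}. \<exists>t\<in>L - {0}. related s t \<psi> \<phi>)"
  by (simp add: torus_rel_def related_def)

lemma equiv_torus_rel: "equiv (rees_homs J I L) (torus_rel J I L)"
proof (rule equivI)
  show "torus_rel J I L \<subseteq> rees_homs J I L \<times> rees_homs J I L"
    by (auto simp: torus_rel_iff)
  show "refl_on (rees_homs J I L) (torus_rel J I L)"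
  proof (rule refl_onI)
    fix \<psi> assume "\<psi> \<in> rees_homs J I L"
    moreover have "related 1 1 \<psi> \<psi>" by (simp add: related_def)
    ultimately show "(\<psi>, \<psi>) \<in> torus_rel J I L"
      unfolding torus_rel_iff by (metis DiffI one_L one_neq_zero singletonD)
  qed
  show "sym (torus_rel J I L)"
  proof (rule symI)
    fix \<psi> \<phi> assume "(\<psi>, \<phi>) \<in> torus_rel J I L"
    then obtain s t where st: "s \<in> L - {0}" "t \<in> L - {0}" "related s t \<psi> \<phi>"
      and "\<psi> \<in> rees_homs J I L" "\<phi> \<in> rees_homs J I L"
      unfolding torus_rel_iff by blast
    moreover have "related (inverse s) (inverse t) \<phi> \<psi>"
      using st by (auto simp: related_def field_simps)
    moreover have "inverse s \<in> L - {0}" "inverse t \<in> L - {0}" using st by auto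
    ultimately show "(\<phi>, \<psi>) \<in> torus_rel J I L"
      unfolding torus_rel_iff by blast
  qed
  show "trans (torus_rel J I L)"
  proof (rule transI)
    fix \<psi> \<phi> \<chi> assume "(\<psi>, \<phi>) \<in> torus_rel J I L" "(\<phi>, \<chi>) \<in> torus_rel J I L"
    then obtain s t s' t' where st: "s \<in> L - {0}" "t \<in> L - {0}" "related s t \<psi> \<phi>"
      "s' \<in> L - {0}" "t' \<in> L - {0}" "related s' t' \<phi> \<chi>"
      and "\<psi> \<in> rees_homs J I L" "\<chi> \<in> rees_homs J I L"
      unfolding torus_rel_iff by blast
    moreover have "related (s * s') (t * t') \<psi> \<chi>"
      using st by (auto simp: related_def power_mult_distrib mult_ac)
    moreover have "s * s' \<in> L - {0}" "t * t' \<in> L - {0}" using st by auto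
    ultimately show "(\<psi>, \<chi>) \<in> torus_rel J I L"
      unfolding torus_rel_iff by blast
  qed
qed

lemma rees_homs_1_sum_hcomp:
  assumes "\<psi> \<in> rees_homs J I L" "f \<in> I" "f = (\<Sum>d\<le>N. hcomp d f)"
  shows "\<psi> 1 f = (\<Sum>d\<le>N. \<psi> 1 (hcomp d f))"
proof -
  have I1: "ideal_power I 1 = I" by (rule ideal_power_1[OF ideal_I])
  have "\<psi> 1 (\<Sum>d\<le>M. hcomp d f) = (\<Sum>d\<le>M. \<psi> 1 (hcomp d f))" for M
  proof (induction M)
    case (Suc M)
    have "(\<Sum>d\<le>M. hcomp d f) \<in> ideal_power I 1" "hcomp (Suc M) f \<in> ideal_power I 1"
      unfolding I1 using hcomp_I[OF assms(2)] by (auto intro!: is_ideal_sum[OF ideal_I])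
    from rees_homs_add[OF assms(1) this] Suc show ?case by simp
  qed simp
  from this[of N] assms(3) show ?thesis by simp
qed

lemma related_unique:
  assumes "\<psi> \<in> rees_homs J I L" "\<phi> \<in> rees_homs J I L" "\<chi> \<in> rees_homs J I L"
    and "related s t \<psi> \<phi>" "related s t \<psi> \<chi>"
  shows "\<phi> = \<chi>"
proof (rule rees_homs_eqI[OF ideal_I assms(2,3)])
  show "\<phi> 0 (Var i) = \<chi> 0 (Var i)" for i
    using related_Var assms(4,5) by metis
  fix f assume f: "f \<in> I"
  obtain N where N: "f = (\<Sum>d\<le>N. hcomp d f)" using sum_hcomp by blast
  have "\<phi> 1 (hcomp d f) = \<chi> 1 (hcomp d f)" for d
    using relatedD[OF assms(4), of "hcomp d f" 1 d] relatedD[OF assms(5), of "hcomp d f" 1 d]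
      hcomp_I[OF f, of d] homogeneous_hcomp[of d f] ideal_power_1[OF ideal_I] by simp
  then show "\<phi> 1 f = \<chi> 1 f"
    using rees_homs_1_sum_hcomp[OF assms(2) f N] rees_homs_1_sum_hcomp[OF assms(3) f N] by simp
qed

text \<open>Freeness of the torus action: a nonzero coordinate determines \<open>s\<close>, and then
  a homogeneous element of \<open>I\<close> with nonzero image determines \<open>t\<close>.\<close>

lemma related_inj:
  assumes \<psi>: "\<psi> \<in> rees_homs J I L" and "related s t \<psi> \<phi>" "related s' t' \<psi> \<phi>" and "s \<noteq> 0"
  shows "s = s' \<and> t = t'"
proof -
  obtain i where "\<psi> 0 (Var i) \<noteq> 0" using \<psi> by (auto simp: rees_homs_def)
  then have s: "s = s'"
    using related_Var[OF assms(2), of i] related_Var[OF assms(3), of i] by simp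
  have I1: "ideal_power I 1 = I" by (rule ideal_power_1[OF ideal_I])
  obtain f where f: "f \<in> I" "\<psi> 1 f \<noteq> 0" using \<psi> unfolding rees_homs_def mem_Collect_eq I1 by blast
  obtain N where N: "f = (\<Sum>d\<le>N. hcomp d f)" using sum_hcomp by blast
  obtain d where d: "\<psi> 1 (hcomp d f) \<noteq> 0"
    using f(2) unfolding rees_homs_1_sum_hcomp[OF \<psi> f(1) N] by (meson sum.neutral)
  have "hcomp d f \<in> ideal_power I 1" using hcomp_I[OF f(1)] I1 by simp
  from relatedD[OF assms(2) this homogeneous_hcomp] relatedD[OF assms(3) this homogeneous_hcomp] d s assms(4)
  show ?thesis by simp
qed

text \<open>Every class is an orbit of the full torus and has \<open>(card L - 1) ^ 2\<close>
  elements. That all translates exist is a hypothesis here; it is later read off from the explicit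
  form of the homomorphisms.\<close>

lemma finite_card_rees_homs:
  assumes fin: "finite (rees_homs J I L)"
    and ex: "\<And>\<psi> s t. \<psi> \<in> rees_homs J I L \<Longrightarrow> s \<in> L - {0} \<Longrightarrow> t \<in> L - {0} \<Longrightarrow> \<exists>\<phi>\<in>rees_homs J I L. related s t \<psi> \<phi>"
  shows "card (rees_homs J I L) = (card L - 1) ^ 2 * card (blowup_points J I L)"
proof -
  let ?R = "rees_homs J I L" and ?T = "torus_rel J I L"
  have "(card L - 1) ^ 2 * card (?R // ?T) = card (\<Union> (?R // ?T))"
  proof (rule card_partition)
    show "finite (?R // ?T)" using fin by (rule finite_quotient) (auto simp: torus_rel_iff)
    show "finite (\<Union> (?R // ?T))" using fin equiv_torus_rel by (simp add: Union_quotient)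
    show "A \<inter> B = {}" if "A \<in> ?R // ?T" "B \<in> ?R // ?T" "A \<noteq> B" for A B
      using quotient_disj[OF equiv_torus_rel that(1,2)] that(3) by blast
    fix A assume "A \<in> ?R // ?T"
    then obtain \<psi> where \<psi>: "\<psi> \<in> ?R" and A: "A = ?T `` {\<psi>}" by (auto elim: quotientE)
    define act where "act = (\<lambda>(s, t). SOME \<phi>. \<phi> \<in> ?R \<and> related s t \<psi> \<phi>)"
    have act: "act (s, t) \<in> ?R" "related s t \<psi> (act (s, t))" if "s \<in> L - {0}" "t \<in> L - {0}" for s t
      using someI_ex[of "\<lambda>\<phi>. \<phi> \<in> ?R \<and> related s t \<psi> \<phi>"] ex[OF \<psi> that] by (auto simp: act_def)
    have "bij_betw act ((L - {0}) \<times> (L - {0})) A"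
    proof (rule bij_betw_imageI)
      show "inj_on act ((L - {0}) \<times> (L - {0}))"
      proof (rule inj_onI)
        fix a b assume ab: "a \<in> (L - {0}) \<times> (L - {0})" "b \<in> (L - {0}) \<times> (L - {0})" "act a = act b"
        obtain s t s' t' where st: "a = (s, t)" "b = (s', t')"
          by (cases a, cases b) blast
        have "related s t \<psi> (act a)" "related s' t' \<psi> (act a)" "s \<noteq> 0"
          using act(2)[of s t] act(2)[of s' t'] ab by (auto simp: st)
        from related_inj[OF \<psi> this] show "a = b" by (simp add: st)
      qed
      show "act ` ((L - {0}) \<times> (L - {0})) = A"
      proof (intro equalityI subsetI)
        fix \<phi> assume "\<phi> \<in> act ` ((L - {0}) \<times> (L - {0}))"
        then obtain s t where "s \<in> L - {0}" "t \<in> L - {0}" "\<phi> = act (s, t)" by auto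
        then show "\<phi> \<in> A"
          using act[of s t] \<psi> unfolding A by (auto simp: torus_rel_iff)
      next
        fix \<phi> assume "\<phi> \<in> A"
        then obtain s t where st: "s \<in> L - {0}" "t \<in> L - {0}" "related s t \<psi> \<phi>" "\<phi> \<in> ?R"
          unfolding A by (auto simp: torus_rel_iff)
        then have "\<phi> = act (s, t)"
          using related_unique[OF \<psi> st(4) act(1) st(3) act(2)] by blast
        then show "\<phi> \<in> act ` ((L - {0}) \<times> (L - {0}))" using st by blast
      qed
    qed
    then have "card A = card ((L - {0}) \<times> (L - {0}))"
      by (simp add: bij_betw_same_card)
    then show "card A = (card L - 1) ^ 2"
      using finite_L by (simp add: card_cartesian_product power2_eq_square)
  qed
  then show ?thesis
    using equiv_torus_rel by (simp add: blowup_points_def Union_quotient)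
qed

end

section \<open>The points of the blow-up\<close>

context node
begin

lemma node_second: "x k \<noteq> 0 \<Longrightarrow> (if x k = 0 then 1 else 3 * x k ^ 2) \<noteq> 0"
  using three_neq_0[OF card_not_3] by simp

lemma eval_local_param: "i \<noteq> j \<Longrightarrow> eval_ac x (local_param x j i) = 0"
  using cubes[of i] by (simp add: local_param_def eval_ac_eq_mp_eval)

text \<open>The differential of a multiplied parameter is a nonzero multiple of the
  \<open>i\<close>-th coordinate, since 3 is invertible. So a vector with \<open>v j = 0\<close> is
  recovered from its values on the parameters.\<close>

lemma coeff_line_eval_param:
  assumes "v j = 0" "i \<noteq> j"
  shows "coeff (line_eval x v (h * local_param x j i)) 1 =
    eval_ac x h * (if x i = 0 then 1 else 3 * x i ^ 2) * v i"
proof -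
  have "coeff (line_eval x v (local_param x j i)) 1 = (if x i = 0 then 1 else 3 * x i ^ 2) * v i"
    using assms(1) by (simp add: local_param_def line_eval_def power3_eq_cube power2_eq_square algebra_simps)
  moreover have "coeff (line_eval x v (local_param x j i)) 0 = 0"
    using eval_local_param[OF assms(2)] by simp
  moreover have "line_eval x v (h * local_param x j i) = line_eval x v h * line_eval x v (local_param x j i)"
    by (simp add: line_eval_def)
  ultimately show ?thesis
    by (simp add: coeff_mult del: coeff_line_eval_0) (simp add: mult.assoc)
qed

lemma coeff_line_eval_mult_1:
  assumes "eval_ac x p = 0"
  shows "coeff (line_eval x v (q * p)) 1 = eval_ac x q * coeff (line_eval x v p) 1"
proof -
  have "line_eval x v (q * p) = line_eval x v q * line_eval x v p"
    by (simp add: line_eval_def)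
  then show ?thesis using assms by (simp add: coeff_mult)
qed

lemma sing_ideal_eval: "f \<in> sing_ideal \<Longrightarrow> eval_ac x f = 0"
  using node by (simp add: vanishing_ideal_def)

text \<open>On the ideal both sides are additive, and multiplication by a polynomial acts through
  its value at \<open>x\<close>. So agreement on the generators extends to
  \<open>param_ideal\<close>. For general \<open>f\<close> some \<open>q\<close>, nonzero at
  \<open>x\<close>, moves \<open>q * f\<close> into \<open>param_ideal\<close>, and its value
  cancels.\<close>

lemma hom_eq_derivative:
  assumes \<psi>: "\<psi> \<in> rees_homs J sing_ideal L" and pt: "\<And>i. \<psi> 0 (Var i) = x i"
    and param: "\<And>i. i \<noteq> j \<Longrightarrow> \<psi> 1 (h * local_param x j i) = coeff (line_eval x v (h * local_param x j i)) 1"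
    and f: "f \<in> sing_ideal"
  shows "\<psi> 1 f = coeff (line_eval x v f) 1"
proof -
  have I1: "ideal_power sing_ideal 1 = (sing_ideal :: (5, 'k) mpoly set)"
    by (rule ideal_power_1[OF is_ideal_vanishing])
  have mod: "\<psi> 1 (q * p) = eval_ac x q * \<psi> 1 p" if "p \<in> sing_ideal" for p q
    using rees_homs_module[OF \<psi>, of p 1 q] that I1 pt by simp
  have "f \<in> germ_ideal" by (rule sing_ideal_germ[OF f])
  then obtain q where q: "eval_ac x q \<noteq> 0" "q * f \<in> param_ideal"
    by (auto simp: germ_ideal_def)
  have "p \<in> sing_ideal \<and> \<psi> 1 p = coeff (line_eval x v p) 1" if "p \<in> param_ideal" for p
    using that unfolding param_ideal_def
  proof (induction rule: ring_mod.span_induct_alt)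
    case base
    show ?case
      by (simp add: rees_homs_zero[OF \<psi>] line_eval_def is_ideal_zero[OF is_ideal_vanishing])
  next
    case (step c b y)
    then obtain i where i: "b = h * local_param x j i" "i \<noteq> j" by blast
    then have b: "b \<in> sing_ideal" using h_param by simp
    have y: "y \<in> sing_ideal" and IH: "\<psi> 1 y = coeff (line_eval x v y) 1" using step(2) by simp_all
    have "\<psi> 1 (c * b + y) = \<psi> 1 (c * b) + \<psi> 1 y"
      using rees_homs_add[OF \<psi>, of "c * b" 1 y] is_ideal_mult_left[OF is_ideal_vanishing b, of c] y I1 by simp
    also have "\<dots> = coeff (line_eval x v (c * b)) 1 + coeff (line_eval x v y) 1"
      using mod[OF b] coeff_line_eval_mult_1[OF sing_ideal_eval[OF b]] param[OF i(2)] IH i(1) by simp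
    also have "\<dots> = coeff (line_eval x v (c * b + y)) 1"
      by (simp add: line_eval_def)
    finally have "\<psi> 1 (c * b + y) = coeff (line_eval x v (c * b + y)) 1" .
    moreover have "c * b + y \<in> sing_ideal"
      by (intro is_ideal_add[OF is_ideal_vanishing] is_ideal_mult_left[OF is_ideal_vanishing] b y)
    ultimately show ?case by simp
  qed
  from this[OF q(2)] have "eval_ac x q * \<psi> 1 f = eval_ac x q * coeff (line_eval x v f) 1"
    using mod[OF f] coeff_line_eval_mult_1[OF sing_ideal_eval[OF f]] by simp
  then show ?thesis using q(1) by simp
qed

end

lemma line_eval_zero: "line_eval x (\<lambda>_. 0) f = [:eval_ac x f:]"
proof -
  have "[:mp_eval to_ac x f:] = mp_eval (\<lambda>c. [:to_ac c:]) (\<lambda>i. [:mp_eval to_ac x (Var i):]) f"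
    by (rule mp_eval_unique) (simp_all add: one_pCons)
  then show ?thesis
    by (simp add: line_eval_def eval_ac_eq_mp_eval)
qed

section \<open>Classification of the homomorphisms over smooth points and over nodes\<close>

locale burkhardt_field =
  fixes L :: "'k::{field, finite} alg_closure set"
  assumes subfield_L: "finite_subfield L"
    and to_ac_L: "range to_ac \<subseteq> L"
    and card_not_3': "\<not> 3 dvd CARD('k)"
begin

abbreviation F :: "(5, 'k) mpoly" where "F \<equiv> burkhardt"
abbreviation nodes :: "(5 \<Rightarrow> 'k alg_closure) set" where "nodes \<equiv> singular_cone F"
abbreviation homs :: "(nat \<Rightarrow> (5, 'k) mpoly \<Rightarrow> 'k alg_closure) set" where
  "homs \<equiv> rees_homs (ideal_hull {F}) sing_ideal L"
abbreviation pt :: "(nat \<Rightarrow> (5, 'k) mpoly \<Rightarrow> 'k alg_closure) \<Rightarrow> 5 \<Rightarrow> 'k alg_closure" where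
  "pt \<psi> \<equiv> \<lambda>i. \<psi> 0 (Var i)"

sublocale torus "ideal_hull {F}" sing_ideal L
  by (intro torus.intro subfield_L is_ideal_vanishing hcomp_sing_ideal)

definition smooth_cone :: "(5 \<Rightarrow> 'k alg_closure) set" where
  "smooth_cone = {x. (\<forall>i. x i \<in> L) \<and> (\<exists>i. x i \<noteq> 0) \<and> eval_ac x F = 0 \<and> x \<notin> nodes}"

definition node_cone :: "(5 \<Rightarrow> 'k alg_closure) set" where
  "node_cone = {x. (\<forall>i. x i \<in> L) \<and> x \<in> nodes}"

text \<open>The condition \<open>v j = 0\<close> picks a representative of \<open>v\<close> modulo \<open>x\<close>.\<close>

definition tangents :: "5 \<Rightarrow> (5 \<Rightarrow> 'k alg_closure) \<Rightarrow> (5 \<Rightarrow> 'k alg_closure) set" where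
  "tangents j x = {v. (\<forall>i. v i \<in> L) \<and> v j = 0 \<and> v \<noteq> (\<lambda>_. 0) \<and> coeff (line_eval x v F) 2 = 0}"

lemma F_in_J: "F \<in> ideal_hull {F}"
  by (rule ring_mod.span_base) simp

lemma J_eval: "f \<in> ideal_hull {F} \<Longrightarrow> eval_ac x F = 0 \<Longrightarrow> eval_ac x f = 0"
  by (auto simp: ideal_hull_singleton eval_ac_eq_mp_eval)

lemma pt_in_L: "\<psi> \<in> homs \<Longrightarrow> pt \<psi> i \<in> L"
  by (rule rees_homs_in_L[of \<psi>]) simp_all

lemma pt_nonzero: "\<psi> \<in> homs \<Longrightarrow> \<exists>i. pt \<psi> i \<noteq> 0"
  by (auto simp: rees_homs_def)

lemma pt_on_F: "\<psi> \<in> homs \<Longrightarrow> eval_ac (pt \<psi>) F = 0"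
  using rees_homs_vanish[of \<psi> _ _ _ F 0] F_in_J rees_homs_eval[of \<psi> _ _ _ F] by simp

lemma I1: "ideal_power sing_ideal 1 = (sing_ideal :: (5, 'k) mpoly set)"
  by (rule ideal_power_1[OF is_ideal_vanishing])

lemma partial_sing_ideal: "partial_deriv i F \<in> sing_ideal"
  by (simp add: vanishing_ideal_def singular_cone_def)

lemma smooth_partial:
  assumes "x \<in> smooth_cone"
  obtains i where "eval_ac x (partial_deriv i F) \<noteq> 0"
  using assms by (auto simp: smooth_cone_def singular_cone_def)

lemma smooth_hom_homs:
  assumes "x \<in> smooth_cone" "t \<in> L" "t \<noteq> 0"
  shows "smooth_hom sing_ideal x t \<in> homs"
proof -
  obtain i where i: "eval_ac x (partial_deriv i F) \<noteq> 0" using smooth_partial[OF assms(1)] .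
  obtain k where k: "x k \<noteq> 0" using assms(1) by (auto simp: smooth_cone_def)
  show ?thesis
    by (rule smooth_hom_in_rees_homs[OF subfield_L to_ac_L is_ideal_vanishing _ k _ assms(2,3) partial_sing_ideal i])
      (use assms(1) J_eval in \<open>auto simp: smooth_cone_def\<close>)
qed

lemma pt_smooth_hom: "pt (smooth_hom sing_ideal x t) = x"
  by (rule ext) (simp add: smooth_hom_def eval_ac_eq_mp_eval)

lemma pt_node_hom: "pt (node_hom sing_ideal x v) = x"
  by (rule ext) (simp add: node_hom_def eval_ac_eq_mp_eval)

text \<open>Away from the nodes some partial derivative \<open>p\<close>, which belongs to the
  ideal, is nonzero at \<open>x\<close>. Computing \<open>\<psi> 1 (p * f)\<close> in two ways shows
  that \<open>\<psi> 1\<close> is evaluation at \<open>x\<close> times a constant.\<close>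

lemma smooth_hom_cases:
  assumes \<psi>: "\<psi> \<in> homs" and "pt \<psi> \<notin> nodes"
  obtains t where "t \<in> L" "t \<noteq> 0" "pt \<psi> \<in> smooth_cone" "\<psi> = smooth_hom sing_ideal (pt \<psi>) t"
proof -
  define x where "x = pt \<psi>"
  have x: "x \<in> smooth_cone"
    using pt_in_L[OF \<psi>] pt_nonzero[OF \<psi>] pt_on_F[OF \<psi>] assms(2) by (simp add: smooth_cone_def x_def)
  obtain i where i: "eval_ac x (partial_deriv i F) \<noteq> 0" using smooth_partial[OF x] .
  define p where "p = partial_deriv i F"
  have p: "p \<in> sing_ideal" "eval_ac x p \<noteq> 0"
    using i partial_sing_ideal by (simp_all add: p_def)
  define t where "t = \<psi> 1 p / eval_ac x p"
  have 1: "\<psi> 1 f = t * eval_ac x f" if "f \<in> sing_ideal" for f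
  proof -
    have "eval_ac x p * \<psi> 1 f = eval_ac x f * \<psi> 1 p"
      using rees_homs_module[OF \<psi>, of f 1 p] rees_homs_module[OF \<psi>, of p 1 f] that p I1
      by (simp add: x_def mult.commute)
    then show ?thesis using p by (simp add: t_def field_simps)
  qed
  have "eval_ac x p \<in> L"
    using rees_homs_in_L[OF \<psi>, of p 0] rees_homs_eval[OF \<psi>, of p] by (simp add: x_def)
  moreover have "\<psi> 1 p \<in> L"
    using rees_homs_in_L[OF \<psi>, of p 1] p I1 by simp
  ultimately have "t \<in> L" by (simp add: t_def)
  have "\<exists>f\<in>ideal_power sing_ideal 1. \<psi> 1 f \<noteq> 0"
    using \<psi> unfolding rees_homs_def by blast
  then have "t \<noteq> 0" using 1 unfolding I1 by force
  have "\<psi> = smooth_hom sing_ideal x t"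
  proof (rule rees_homs_eqI[OF is_ideal_vanishing \<psi> smooth_hom_homs[OF x \<open>t \<in> L\<close> \<open>t \<noteq> 0\<close>]])
    show "\<psi> 0 (Var i) = smooth_hom sing_ideal x t 0 (Var i)" for i
      using fun_cong[OF pt_smooth_hom[of x t], of i] by (simp add: x_def)
    show "\<psi> 1 f = smooth_hom sing_ideal x t 1 f" if "f \<in> sing_ideal" for f
      using 1[OF that] that I1 by (simp add: smooth_hom_def)
  qed
  from that[of t, folded x_def, OF \<open>t \<in> L\<close> \<open>t \<noteq> 0\<close> x this] show ?thesis .
qed

lemma smooth_hom_inj:
  assumes "x \<in> smooth_cone" "smooth_hom sing_ideal x t = smooth_hom sing_ideal x t'"
  shows "t = t'"
proof -
  obtain i where i: "eval_ac x (partial_deriv i F) \<noteq> 0" using smooth_partial[OF assms(1)] .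
  have "smooth_hom sing_ideal x s 1 (partial_deriv i F) = s * eval_ac x (partial_deriv i F)" for s
    using partial_sing_ideal I1 by (simp add: smooth_hom_def)
  with assms(2) i show ?thesis by (metis mult_right_cancel)
qed

lemma card_smooth_homs:
  "card {\<psi> \<in> homs. pt \<psi> \<notin> nodes} = (card L - 1) * card smooth_cone"
  "finite {\<psi> \<in> homs. pt \<psi> \<notin> nodes}" if fin: "finite smooth_cone"
proof -
  have "bij_betw (\<lambda>(x, t). smooth_hom sing_ideal x t) (smooth_cone \<times> (L - {0})) {\<psi> \<in> homs. pt \<psi> \<notin> nodes}"
  proof (rule bij_betw_imageI)
    show "inj_on (\<lambda>(x, t). smooth_hom sing_ideal x t) (smooth_cone \<times> (L - {0}))"
    proof (rule inj_onI)
      fix a b assume ab: "a \<in> smooth_cone \<times> (L - {0})" "b \<in> smooth_cone \<times> (L - {0})"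
        "(\<lambda>(x, t). smooth_hom sing_ideal x t) a = (\<lambda>(x, t). smooth_hom sing_ideal x t) b"
      obtain x t y s where xt: "a = (x, t)" "b = (y, s)"
        by (cases a, cases b) blast
      have "x = y" using ab(3) pt_smooth_hom[of x t] pt_smooth_hom[of y s] by (simp add: xt)
      then show "a = b" using ab smooth_hom_inj[of x t s] by (auto simp: xt)
    qed
    show "(\<lambda>(x, t). smooth_hom sing_ideal x t) ` (smooth_cone \<times> (L - {0})) = {\<psi> \<in> homs. pt \<psi> \<notin> nodes}"
    proof (intro equalityI subsetI)
      fix \<psi> assume "\<psi> \<in> (\<lambda>(x, t). smooth_hom sing_ideal x t) ` (smooth_cone \<times> (L - {0}))"
      then obtain x t where xt: "x \<in> smooth_cone" "t \<in> L" "t \<noteq> 0" "\<psi> = smooth_hom sing_ideal x t" by auto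
      then show "\<psi> \<in> {\<psi> \<in> homs. pt \<psi> \<notin> nodes}"
        using smooth_hom_homs[OF xt(1-3)] pt_smooth_hom[of x t] by (auto simp: smooth_cone_def)
    next
      fix \<psi> assume "\<psi> \<in> {\<psi> \<in> homs. pt \<psi> \<notin> nodes}"
      then have \<psi>: "\<psi> \<in> homs" "pt \<psi> \<notin> nodes" by auto
      obtain t where "t \<in> L" "t \<noteq> 0" "pt \<psi> \<in> smooth_cone" "\<psi> = smooth_hom sing_ideal (pt \<psi>) t"
        using smooth_hom_cases[OF \<psi>] .
      then show "\<psi> \<in> (\<lambda>(x, t). smooth_hom sing_ideal x t) ` (smooth_cone \<times> (L - {0}))"
        by (intro image_eqI[of _ _ "(pt \<psi>, t)"]) auto
    qed
  qed
  from bij_betw_same_card[OF this] bij_betw_finite[OF this] that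
  show "card {\<psi> \<in> homs. pt \<psi> \<notin> nodes} = (card L - 1) * card smooth_cone" "finite {\<psi> \<in> homs. pt \<psi> \<notin> nodes}"
    using finite_L by (simp_all add: card_cartesian_product mult.commute)
qed

lemma node_hom_homs:
  assumes x: "x \<in> node_cone" and v: "\<And>i. v i \<in> L" "coeff (line_eval x v F) 2 = 0"
    and f: "f \<in> sing_ideal" "coeff (line_eval x v f) 1 \<noteq> 0"
  shows "node_hom sing_ideal x v \<in> homs"
proof -
  have xL: "x i \<in> L" for i using x by (simp add: node_cone_def)
  have xn: "x \<in> nodes" using x by (simp add: node_cone_def)
  obtain k where k: "x k \<noteq> 0" using xn by (auto simp: singular_cone_def)
  obtain j h d g u where "node x j h d g u" using ex_node[OF card_not_3' xn] by blast
  then interpret node x j h d g u .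
  show ?thesis
    by (rule node_hom_in_rees_homs[OF subfield_L to_ac_L xL k xn v(1) _ f])
      (use coeff_line_eval_multiple v(2) in \<open>auto simp: ideal_hull_singleton\<close>)
qed

text \<open>The entries of \<open>v\<close> are solved from the values of \<open>\<psi>\<close> on
  the multiplied parameters. By \<open>hom_eq_derivative\<close>, \<open>\<psi> 1\<close> is then
  differentiation along \<open>v\<close>, and the vanishing of \<open>\<psi>\<close> on
  \<open>g * F\<close> puts \<open>v\<close> on the quadric.\<close>

lemma node_hom_cases:
  assumes \<psi>: "\<psi> \<in> homs" and nd: "node (pt \<psi>) j h d g u"
  obtains v where "v \<in> tangents j (pt \<psi>)" "\<psi> = node_hom sing_ideal (pt \<psi>) v"
proof -
  define x where "x = pt \<psi>"
  interpret node x j h d g u using nd by (simp add: x_def)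
  define v where "v i = (if i = j then 0 else
    \<psi> 1 (h * local_param x j i) / (eval_ac x h * (if x i = 0 then 1 else 3 * x i ^ 2)))" for i
  have vj: "v j = 0" by (simp add: v_def)
  have "\<psi> 1 (h * local_param x j i) = coeff (line_eval x v (h * local_param x j i)) 1" if "i \<noteq> j" for i
    unfolding coeff_line_eval_param[of v i, OF vj that] using that h_nz node_second[of i] by (auto simp: v_def)
  then have 1: "\<psi> 1 f = coeff (line_eval x v f) 1" if "f \<in> sing_ideal" for f
    using hom_eq_derivative[OF \<psi> _ _ that] by (simp add: x_def)
  have xL: "x i \<in> L" for i using pt_in_L[OF \<psi>] by (simp add: x_def)
  have "eval_ac x h \<in> L"
    using rees_homs_in_L[OF \<psi>, of h 0] rees_homs_eval[OF \<psi>, of h] by (simp add: x_def)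
  then have vL: "v i \<in> L" for i
    using rees_homs_in_L[OF \<psi>, of "h * local_param x j i" 1] h_param[of i] I1 xL by (auto simp: v_def)
  have "\<exists>f\<in>ideal_power sing_ideal 1. \<psi> 1 f \<noteq> 0"
    using \<psi> unfolding rees_homs_def by blast
  then obtain f where f: "f \<in> sing_ideal" "coeff (line_eval x v f) 1 \<noteq> 0"
    using 1 unfolding I1 by auto
  \<comment> \<open>The comparison is made with \<open>J = {}\<close>, because \<open>v\<close> is
    placed on the quadric only afterwards, by means of the equality obtained here.\<close>
  have "node_hom sing_ideal x v \<in> rees_homs {} sing_ideal L"
    by (rule node_hom_in_rees_homs[OF subfield_L to_ac_L xL pivot node vL _ f]) simp
  then have eq: "\<psi> = node_hom sing_ideal x v"
  proof (rule rees_homs_eqI[OF is_ideal_vanishing \<psi>])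
    show "\<psi> 0 (Var i) = node_hom sing_ideal x v 0 (Var i)" for i
      using fun_cong[OF pt_node_hom[of x v], of i] by (simp add: x_def)
    show "\<psi> 1 f = node_hom sing_ideal x v 1 f" if "f \<in> sing_ideal" for f
      using 1[OF that] that I1 by (simp add: node_hom_def)
  qed
  have "g * F \<in> ideal_hull {F}" by (auto simp: ideal_hull_singleton)
  then have "node_hom sing_ideal x v 2 (g * F) = 0"
    using rees_homs_vanish[OF \<psi> square] eq by simp
  then have "coeff (line_eval x v F) 2 = 0"
    using quadric_of_hom[of v] square by (simp add: node_hom_def)
  moreover have "v \<noteq> (\<lambda>_. 0)"
  proof
    assume v0: "v = (\<lambda>_. 0)"
    with f(2) show False by (simp add: line_eval_zero)
  qed
  ultimately have "v \<in> tangents j x"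
    using vL vj by (simp add: tangents_def)
  from that[of v, folded x_def, OF this eq] show ?thesis .
qed

lemma card_node_homs:
  assumes x: "x \<in> node_cone" and "node x j h d g u"
  shows "card {\<psi> \<in> homs. pt \<psi> = x} = card (tangents j x)" "finite (tangents j x) \<Longrightarrow> finite {\<psi> \<in> homs. pt \<psi> = x}"
proof -
  interpret node x j h d g u by fact
  have nz: "\<exists>f\<in>sing_ideal. coeff (line_eval x v f) 1 \<noteq> coeff (line_eval x v' f) 1"
    if "v j = 0" "v' j = 0" "v \<noteq> v'" for v v'
  proof -
    from that(3) obtain i where i: "v i \<noteq> v' i" by blast
    with that have "i \<noteq> j" by auto
    then show ?thesis
      using coeff_line_eval_param[of v i, OF that(1) \<open>i \<noteq> j\<close>] coeff_line_eval_param[of v' i, OF that(2) \<open>i \<noteq> j\<close>]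
        h_nz node_second[of i] i h_param[OF \<open>i \<noteq> j\<close>]
      by (intro bexI[of _ "h * local_param x j i"]) auto
  qed
  have "bij_betw (node_hom sing_ideal x) (tangents j x) {\<psi> \<in> homs. pt \<psi> = x}"
  proof (rule bij_betw_imageI)
    show "inj_on (node_hom sing_ideal x) (tangents j x)"
    proof (rule inj_onI, rule ccontr)
      fix v v' assume v: "v \<in> tangents j x" "v' \<in> tangents j x" "node_hom sing_ideal x v = node_hom sing_ideal x v'" "v \<noteq> v'"
      then obtain f where f: "f \<in> sing_ideal" "coeff (line_eval x v f) 1 \<noteq> coeff (line_eval x v' f) 1"
        using nz[of v v'] by (auto simp: tangents_def)
      have "node_hom sing_ideal x w 1 f = coeff (line_eval x w f) 1" for w
        using f(1) I1 by (simp add: node_hom_def)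
      with f(2) v(3) show False by metis
    qed
    show "node_hom sing_ideal x ` tangents j x = {\<psi> \<in> homs. pt \<psi> = x}"
    proof (intro equalityI subsetI)
      fix \<psi> assume "\<psi> \<in> node_hom sing_ideal x ` tangents j x"
      then obtain v where v: "v \<in> tangents j x" "\<psi> = node_hom sing_ideal x v" by blast
      then obtain f where f: "f \<in> sing_ideal" "coeff (line_eval x v f) 1 \<noteq> coeff (line_eval x (\<lambda>_. 0) f) 1"
        using nz[of v "\<lambda>_. 0"] by (auto simp: tangents_def)
      then have "coeff (line_eval x v f) 1 \<noteq> 0" by (simp add: line_eval_zero)
      then have "node_hom sing_ideal x v \<in> homs"
        using v(1) by (intro node_hom_homs[OF x _ _ f(1)]) (auto simp: tangents_def)
      then show "\<psi> \<in> {\<psi> \<in> homs. pt \<psi> = x}"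
        using v(2) pt_node_hom[of x v] by simp
    next
      fix \<psi> assume "\<psi> \<in> {\<psi> \<in> homs. pt \<psi> = x}"
      then have \<psi>: "\<psi> \<in> homs" and pt: "pt \<psi> = x" by auto
      obtain v where "v \<in> tangents j (pt \<psi>)" "\<psi> = node_hom sing_ideal (pt \<psi>) v"
        using node_hom_cases[OF \<psi>, unfolded pt, OF assms(2)] unfolding pt by blast
      then show "\<psi> \<in> node_hom sing_ideal x ` tangents j x" unfolding pt by blast
    qed
  qed
  from bij_betw_same_card[OF this] bij_betw_finite[OF this]
  show "card {\<psi> \<in> homs. pt \<psi> = x} = card (tangents j x)" "finite (tangents j x) \<Longrightarrow> finite {\<psi> \<in> homs. pt \<psi> = x}"
    by simp_all
qed

end

section \<open>The number of points\<close>

definition fun5 :: "5 \<Rightarrow> 5 \<Rightarrow> 5 \<Rightarrow> 5 \<Rightarrow> 'b \<times> 'b \<times> 'b \<times> 'b \<times> 'b \<Rightarrow> 5 \<Rightarrow> 'b" where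
  "fun5 i j k l = (\<lambda>(a, b, c, d, e) m. if m = 0 then a else if m = i then b else if m = j then c else if m = k then d else e)"

lemma fun5_simps:
  assumes "distinct [0, i, j, k, l]"
  shows "fun5 i j k l (a, b, c, d, e) 0 = a" "fun5 i j k l (a, b, c, d, e) i = b" "fun5 i j k l (a, b, c, d, e) j = c"
    "fun5 i j k l (a, b, c, d, e) k = d" "fun5 i j k l (a, b, c, d, e) l = e"
  using assms by (auto simp: fun5_def)

lemma all_5_iff:
  assumes "distinct [0 :: 5, i, j, k, l]"
  shows "(\<forall>m. P m) \<longleftrightarrow> P 0 \<and> P i \<and> P j \<and> P k \<and> P l"
  using UNIV_5_distinct(1)[OF assms] by (metis UNIV_I insertE singletonD)

lemma fun5_eta:
  assumes "distinct [0, i, j, k, l]"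
  shows "fun5 i j k l (x 0, x i, x j, x k, x l) = x"
  unfolding fun_eq_iff all_5_iff[OF assms] by (simp add: fun5_simps[OF assms])

context counting
begin

text \<open>The equation reads \<open>d * (d - a - b - c) = - N\<close> with \<open>N\<close> the
  norm form of \<open>a - c\<close> and \<open>b - c\<close>. So the quadric is a hyperbolic plane
  plus a norm form, and its count depends only on the zeros of that form in
  \<open>L\<close>.\<close>

lemma card_node_A_quadric:
  assumes Z: "Z = {(a, b). a \<in> L \<and> b \<in> L \<and> a ^ 2 - a * b + b ^ 2 = 0}"
  shows "int (card {(a, b, c, d). a \<in> L \<and> b \<in> L \<and> c \<in> L \<and> d \<in> L \<and>
      a ^ 2 + b ^ 2 + c ^ 2 + d ^ 2 = a * b + a * c + a * d + b * c + b * d + c * d}) =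
    (2 * q - 1) * int (card Z) + (q - 1) * (q ^ 2 - int (card Z))"
proof -
  define S where "S = {(a, b, c, d). a \<in> L \<and> b \<in> L \<and> c \<in> L \<and> d \<in> L \<and>
      a ^ 2 + b ^ 2 + c ^ 2 + d ^ 2 = a * b + a * c + a * d + b * c + b * d + c * d}"
  define h where "h = (\<lambda>(a, b). - (a ^ 2 - a * b + b ^ 2 :: 'b))"
  define t where "t = inverse (3 :: 'b)"
  have t: "3 * t = 1" using three by (simp add: t_def)
  have tL: "t \<in> L" by (simp add: t_def)
  define f where "f = (\<lambda>(a, b, c, d). ((a - c, b - c), d, d - a - b - (c :: 'b)))"
  define g where "g = (\<lambda>((a, b), d, e). (a + t * (d - a - b - e), b + t * (d - a - b - e), t * (d - a - b - e), d))"
  have "card S = card {(p, a, b). p \<in> L \<times> L \<and> a \<in> L \<and> b \<in> L \<and> a * b = h p}"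
  proof (rule card_eq_witness[of _ f _ g])
    fix p assume "p \<in> S"
    then obtain a b c d where p: "p = (a, b, c, d)" "a \<in> L" "b \<in> L" "c \<in> L" "d \<in> L"
      and eq: "a ^ 2 + b ^ 2 + c ^ 2 + d ^ 2 = a * b + a * c + a * d + b * c + b * d + c * d"
      by (auto simp: S_def)
    have "d * (d - a - b - c) = h (a - c, b - c)"
      using eq by (simp add: h_def algebra_simps power2_eq_square)
    moreover have "t * (d - (a - c) - (b - c) - (d - a - b - c)) = c"
    proof -
      have "t * (d - (a - c) - (b - c) - (d - a - b - c)) = (3 * t) * c" by (simp add: algebra_simps)
      then show ?thesis by (simp add: t)
    qed
    ultimately show "f p \<in> {(p, a, b). p \<in> L \<times> L \<and> a \<in> L \<and> b \<in> L \<and> a * b = h p} \<and> g (f p) = p"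
      using p by (simp add: f_def g_def)
  next
    fix p assume "p \<in> {(p, a, b). p \<in> L \<times> L \<and> a \<in> L \<and> b \<in> L \<and> a * b = h p}"
    then obtain a b d e where p: "p = ((a, b), d, e)" "a \<in> L" "b \<in> L" "d \<in> L" "e \<in> L" and eq: "d * e = h (a, b)"
      by auto
    define c where "c = t * (d - a - b - e)"
    have "3 * c = d - a - b - e"
    proof -
      have "3 * c = (3 * t) * (d - a - b - e)" by (simp add: c_def)
      then show ?thesis by (simp add: t)
    qed
    then have e: "e = d - a - b - 3 * c" by (simp add: algebra_simps)
    have cL: "c \<in> L" using p tL by (simp add: c_def)
    have "(a + c) ^ 2 + (b + c) ^ 2 + c ^ 2 + d ^ 2 =
      (a + c) * (b + c) + (a + c) * c + (a + c) * d + (b + c) * c + (b + c) * d + c * d"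
      using eq unfolding e by (simp add: h_def algebra_simps power2_eq_square)
    moreover have "g p = (a + c, b + c, c, d)"
      by (simp add: p(1) g_def c_def)
    moreover have "f (a + c, b + c, c, d) = p"
      by (simp add: p(1) f_def e algebra_simps)
    ultimately show "g p \<in> S \<and> f (g p) = p"
      using p(2-4) cL by (simp add: S_def)
  qed
  moreover have "{p \<in> L \<times> L. h p = 0} = Z"
  proof -
    have "h p = 0 \<longleftrightarrow> fst p ^ 2 - fst p * snd p + snd p ^ 2 = 0" for p
      by (cases p) (simp only: h_def prod.case neg_equal_0_iff_equal fst_conv snd_conv)
    then show ?thesis unfolding Z by auto
  qed
  ultimately show ?thesis
    unfolding S_def[symmetric] using card_mult_eq_on[of "L \<times> L" h] finite_L
    by (auto simp: h_def card_cartesian_product power2_eq_square)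
qed

end

context burkhardt_field
begin

lemma three_L: "(3 :: 'k alg_closure) \<noteq> 0"
  by (rule three_neq_0(2)[OF card_not_3'])

sublocale counting L
  by unfold_locales (rule three_L)

lemma finite_functions: "finite {x :: 5 \<Rightarrow> 'k alg_closure. \<forall>i. x i \<in> L}"
proof -
  have "{x :: 5 \<Rightarrow> 'k alg_closure. \<forall>i. x i \<in> L} \<subseteq> fun5 1 2 3 4 ` (L \<times> L \<times> L \<times> L \<times> L)"
  proof
    fix x :: "5 \<Rightarrow> 'k alg_closure" assume "x \<in> {x. \<forall>i. x i \<in> L}"
    then show "x \<in> fun5 1 2 3 4 ` (L \<times> L \<times> L \<times> L \<times> L)"
      using fun5_eta[OF distinct_1234, of x] by (intro image_eqI[of _ _ "(x 0, x 1, x 2, x 3, x 4)"]) auto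
  qed
  then show ?thesis by (rule finite_subset) (simp add: finite_L)
qed

lemma finite_tangents: "finite (tangents j x)"
  by (rule finite_subset[OF _ finite_functions]) (auto simp: tangents_def)

lemma finite_smooth_cone: "finite smooth_cone"
  by (rule finite_subset[OF _ finite_functions]) (auto simp: smooth_cone_def)

lemma finite_node_cone: "finite node_cone"
  by (rule finite_subset[OF _ finite_functions]) (auto simp: node_cone_def)

lemma scale_nodes: "s \<noteq> 0 \<Longrightarrow> (\<lambda>i. s * x i) \<in> nodes \<longleftrightarrow> x \<in> nodes"
  using singular_cone_scale[of x s] singular_cone_scale[of "\<lambda>i. s * x i" "inverse s"] by (auto simp: mult.assoc[symmetric])

text \<open>The translates are explicit: \<open>(x, r)\<close> goes to \<open>(s x, r t)\<close>
  over a smooth point and \<open>(x, v)\<close> to \<open>(s x, s t v)\<close> over a node.\<close>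

lemma ex_related:
  assumes \<psi>: "\<psi> \<in> homs" and s: "s \<in> L - {0}" and t: "t \<in> L - {0}"
  shows "\<exists>\<phi>\<in>homs. related s t \<psi> \<phi>"
proof (cases "pt \<psi> \<in> nodes")
  case False
  obtain r where r: "r \<in> L" "r \<noteq> 0" "pt \<psi> \<in> smooth_cone" "\<psi> = smooth_hom sing_ideal (pt \<psi>) r"
    using smooth_hom_cases[OF \<psi> False] .
  define x where "x = pt \<psi>"
  note \<psi>_eq = r(4)[folded x_def]
  have ev: "eval_ac (\<lambda>i. s * x i) f = s ^ d * eval_ac x f" if "homogeneous d f" for d f
    using ac.mp_eval_homogeneous_scale[OF that] by (simp add: eval_ac_eq_mp_eval)
  have "(\<lambda>i. s * x i) \<in> smooth_cone"
    using r(3) s scale_nodes[of s x] ev[OF homogeneous_burkhardt] by (auto simp: smooth_cone_def x_def)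
  then have "smooth_hom sing_ideal (\<lambda>i. s * x i) (r * t) \<in> homs"
    using r s t by (intro smooth_hom_homs) auto
  moreover have "related s t \<psi> (smooth_hom sing_ideal (\<lambda>i. s * x i) (r * t))"
    unfolding related_def by (subst \<psi>_eq) (simp add: smooth_hom_def ev power_mult_distrib)
  ultimately show ?thesis by blast
next
  case True
  define x where "x = pt \<psi>"
  obtain j h d g u where nd: "node (pt \<psi>) j h d g u" using ex_node[OF card_not_3' True] by blast
  obtain v where v: "v \<in> tangents j (pt \<psi>)" "\<psi> = node_hom sing_ideal (pt \<psi>) v"
    using node_hom_cases[OF \<psi> nd] .
  note \<psi>_eq = v(2)[folded x_def]
  interpret node x j h d g u using nd by (simp add: x_def)
  have vL: "v i \<in> L" for i using v(1) by (simp add: tangents_def)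
  have Q: "coeff (line_eval x v F) 2 = 0" and vj: "v j = 0" and v0: "v \<noteq> (\<lambda>_. 0)"
    using v(1) by (auto simp: tangents_def x_def)
  obtain i where i: "v i \<noteq> 0" using v0 by auto
  with vj have "i \<noteq> j" by auto
  \<comment> \<open>A homogeneous element of the ideal with nonzero derivative along
    \<open>v\<close>; it witnesses that the translate is nonzero in degree 1.\<close>
  define f where "f = h * local_param x j i"
  have f: "f \<in> sing_ideal" "coeff (line_eval x v f) 1 \<noteq> 0"
    using h_param[OF \<open>i \<noteq> j\<close>] coeff_line_eval_param[of v i, OF vj \<open>i \<noteq> j\<close>] h_nz node_second[of i] i
    by (auto simp: f_def)
  have c3: "homogeneous 3 (Var m ^ 3 :: (5, 'k) mpoly)" for m
    using homogeneous_power[OF homogeneous_Var[of m], of 3] by simp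
  have "\<exists>e. homogeneous e f"
    unfolding f_def local_param_def using homogeneous_mult[OF homogeneous_h homogeneous_Var[of i]]
      homogeneous_mult[OF homogeneous_h homogeneous_add[OF c3[of i] c3[of j]]] by auto
  then obtain e where e: "homogeneous e f" by blast
  have x: "(\<lambda>i. s * x i) \<in> node_cone"
    using True scale_nodes[of s x] s pt_in_L[OF \<psi>] by (auto simp: node_cone_def x_def)
  have "node_hom sing_ideal (\<lambda>i. s * x i) (\<lambda>i. s * t * v i) \<in> homs"
  proof (rule node_hom_homs[OF x _ _ f(1)])
    show "s * t * v i \<in> L" for i using s t vL by simp
    show "coeff (line_eval (\<lambda>i. s * x i) (\<lambda>i. s * t * v i) F) 2 = 0"
      using line_eval_scale[OF homogeneous_burkhardt, of s x t v 2] Q by simp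
    show "coeff (line_eval (\<lambda>i. s * x i) (\<lambda>i. s * t * v i) f) 1 \<noteq> 0"
      using line_eval_scale[OF e, of s x t v 1] f(2) s t by simp
  qed
  moreover have "related s t \<psi> (node_hom sing_ideal (\<lambda>i. s * x i) (\<lambda>i. s * t * v i))"
    unfolding related_def by (subst \<psi>_eq) (simp add: node_hom_def line_eval_scale)
  ultimately show ?thesis by blast
qed

lemma card_homs:
  fixes T :: "(5 \<Rightarrow> 'k alg_closure) \<Rightarrow> nat"
  assumes "\<And>x. x \<in> node_cone \<Longrightarrow> \<exists>j h d g u. node x j h d g u \<and> card (tangents j x) = T x"
  shows "(card L - 1) ^ 2 * card (sing_blowup_points F L) = (card L - 1) * card smooth_cone + (\<Sum>x\<in>node_cone. T x)"
proof -
  have T: "card {\<psi> \<in> homs. pt \<psi> = x} = T x" "finite {\<psi> \<in> homs. pt \<psi> = x}" if x: "x \<in> node_cone" for x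
  proof -
    obtain j h d g u where nd: "node x j h d g u" "card (tangents j x) = T x"
      using assms[OF x] by blast
    show "card {\<psi> \<in> homs. pt \<psi> = x} = T x" "finite {\<psi> \<in> homs. pt \<psi> = x}"
      using card_node_homs[OF x nd(1)] nd(2) finite_tangents by simp_all
  qed
  have eq: "homs = {\<psi> \<in> homs. pt \<psi> \<notin> nodes} \<union> (\<Union>x\<in>node_cone. {\<psi> \<in> homs. pt \<psi> = x})"
    using pt_in_L by (auto simp: node_cone_def)
  have fin: "finite {\<psi> \<in> homs. pt \<psi> \<notin> nodes}" "finite (\<Union>x\<in>node_cone. {\<psi> \<in> homs. pt \<psi> = x})"
    using card_smooth_homs(2)[OF finite_smooth_cone] T(2) finite_node_cone by auto
  have "finite homs"
    by (subst eq) (rule finite_UnI[OF fin])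
  have "card homs = card {\<psi> \<in> homs. pt \<psi> \<notin> nodes} + card (\<Union>x\<in>node_cone. {\<psi> \<in> homs. pt \<psi> = x})"
    by (rule trans[OF arg_cong[OF eq, of card] card_Un_disjoint[OF fin]]) (auto simp: node_cone_def)
  also have "card (\<Union>x\<in>node_cone. {\<psi> \<in> homs. pt \<psi> = x}) = (\<Sum>x\<in>node_cone. T x)"
    using T finite_node_cone by (subst card_UN_disjoint) auto
  finally show ?thesis
    using finite_card_rees_homs[OF \<open>finite homs\<close> ex_related] card_smooth_homs(1)[OF finite_smooth_cone]
    by (simp add: sing_blowup_points_def)
qed

text \<open>On \<open>y\<^sub>0 = 0\<close> the quartic is three times the product of the other
  coordinates. Its nonzero zeros number \<open>q ^ 4 - (q - 1) ^ 4 - 1\<close>, which is the first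
  term on the right.\<close>

lemma card_cone:
  "int (card smooth_cone) + int (card node_cone) = (q - 1) * (4 * q ^ 2 - 2 * q + 2) + (q - 1) * int (card affine_pts)"
proof -
  define C where "C = {x. (\<forall>i. x i \<in> L) \<and> (\<exists>i. x i \<noteq> 0) \<and> eval_ac x F = 0}"
  define f where "f x = (x 0, x 1, x 2, x 3, x (4 :: 5) :: 'k alg_closure)" for x
  define g :: "_ \<Rightarrow> 5 \<Rightarrow> 'k alg_closure" where "g = fun5 1 2 3 4"
  have gf: "g (f x) = x" for x unfolding f_def g_def by (rule fun5_eta[OF distinct_1234])
  have fg: "f (g p) = p" for p by (cases p) (simp add: f_def g_def fun5_simps[OF distinct_1234])
  note all = all_5_iff[OF distinct_1234]
  define C0 where "C0 = {(a, b, c, d). a \<in> L \<and> b \<in> L \<and> c \<in> L \<and> d \<in> L \<and> a * b * c * d = 0} - {(0, 0, 0, 0 :: 'k alg_closure)}"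
  define f1 where "f1 x = (x 0, - x 4 / x 0, x 1 / x 0, x 2 / x 0, x 3 / x (0 :: 5) :: 'k alg_closure)" for x
  define g1 where "g1 = (\<lambda>(s, m, a, b, c). g (s, s * a, s * b, s * c, - (s * m)))"
  have finC: "finite C" by (rule finite_subset[OF _ finite_functions]) (auto simp: C_def)
  have "C = smooth_cone \<union> node_cone"
    by (auto simp: C_def smooth_cone_def node_cone_def singular_cone_def)
  moreover have "smooth_cone \<inter> node_cone = {}"
    by (auto simp: smooth_cone_def node_cone_def)
  ultimately have "int (card smooth_cone) + int (card node_cone) = int (card C)"
    using finite_smooth_cone finite_node_cone by (simp add: card_Un_disjoint)
  also have "card C = card {x \<in> C. x 0 = 0} + card {x \<in> C. x 0 \<noteq> 0}"
    using finC by (subst card_Un_disjoint[symmetric]) (auto intro: arg_cong[where f = card])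
  also have "card {x \<in> C. x 0 = 0} = card C0"
  proof (rule card_eq_witness[of _ "\<lambda>x. snd (f x)" _ "\<lambda>p. g (0, p)"])
    fix x assume x: "x \<in> {x \<in> C. x 0 = 0}"
    then have "eval_ac x F = 3 * x 1 * x 2 * x 3 * x 4"
      by (simp add: eval_burkhardt[OF distinct_1234])
    moreover have "g (0, snd (f x)) = x"
      using gf[of x] x by (simp add: f_def)
    moreover have "\<not> (\<forall>i. x i = 0)"
      using x by (simp add: C_def)
    then have "(x 1, x 2, x 3, x 4) \<noteq> (0, 0, 0, 0)"
      unfolding all using x by simp
    ultimately show "snd (f x) \<in> C0 \<and> g (0, snd (f x)) = x"
      using x three_L by (simp add: C_def C0_def f_def)
  next
    fix p assume p: "p \<in> C0"
    then obtain a b c d where abcd: "p = (a, b, c, d)" by (cases p) auto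
    have g: "g (0, p) 0 = 0" "g (0, p) 1 = a" "g (0, p) 2 = b" "g (0, p) 3 = c" "g (0, p) 4 = d"
      by (simp_all add: abcd g_def fun5_simps[OF distinct_1234])
    have "eval_ac (g (0, p)) F = 3 * (a * b * c * d)"
      by (simp add: eval_burkhardt[OF distinct_1234] g)
    then have "eval_ac (g (0, p)) F = 0"
      using p by (simp add: C0_def abcd)
    moreover have "\<forall>i. g (0, p) i \<in> L"
      unfolding all g using p by (simp add: C0_def abcd)
    moreover have "\<not> (\<forall>i. g (0, p) i = 0)"
      unfolding all g using p by (simp add: C0_def abcd)
    moreover have "snd (f (g (0, p))) = p"
      by (simp add: fg)
    ultimately show "g (0, p) \<in> {x \<in> C. x 0 = 0} \<and> snd (f (g (0, p))) = p"
      using g(1) by (simp add: C_def)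
  qed
  also have "card {x \<in> C. x 0 \<noteq> 0} = card ((L - {0}) \<times> affine_pts)"
  proof (rule card_eq_witness[of _ f1 _ g1])
    fix x assume x: "x \<in> {x \<in> C. x 0 \<noteq> 0}"
    define s m a b c where defs: "s = x 0" "m = - x 4 / x 0" "a = x 1 / x 0" "b = x 2 / x 0" "c = x 3 / x 0"
    have "s \<noteq> 0" using x by (simp add: defs)
    then have xs: "x 0 = s" "x 1 = s * a" "x 2 = s * b" "x 3 = s * c" "x 4 = - (s * m)"
      by (simp_all add: defs)
    have in_L: "s \<in> L" "m \<in> L" "a \<in> L" "b \<in> L" "c \<in> L" using x by (auto simp: C_def defs)
    have "eval_ac x F = s ^ 4 * ((a ^ 3 + b ^ 3 + c ^ 3 - 3 * m * a * b * c) - (m ^ 3 - 1))"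
      unfolding eval_burkhardt[OF distinct_1234] xs by (simp add: algebra_simps power_numeral_reduce)
    then have "a ^ 3 + b ^ 3 + c ^ 3 - 3 * m * a * b * c = m ^ 3 - 1"
      using x \<open>s \<noteq> 0\<close> by (simp add: C_def)
    then have "(s, m, a, b, c) \<in> (L - {0}) \<times> affine_pts"
      using in_L \<open>s \<noteq> 0\<close> by (simp add: affine_pts_def)
    moreover have "g (s, s * a, s * b, s * c, - (s * m)) = x"
      using gf[of x] by (simp add: f_def xs)
    ultimately show "f1 x \<in> (L - {0}) \<times> affine_pts \<and> g1 (f1 x) = x"
      by (simp add: f1_def g1_def defs)
  next
    fix p assume "p \<in> (L - {0}) \<times> affine_pts"
    moreover obtain s m a b c where p: "p = (s, m, a, b, c)" by (cases p) auto
    ultimately have in_L: "s \<in> L" "s \<noteq> 0" "m \<in> L" "a \<in> L" "b \<in> L" "c \<in> L"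
      and eq: "a ^ 3 + b ^ 3 + c ^ 3 - 3 * m * a * b * c = m ^ 3 - 1"
      by (simp_all add: affine_pts_def)
    define x where "x = g (s, s * a, s * b, s * c, - (s * m))"
    have xs: "x 0 = s" "x 1 = s * a" "x 2 = s * b" "x 3 = s * c" "x 4 = - (s * m)"
      by (simp_all add: x_def g_def fun5_simps[OF distinct_1234])
    have "eval_ac x F = s ^ 4 * ((a ^ 3 + b ^ 3 + c ^ 3 - 3 * m * a * b * c) - (m ^ 3 - 1))"
      unfolding eval_burkhardt[OF distinct_1234] xs by (simp add: algebra_simps power_numeral_reduce)
    then have "eval_ac x F = 0" using eq by simp
    then have "x \<in> {x \<in> C. x 0 \<noteq> 0}"
      using in_L all[of "\<lambda>i. x i \<in> L"] exI[of "\<lambda>i. x i \<noteq> 0" 0] by (simp add: C_def xs)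
    moreover have "g1 p = x" "f1 x = p"
      using in_L by (simp_all add: p g1_def f1_def x_def[symmetric] xs)
    ultimately show "g1 p \<in> {x \<in> C. x 0 \<noteq> 0} \<and> f1 (g1 p) = p"
      by simp
  qed
  also have "int (card C0 + card ((L - {0}) \<times> affine_pts)) = int (card C0) + (q - 1) * int (card affine_pts)"
    using card_L_minus[of 0] by (simp add: card_cartesian_product)
  also have "int (card C0) = q ^ 4 - (q - 1) ^ 4 - 1"
  proof -
    define A where "A = L \<times> L \<times> L \<times> L"
    define B where "B = (L - {0}) \<times> (L - {0}) \<times> (L - {0}) \<times> (L - {0})"
    have "C0 = A - (B \<union> {(0, 0, 0, 0)})" by (auto simp: C0_def A_def B_def)
    moreover have "B \<union> {(0, 0, 0, 0)} \<subseteq> A" "finite A" "finite B" "(0, 0, 0, 0) \<notin> B"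
      using finite_L by (auto simp: A_def B_def)
    ultimately have "int (card C0) = int (card A) - (int (card B) + 1)"
      using card_mono[of A "B \<union> {(0, 0, 0, 0)}"] by (simp add: card_Diff_subset of_nat_diff)
    moreover have "int (card A) = q ^ 4" "int (card B) = (q - 1) ^ 4"
      using card_L_minus[of 0] by (simp_all add: A_def B_def card_cartesian_product power_numeral_reduce)
    ultimately show ?thesis by simp
  qed
  also have "q ^ 4 - (q - 1) ^ 4 - 1 = (q - 1) * (4 * q ^ 2 - 2 * q + 2)"
    by (simp add: algebra_simps power_numeral_reduce)
  finally show ?thesis .
qed

section \<open>Rational nodes, their tangent quadrics, and the resulting count\<close>

definition cube_roots :: "'k alg_closure set" where
  "cube_roots = {z \<in> L. z ^ 3 = 1}"

definition nodes_A :: "(5 \<Rightarrow> 'k alg_closure) set" where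
  "nodes_A = {x \<in> node_cone. node_A x}"

definition nodes_B :: "5 \<Rightarrow> 5 \<Rightarrow> (5 \<Rightarrow> 'k alg_closure) set" where
  "nodes_B i j = {x \<in> node_cone. node_B i j x}"

lemma node_cone_iff: "x \<in> node_cone \<longleftrightarrow> (\<forall>i. x i \<in> L) \<and> (node_A x \<or> (\<exists>i j. node_B i j x))"
  using singular_cone_iff[OF three_neq_0(1)[OF card_not_3'], of x] by (simp add: node_cone_def)

lemma card_nodes_A: "int (card nodes_A) = (q - 1) * int (card cube_roots) ^ 3"
proof -
  define f where "f x = (x 0, - x 1 / x 0, - x 2 / x 0, - x 3 / x (0 :: 5) :: 'k alg_closure)" for x
  \<comment> \<open>Three cube roots of unity are free. The fourth must be the inverse of their
    product, that is, its square.\<close>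
  define g :: "_ \<Rightarrow> 5 \<Rightarrow> 'k alg_closure"
    where "g = (\<lambda>(s, a, b, c). fun5 1 2 3 4 (s, - (s * a), - (s * b), - (s * c), - (s * (a * b * c) ^ 2)))"
  note all = all_5_iff[OF distinct_1234]
  have "card nodes_A = card ((L - {0}) \<times> cube_roots \<times> cube_roots \<times> cube_roots)"
  proof (rule card_eq_witness[of _ f _ g])
    fix x assume x: "x \<in> nodes_A"
    define s where "s = x 0"
    define a where "a = - x 1 / x 0"
    define b where "b = - x 2 / x 0"
    define c where "c = - x 3 / x 0"
    have A: "node_A x" and xL: "\<And>i. x i \<in> L" using x by (auto simp: nodes_A_def node_cone_def)
    have "s \<noteq> 0" using A by (simp add: node_A_def s_def)
    have xs: "x 0 = s" "x 1 = - (s * a)" "x 2 = - (s * b)" "x 3 = - (s * c)"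
      using \<open>s \<noteq> 0\<close> by (simp_all add: s_def a_def b_def c_def)
    have cube: "y ^ 3 = 1" if "(- (s * y)) ^ 3 = - (s ^ 3)" for y
    proof -
      have "s ^ 3 * y ^ 3 = s ^ 3 * 1" using that by (simp add: power_mult_distrib)
      then show ?thesis using \<open>s \<noteq> 0\<close> by (simp only: mult_cancel_left) simp
    qed
    have d: "(1 :: 5) \<noteq> 0" "(2 :: 5) \<noteq> 0" "(3 :: 5) \<noteq> 0" by simp_all
    have abc: "a ^ 3 = 1" "b ^ 3 = 1" "c ^ 3 = 1"
      by (rule cube[OF node_A_cube[OF A d(1), unfolded xs]] cube[OF node_A_cube[OF A d(2), unfolded xs]]
        cube[OF node_A_cube[OF A d(3), unfolded xs]])+
    have "x 4 = - (s * (a * b * c) ^ 2)"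
    proof -
      have p: "x 1 * x 2 * x 3 * x 4 = s ^ 4" using A by (simp add: node_A_def xs(1))
      have "s ^ 3 * (a * b * c) ^ 3 * x 4 = - ((a * b * c) ^ 2 * (x 1 * x 2 * x 3 * x 4))"
        unfolding xs by (simp add: algebra_simps power_numeral_reduce)
      also have "\<dots> = s ^ 3 * (- (s * (a * b * c) ^ 2))"
        unfolding p by (simp add: algebra_simps power_numeral_reduce)
      also have "(a * b * c) ^ 3 = 1" by (simp add: power_mult_distrib abc)
      finally have "s ^ 3 * x 4 = s ^ 3 * (- (s * (a * b * c) ^ 2))" by simp
      then show ?thesis using \<open>s \<noteq> 0\<close> by (simp only: mult_cancel_left) simp
    qed
    then have "g (s, a, b, c) = x"
      using fun5_eta[OF distinct_1234, of x] by (simp add: g_def xs)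
    moreover have "f x = (s, a, b, c)"
      by (simp add: f_def s_def a_def b_def c_def)
    moreover have "s \<in> L" "a \<in> L" "b \<in> L" "c \<in> L"
      using xL by (simp_all add: s_def a_def b_def c_def)
    ultimately show "f x \<in> (L - {0}) \<times> cube_roots \<times> cube_roots \<times> cube_roots \<and> g (f x) = x"
      using abc \<open>s \<noteq> 0\<close> by (simp add: cube_roots_def)
  next
    fix p assume "p \<in> (L - {0}) \<times> cube_roots \<times> cube_roots \<times> cube_roots"
    then obtain s a b c where p: "p = (s, a, b, c)" and in_L: "s \<in> L" "s \<noteq> 0" "a \<in> L" "b \<in> L" "c \<in> L"
      and abc: "a ^ 3 = 1" "b ^ 3 = 1" "c ^ 3 = 1"
      by (auto simp: cube_roots_def)
    define x where "x = g p"
    have xs: "x 0 = s" "x 1 = - (s * a)" "x 2 = - (s * b)" "x 3 = - (s * c)" "x 4 = - (s * (a * b * c) ^ 2)"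
      by (simp_all add: x_def g_def p fun5_simps[OF distinct_1234])
    have d: "(a * b * c) ^ 3 = 1" by (simp add: power_mult_distrib abc)
    have "((a * b * c) ^ 2) ^ 3 = ((a * b * c) ^ 3) ^ 2" by (simp only: power_mult[symmetric] mult.commute)
    then have d2: "((a * b * c) ^ 2) ^ 3 = 1" by (simp add: d)
    have "x 1 * x 2 * x 3 * x 4 = s ^ 4 * (a * b * c) ^ 3"
      unfolding xs by (simp add: algebra_simps power_numeral_reduce)
    then have "x 1 * x 2 * x 3 * x 4 = x 0 ^ 4" by (simp add: d xs(1))
    moreover have "\<forall>i. i \<noteq> 0 \<longrightarrow> x i ^ 3 = - (x 0 ^ 3)"
      unfolding all xs using abc d2 by (simp add: power_mult_distrib)
    ultimately have "node_A x" using in_L by (simp add: node_A_def xs(1))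
    moreover have "\<forall>i. x i \<in> L"
      unfolding all xs using in_L by simp
    ultimately have "x \<in> nodes_A"
      by (simp add: nodes_A_def node_cone_iff)
    moreover have "f x = p" using in_L by (simp add: f_def xs p)
    ultimately show "g p \<in> nodes_A \<and> f (g p) = p" by (simp add: x_def)
  qed
  then show ?thesis
    using card_L_minus[of 0] by (simp add: card_cartesian_product power3_eq_cube)
qed

lemma card_nodes_B:
  assumes "i \<noteq> 0" "j \<noteq> 0" "i \<noteq> j"
  shows "int (card (nodes_B i j)) = (q - 1) * int (card cube_roots)"
proof -
  obtain k l where d: "distinct [0 :: 5, i, j, k, l]" using ex_perm[OF assms] .
  define g :: "_ \<Rightarrow> 5 \<Rightarrow> 'k alg_closure" where "g = (\<lambda>(s, z). fun5 i j k l (0, s, - (s * z), 0, 0))"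
  have "card (nodes_B i j) = card ((L - {0}) \<times> cube_roots)"
  proof (rule card_eq_witness[of _ "\<lambda>x. (x i, - x j / x i)" _ g])
    fix x assume x: "x \<in> nodes_B i j"
    have B: "node_B i j x" and xL: "\<And>i. x i \<in> L" using x by (auto simp: nodes_B_def node_cone_def)
    have xs: "x 0 = 0" "x k = 0" "x l = 0" "x i \<noteq> 0" "x j ^ 3 = - (x i ^ 3)"
      using B d by (auto simp: node_B_def)
    have "(- x j / x i) ^ 3 = - (x j ^ 3) / x i ^ 3" by (simp add: power_divide)
    then have "(- x j / x i) ^ 3 = 1" using xs by simp
    moreover have "g (x i, - x j / x i) = x"
      using fun5_eta[OF d, of x] xs by (simp add: g_def)
    ultimately show "(x i, - x j / x i) \<in> (L - {0}) \<times> cube_roots \<and> g (x i, - x j / x i) = x"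
      using xL xs by (simp add: cube_roots_def)
  next
    fix p assume "p \<in> (L - {0}) \<times> cube_roots"
    then obtain s z where p: "p = (s, z)" "s \<in> L" "s \<noteq> 0" "z \<in> L" "z ^ 3 = 1" by (auto simp: cube_roots_def)
    have xs: "g p 0 = 0" "g p i = s" "g p j = - (s * z)" "g p k = 0" "g p l = 0"
      by (simp_all add: g_def p(1) fun5_simps[OF d])
    have "\<forall>m. m \<noteq> i \<longrightarrow> m \<noteq> j \<longrightarrow> g p m = 0"
      unfolding all_5_iff[OF d] xs by simp
    then have "node_B i j (g p)"
      using p assms xs by (simp add: node_B_def power_mult_distrib)
    moreover have "\<forall>m. g p m \<in> L"
      unfolding all_5_iff[OF d] xs using p by simp
    ultimately have "g p \<in> nodes_B i j"
      by (auto simp: nodes_B_def node_cone_iff)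
    moreover have "(g p i, - g p j / g p i) = p"
      unfolding xs using p by simp
    ultimately show "g p \<in> nodes_B i j \<and> (g p i, - g p j / g p i) = p" ..
  qed
  then show ?thesis
    using card_L_minus[of 0] by (simp add: card_cartesian_product)
qed

definition pairs :: "(5 \<times> 5) set" where
  "pairs = {(1, 2), (1, 3), (1, 4), (2, 3), (2, 4), (3, 4)}"

lemma node_B_sym: "node_B i j x \<longleftrightarrow> node_B j i (x :: 5 \<Rightarrow> 'k alg_closure)"
proof -
  have "node_B j i x" if "node_B i j x" for i j
  proof -
    have "x j \<noteq> 0" using that by (auto simp: node_B_def)
    then show ?thesis using that by (auto simp: node_B_def)
  qed
  then show ?thesis by blast
qed

lemma ex_pairs:
  assumes "node_B i j (x :: 5 \<Rightarrow> 'k alg_closure)"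
  shows "\<exists>(i, j)\<in>pairs. node_B i j x"
proof -
  have ne: "i \<noteq> 0" "j \<noteq> 0" "i \<noteq> j" using assms by (auto simp: node_B_def)
  have "i \<in> {0, 1, 2, 3, 4}" "j \<in> {0, 1, 2, 3, 4}" using UNIV_5 by blast+
  then have "(i, j) \<in> pairs \<or> (j, i) \<in> pairs" using ne by (auto simp: pairs_def)
  then show ?thesis using assms node_B_sym by blast
qed

lemma node_B_unique:
  assumes "node_B i j (x :: 5 \<Rightarrow> 'k alg_closure)" "node_B i' j' x"
  shows "{i, j} = {i', j'}"
proof -
  have "{m. x m \<noteq> 0} = {i, j}" if "node_B i j x" for i j
  proof -
    have "x j \<noteq> 0" using that by (auto simp: node_B_def)
    then show ?thesis using that by (auto simp: node_B_def)
  qed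
  then show ?thesis using assms by metis
qed

text \<open>Stated for a weight that is constant on each kind of node: weight 1 counts the nodes,
  and the number of tangent vectors counts the homomorphisms over them.\<close>

lemma node_cone_sum:
  fixes TA TB :: int
  assumes "\<And>x. x \<in> nodes_A \<Longrightarrow> T x = TA" "\<And>i j x. (i, j) \<in> pairs \<Longrightarrow> x \<in> nodes_B i j \<Longrightarrow> T x = TB"
  shows "(\<Sum>x\<in>node_cone. T x) = int (card nodes_A) * TA + 6 * ((q - 1) * int (card cube_roots)) * TB"
proof -
  define B where "B = (\<Union>p\<in>pairs. nodes_B (fst p) (snd p))"
  have eq: "node_cone = nodes_A \<union> B"
  proof
    show "node_cone \<subseteq> nodes_A \<union> B"
    proof
      fix x assume x: "x \<in> node_cone"
      then consider "node_A x" | i j where "node_B i j x" using node_cone_iff by blast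
      then show "x \<in> nodes_A \<union> B"
      proof cases
        case 1 then show ?thesis using x by (simp add: nodes_A_def)
      next
        case 2
        with ex_pairs obtain i j where "(i, j) \<in> pairs" "node_B i j x" by blast
        then have "x \<in> B" using x unfolding B_def nodes_B_def by force
        then show ?thesis by blast
      qed
    qed
    show "nodes_A \<union> B \<subseteq> node_cone" by (auto simp: nodes_A_def B_def nodes_B_def)
  qed
  have fin: "finite nodes_A" "finite B" "\<And>i j. finite (nodes_B i j)"
    using finite_node_cone by (auto intro: finite_subset[of _ node_cone] simp: nodes_A_def B_def nodes_B_def)
  have disj: "nodes_A \<inter> B = {}"
    by (auto simp: nodes_A_def B_def nodes_B_def node_A_def dest: node_B_0)
  have "(\<Sum>x\<in>node_cone. T x) = (\<Sum>x\<in>nodes_A. T x) + (\<Sum>x\<in>B. T x)"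
    unfolding eq by (rule sum.union_disjoint[OF fin(1,2) disj])
  also have "(\<Sum>x\<in>nodes_A. T x) = int (card nodes_A) * TA"
    using assms(1) by simp
  also have "(\<Sum>x\<in>B. T x) = (\<Sum>p\<in>pairs. \<Sum>x\<in>nodes_B (fst p) (snd p). T x)"
    unfolding B_def
  proof (rule sum.UNION_disjoint)
    show "finite pairs" by (simp add: pairs_def)
    show "\<forall>p\<in>pairs. finite (nodes_B (fst p) (snd p))" using fin by blast
    show "\<forall>p\<in>pairs. \<forall>p'\<in>pairs. p \<noteq> p' \<longrightarrow> nodes_B (fst p) (snd p) \<inter> nodes_B (fst p') (snd p') = {}"
    proof (intro ballI impI, rule ccontr)
      fix p p' assume p: "p \<in> pairs" "p' \<in> pairs" "p \<noteq> p'" "nodes_B (fst p) (snd p) \<inter> nodes_B (fst p') (snd p') \<noteq> {}"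
      then obtain x where "x \<in> nodes_B (fst p) (snd p)" "x \<in> nodes_B (fst p') (snd p')"
        by blast
      then have "node_B (fst p) (snd p) x" "node_B (fst p') (snd p') x"
        by (simp_all add: nodes_B_def)
      then have "{fst p, snd p} = {fst p', snd p'}" by (rule node_B_unique)
      with p(1-3) show False by (auto simp: pairs_def doubleton_eq_iff)
    qed
  qed
  also have "\<dots> = (\<Sum>p\<in>pairs. ((q - 1) * int (card cube_roots)) * TB)"
  proof (rule sum.cong[OF refl])
    fix p assume "p \<in> pairs"
    then obtain i j where ij: "p = (i, j)" "(i, j) \<in> pairs" by (cases p) auto
    then have "i \<noteq> 0" "j \<noteq> 0" "i \<noteq> j" by (auto simp: pairs_def)
    from card_nodes_B[OF this] show "(\<Sum>x\<in>nodes_B (fst p) (snd p). T x) = ((q - 1) * int (card cube_roots)) * TB"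
      using assms(2)[OF ij(2)] ij(1) by simp
  qed
  also have "\<dots> = 6 * ((q - 1) * int (card cube_roots)) * TB"
  proof -
    have "card pairs = 6" by (simp add: pairs_def)
    then show ?thesis by simp
  qed
  finally show ?thesis .
qed

text \<open>For \<open>v i = 0\<close> the quadric is \<open>v 0 * v j = r * (v k * v l)\<close>,
  whose coefficient \<open>r = - x i / x j\<close> lies in \<open>L\<close>. So it is split over
  every \<open>L\<close>.\<close>

lemma card_tangents_B:
  assumes "x \<in> nodes_B i j"
  shows "int (card (tangents i x)) = q ^ 3 + q ^ 2 - q - 1"
proof -
  have B: "node_B i j x" and xL: "\<And>m. x m \<in> L" using assms by (auto simp: nodes_B_def node_cone_def)
  then have ne: "i \<noteq> 0" "j \<noteq> 0" "i \<noteq> j" "x i \<noteq> 0" "x j \<noteq> 0" by (auto simp: node_B_def)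
  obtain k l where d: "distinct [0 :: 5, i, j, k, l]" using ex_perm[OF ne(1-3)] .
  have x0: "x 0 = 0" "x k = 0" "x l = 0" using B d by (auto simp: node_B_def)
  define r where "r = - x i / x j"
  have r: "r \<in> L" "r \<noteq> 0" using xL ne by (simp_all add: r_def)
  define H where "H = {((c, d), a, b). c \<in> L \<and> d \<in> L \<and> a \<in> L \<and> b \<in> L \<and> a * b = r * (c * d)}"
  have Q: "coeff (line_eval x v F) 2 = 0 \<longleftrightarrow> v 0 * v j = r * (v k * v l)" if "v i = 0" for v
  proof -
    have "coeff (line_eval x v F) 2 = (3 * x j ^ 2) * (v 0 * v j - r * (v k * v l))"
      unfolding coeff_line_eval_burkhardt[OF d] using ne that x0 by (simp add: r_def field_simps power2_eq_square)
    then show ?thesis using three_L ne by simp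
  qed
  define f where "f v = ((v k, v l), v 0, v j)" for v :: "5 \<Rightarrow> 'k alg_closure"
  define g :: "_ \<Rightarrow> 5 \<Rightarrow> 'k alg_closure" where "g = (\<lambda>((c, d), a, b). fun5 i j k l (a, 0, b, c, d))"
  have "card (tangents i x) = card (H - {((0, 0), 0, 0)})"
  proof (rule card_eq_witness[of _ f _ g])
    fix v assume v: "v \<in> tangents i x"
    then have vi: "v i = 0" and vL: "\<And>m. v m \<in> L" by (auto simp: tangents_def)
    have "f v \<in> H" using Q[of v, OF vi] v vL by (simp add: H_def f_def tangents_def)
    moreover have gf: "g (f v) = v" using fun5_eta[OF d, of v] vi by (simp add: f_def g_def)
    moreover have "\<not> (\<forall>m. v m = 0)" using v by (auto simp: tangents_def)
    then have "f v \<noteq> ((0, 0), 0, 0)" unfolding all_5_iff[OF d] using vi by (auto simp: f_def)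
    ultimately show "f v \<in> H - {((0, 0), 0, 0)} \<and> g (f v) = v" by simp
  next
    fix p assume p: "p \<in> H - {((0, 0), 0, 0)}"
    then obtain c e a b where pe: "p = ((c, e), a, b)" "c \<in> L" "e \<in> L" "a \<in> L" "b \<in> L" "a * b = r * (c * e)" by (auto simp: H_def)
    have vs: "g p 0 = a" "g p i = 0" "g p j = b" "g p k = c" "g p l = e"
      by (simp_all add: g_def pe(1) fun5_simps[OF d])
    have "\<forall>m. g p m \<in> L" unfolding all_5_iff[OF d] vs using pe by simp
    moreover have "\<not> (\<forall>m. g p m = 0)" unfolding all_5_iff[OF d] vs using p pe(1) by auto
    then have "g p \<noteq> (\<lambda>_. 0)" by auto
    moreover have "coeff (line_eval x (g p) F) 2 = 0" using Q[of "g p", OF vs(2)] pe(6) by (simp add: vs)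
    ultimately have "g p \<in> tangents i x" using vs(2) by (simp add: tangents_def)
    moreover have "f (g p) = p" unfolding f_def vs by (simp add: pe(1))
    ultimately show "g p \<in> tangents i x \<and> f (g p) = p" by blast
  qed
  moreover have "int (card H) = q ^ 3 + q ^ 2 - q" unfolding H_def by (rule card_hyperbolic[OF r])
  moreover have "finite H" unfolding H_def
    by (rule finite_subset[of _ "(L \<times> L) \<times> L \<times> L"]) (use finite_L in auto)
  moreover have "((0, 0), 0, 0) \<in> H" by (simp add: H_def)
  then have "Suc (card (H - {((0, 0), 0, 0)})) = card H" using card_Suc_Diff1[OF \<open>finite H\<close>] by blast
  ultimately show ?thesis by linarith
qed

text \<open>Dividing each \<open>v m\<close> by \<open>x m\<close>, and using that all the cubes
  \<open>x m ^ 3\<close> equal \<open>- (x 0 ^ 3)\<close>, makes the quadric the same at every node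
  of this kind.\<close>

lemma card_tangents_A:
  assumes "x \<in> nodes_A" and Z: "Z = {(a, b). a \<in> L \<and> b \<in> L \<and> a ^ 2 - a * b + b ^ 2 = 0}"
  shows "int (card (tangents 0 x)) = (2 * q - 1) * int (card Z) + (q - 1) * (q ^ 2 - int (card Z)) - 1"
proof -
  have A: "node_A x" and xL: "\<And>m. x m \<in> L" using assms by (auto simp: nodes_A_def node_cone_def)
  have x0: "x 0 \<noteq> 0" and P: "x 1 * x 2 * x 3 * x 4 = x 0 ^ 4" using A by (auto simp: node_A_def)
  have c: "x m ^ 3 = - (x 0 ^ 3)" if "m \<noteq> 0" for m using node_A_cube[OF A that] .
  have d1: "(1 :: 5) \<noteq> 0" and d2: "(2 :: 5) \<noteq> 0" and d3: "(3 :: 5) \<noteq> 0" and d4: "(4 :: 5) \<noteq> 0"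
    by simp_all
  have nz: "x m \<noteq> 0" for m using c[of m] x0 by (cases "m = 0") auto
  note d = distinct_1234
  define H where "H = {(a, b, c, d). a \<in> L \<and> b \<in> L \<and> c \<in> L \<and> d \<in> L \<and>
      a ^ 2 + b ^ 2 + c ^ 2 + d ^ 2 = a * b + a * c + a * d + b * c + b * d + c * d}"
  define f where "f v = (v 1 / x 1, v 2 / x 2, v 3 / x 3, v 4 / x 4)" for v :: "5 \<Rightarrow> 'k alg_closure"
  define g :: "_ \<Rightarrow> 5 \<Rightarrow> 'k alg_closure"
    where "g = (\<lambda>(a, b, c, e). fun5 1 2 3 4 (0, x 1 * a, x 2 * b, x 3 * c, x 4 * e))"
  have Q: "coeff (line_eval x (g (a, b, c, e)) F) 2 = 0 \<longleftrightarrow>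
      a ^ 2 + b ^ 2 + c ^ 2 + e ^ 2 = a * b + a * c + a * e + b * c + b * e + c * e" for a b c e
  proof -
    have "coeff (line_eval x (g (a, b, c, e)) F) 2 = 3 * x 0 * (x 1 ^ 3 * a ^ 2 + x 2 ^ 3 * b ^ 2 + x 3 ^ 3 * c ^ 2 + x 4 ^ 3 * e ^ 2)
       + 3 * (x 1 * x 2 * x 3 * x 4) * (a * b + a * c + a * e + b * c + b * e + c * e)"
      unfolding coeff_line_eval_burkhardt[OF d] g_def prod.case fun5_simps[OF d]
      by (simp add: algebra_simps power_numeral_reduce)
    also have "\<dots> = - (3 * x 0 ^ 4) * ((a ^ 2 + b ^ 2 + c ^ 2 + e ^ 2) - (a * b + a * c + a * e + b * c + b * e + c * e))"
      unfolding P c[OF d1] c[OF d2] c[OF d3] c[OF d4] by (simp add: algebra_simps power_numeral_reduce)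
    finally show ?thesis using three_L x0 by simp
  qed
  have "card (tangents 0 x) = card (H - {(0, 0, 0, 0)})"
  proof (rule card_eq_witness[of _ f _ g])
    fix v assume v: "v \<in> tangents 0 x"
    then have v0: "v 0 = 0" and vL: "\<And>m. v m \<in> L" by (auto simp: tangents_def)
    have gf: "g (f v) = v" using fun5_eta[OF d, of v] v0 nz by (simp add: f_def g_def)
    obtain a b c e where fv: "f v = (a, b, c, e)" by (cases "f v") auto
    have "a \<in> L" "b \<in> L" "c \<in> L" "e \<in> L" using fv vL xL by (auto simp: f_def)
    moreover have "coeff (line_eval x (g (a, b, c, e)) F) 2 = 0"
      using v gf by (simp add: fv tangents_def)
    ultimately have "f v \<in> H" using Q[of a b c e] by (simp add: fv H_def)
    moreover have "\<not> (\<forall>m. v m = 0)" using v by (auto simp: tangents_def)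
    then have "f v \<noteq> (0, 0, 0, 0)" unfolding all_5_iff[OF d] using v0 nz by (auto simp: f_def)
    ultimately show "f v \<in> H - {(0, 0, 0, 0)} \<and> g (f v) = v" using gf by simp
  next
    fix p assume p: "p \<in> H - {(0, 0, 0, 0)}"
    then obtain a b c e where pe: "p = (a, b, c, e)" "a \<in> L" "b \<in> L" "c \<in> L" "e \<in> L"
      and eq: "a ^ 2 + b ^ 2 + c ^ 2 + e ^ 2 = a * b + a * c + a * e + b * c + b * e + c * e" by (auto simp: H_def)
    have vs: "g p 0 = 0" "g p 1 = x 1 * a" "g p 2 = x 2 * b" "g p 3 = x 3 * c" "g p 4 = x 4 * e"
      by (simp_all add: g_def pe(1) fun5_simps[OF d])
    have "\<forall>m. g p m \<in> L" unfolding all_5_iff[OF d] vs using pe xL by simp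
    moreover have "\<not> (\<forall>m. g p m = 0)" unfolding all_5_iff[OF d] vs using p pe(1) nz by auto
    then have "g p \<noteq> (\<lambda>_. 0)" by auto
    moreover have "coeff (line_eval x (g p) F) 2 = 0" using Q[of a b c e] eq by (simp add: pe(1))
    ultimately have "g p \<in> tangents 0 x" using vs(1) by (simp add: tangents_def)
    moreover have "f (g p) = p" unfolding f_def vs using nz by (simp add: pe(1))
    ultimately show "g p \<in> tangents 0 x \<and> f (g p) = p" by blast
  qed
  moreover have "int (card H) = (2 * q - 1) * int (card Z) + (q - 1) * (q ^ 2 - int (card Z))"
    unfolding H_def by (rule card_node_A_quadric[OF Z])
  moreover have "finite H" unfolding H_def
    by (rule finite_subset[of _ "L \<times> L \<times> L \<times> L"]) (use finite_L in auto)
  moreover have "(0, 0, 0, 0) \<in> H" by (simp add: H_def)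
  then have "Suc (card (H - {(0, 0, 0, 0)})) = card H" using card_Suc_Diff1[OF \<open>finite H\<close>] by blast
  ultimately show ?thesis by linarith
qed

text \<open>A smooth vector carries \<open>q - 1\<close> homomorphisms and a node vector as many as
  it has tangent vectors; one factor \<open>q - 1\<close> has been divided out.
  \<open>W ^ 3 + 6 * W\<close> is the number of rational nodes, which are removed from the points of
  the quartic.\<close>

lemma card_blowup:
  assumes TA: "\<And>x. x \<in> nodes_A \<Longrightarrow> int (card (tangents 0 x)) = TA"
    and N: "N = int (card affine_pts)" and W: "W = int (card cube_roots)"
  shows "(q - 1) * int (card (sing_blowup_points F L)) =
    (q - 1) * (4 * q ^ 2 - 2 * q + 2 + N - (W ^ 3 + 6 * W)) + (W ^ 3 * TA + 6 * W * (q ^ 3 + q ^ 2 - q - 1))"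
proof -
  define TB where "TB = q ^ 3 + q ^ 2 - q - 1"
  define T where "T x = (if x \<in> nodes_A then nat TA else nat TB)" for x
  have TB: "x \<notin> nodes_A" if "x \<in> nodes_B i j" for x i j
    using that by (auto simp: nodes_A_def nodes_B_def node_A_def dest: node_B_0)
  have "\<exists>j h d g u. node x j h d g u \<and> card (tangents j x) = T x" if x: "x \<in> node_cone" for x
  proof -
    consider "node_A x" | i j where "node_B i j x" using x node_cone_iff by blast
    then show ?thesis
    proof cases
      case 1
      then have "x \<in> nodes_A" using x by (simp add: nodes_A_def)
      then have "card (tangents 0 x) = T x" using TA[of x] by (simp add: T_def)
      then show ?thesis using ex_node_A[OF card_not_3' 1] by blast
    next
      case 2
      then have "x \<in> nodes_B i j" using x by (simp add: nodes_B_def)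
      then have "card (tangents i x) = T x"
        using card_tangents_B[of x i j] TB[of x i j] by (simp add: T_def TB_def)
      then show ?thesis using ex_node_B[OF card_not_3' 2] by blast
    qed
  qed
  from card_homs[of T, OF this]
  have "int ((card L - 1) ^ 2 * card (sing_blowup_points F L)) = int ((card L - 1) * card smooth_cone + (\<Sum>x\<in>node_cone. T x))"
    by simp
  moreover have "int (card L - 1) = q - 1"
    using card_L_ge_2 by (simp add: of_nat_diff)
  ultimately have 1: "(q - 1) ^ 2 * int (card (sing_blowup_points F L)) =
      (q - 1) * int (card smooth_cone) + (\<Sum>x\<in>node_cone. int (T x))"
    by (simp only: of_nat_mult of_nat_add of_nat_power of_nat_sum)
  have nA: "int (card nodes_A) = (q - 1) * W ^ 3"
    unfolding W by (rule card_nodes_A)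
  have "int (T x) = TA" if "x \<in> nodes_A" for x
    using TA[OF that, symmetric] that by (simp add: T_def)
  moreover have "int (T x) = TB" if "(i, j) \<in> pairs" "x \<in> nodes_B i j" for i j x
    using card_tangents_B[OF that(2)] TB[OF that(2)] by (simp add: T_def TB_def)
  ultimately have 2: "(\<Sum>x\<in>node_cone. int (T x)) = (q - 1) * W ^ 3 * TA + 6 * ((q - 1) * W) * TB"
    unfolding nA[symmetric] unfolding W by (rule node_cone_sum)
  have "(\<Sum>x\<in>node_cone. 1) = (q - 1) * W ^ 3 * 1 + 6 * ((q - 1) * W) * 1"
    unfolding nA[symmetric] unfolding W by (rule node_cone_sum) simp_all
  then have 3: "int (card smooth_cone) = (q - 1) * (4 * q ^ 2 - 2 * q + 2 + N - (W ^ 3 + 6 * W))"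
    using card_cone unfolding N by (simp add: algebra_simps)
  have "(q - 1) * ((q - 1) * int (card (sing_blowup_points F L))) =
     (q - 1) * ((q - 1) * (4 * q ^ 2 - 2 * q + 2 + N - (W ^ 3 + 6 * W)) + (W ^ 3 * TA + 6 * W * TB))"
    using 1 unfolding 2 3 by (simp add: algebra_simps power2_eq_square)
  then show ?thesis
    unfolding TB_def using card_L_ge_2 by (simp only: mult_cancel_left) auto
qed

text \<open>The quartic has \<open>q ^ 3 + 16 * q ^ 2 - 29 * q + 1\<close> points. Each of its 45
  rational nodes is replaced by \<open>(q + 1) ^ 2\<close> points, which adds
  \<open>45 * (q ^ 2 + 2 * q)\<close>.\<close>

lemma card_blowup_split:
  assumes "w \<in> L" "w ^ 2 + w + 1 = 0"
  shows "int (card (sing_blowup_points F L)) = q ^ 3 + 61 * q ^ 2 + 61 * q + 1"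
proof -
  interpret counting_split L w by unfold_locales (rule assms)+
  have W: "3 = int (card cube_roots)" by (simp add: cube_roots_def card_cube_1)
  have "int (card (tangents 0 x)) = q ^ 3 + q ^ 2 - q - 1" if "x \<in> nodes_A" for x
    unfolding card_tangents_A[OF that refl] card_norm_zero
    by (simp add: algebra_simps power2_eq_square power3_eq_cube)
  from card_blowup[OF this refl W]
  have "(q - 1) * int (card (sing_blowup_points F L)) = (q - 1) * (q ^ 3 + 61 * q ^ 2 + 61 * q + 1)"
    unfolding card_affine_split by (simp add: algebra_simps power2_eq_square power3_eq_cube)
  then show ?thesis using card_L_ge_2 by (simp only: mult_cancel_left) auto
qed

text \<open>The quartic has \<open>q ^ 3 + 4 * q ^ 2 - q + 1\<close> points. One rational node is
  replaced by \<open>q ^ 2 + 1\<close> points and six by \<open>(q + 1) ^ 2\<close> points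
  each.\<close>

lemma card_blowup_nonsplit:
  assumes "\<And>a. a \<in> L \<Longrightarrow> \<exists>!b. b \<in> L \<and> b ^ 3 = a"
  shows "int (card (sing_blowup_points F L)) = q ^ 3 + 11 * q ^ 2 + 11 * q + 1"
proof -
  interpret counting_nonsplit L by unfold_locales (rule assms)
  have "cube_roots = {1}"
    using cube_inj[of _ 1] by (auto simp: cube_roots_def)
  then have W: "1 = int (card cube_roots)" by simp
  have "int (card (tangents 0 x)) = (q - 1) * (q ^ 2 + 1)" if "x \<in> nodes_A" for x
    unfolding card_tangents_A[OF that refl] card_norm_zero
    by (simp add: algebra_simps power2_eq_square power3_eq_cube)
  from card_blowup[OF this refl W]
  have "(q - 1) * int (card (sing_blowup_points F L)) = (q - 1) * (q ^ 3 + 11 * q ^ 2 + 11 * q + 1)"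
    unfolding card_affine_nonsplit by (simp add: algebra_simps power2_eq_square power3_eq_cube)
  then show ?thesis using card_L_ge_2 by (simp only: mult_cancel_left) auto
qed

end

section \<open>The Legendre symbol and the zeta function\<close>

lemma Legendre_3:
  assumes "\<not> 3 dvd q"
  shows "Legendre (int q) 3 = 1 \<or> Legendre (int q) 3 = - 1" "[Legendre (int q) 3 = int q] (mod 3)"
proof -
  have nz: "\<not> [int q = 0] (mod 3)"
    using assms by (simp add: cong_0_iff) presburger
  then show "Legendre (int q) 3 = 1 \<or> Legendre (int q) 3 = - 1"
    by (simp add: Legendre_def)
  have "int q mod 3 = 1 \<or> int q mod 3 = 2"
    using nz by (simp add: cong_def) presburger
  then show "[Legendre (int q) 3 = int q] (mod 3)"
  proof
    assume "int q mod 3 = 1"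
    then have "[1 ^ 2 = int q] (mod 3)" by (simp add: cong_def)
    then have "QuadRes 3 (int q)" unfolding QuadRes_def by blast
    then show ?thesis using nz \<open>int q mod 3 = 1\<close> by (simp add: Legendre_def cong_def)
  next
    assume q: "int q mod 3 = 2"
    have "\<not> QuadRes 3 (int q)"
    proof
      assume "QuadRes 3 (int q)"
      then obtain y :: int where "y ^ 2 mod 3 = 2" using q by (auto simp: QuadRes_def cong_def)
      then have "(y mod 3) ^ 2 mod 3 = 2" by (simp add: power_mod)
      moreover have "y mod 3 = 0 \<or> y mod 3 = 1 \<or> y mod 3 = 2" by presburger
      ultimately show False by auto
    qed
    then show ?thesis using nz q by (simp add: Legendre_def cong_def)
  qed
qed

lemma card_points:
  assumes "\<not> 3 dvd CARD('k)" "n > 0" and Q: "Q = int (CARD('k) ^ n)" and e: "e = Legendre (int CARD('k)) 3 ^ n"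
  shows "int (card (sing_blowup_points (burkhardt :: (5, 'k::{field, finite}) mpoly) (Fq n))) =
    1 + 36 * Q + 25 * e * Q + 25 * e * Q ^ 2 + 36 * Q ^ 2 + Q ^ 3"
proof -
  interpret finite_subfield "Fq n :: 'k alg_closure set"
    by (rule finite_subfield_Fq[OF assms(2)])
  interpret burkhardt_field "Fq n :: 'k alg_closure set"
    by unfold_locales (use to_ac_in_Fq assms(1) in auto)
  have cL: "int (card (Fq n :: 'k alg_closure set)) = Q"
    using card_Fq[OF assms(2), where 'k = 'k] by (simp add: Q)
  have frob_fix: "a ^ (CARD('k) ^ n) = a" if "a \<in> Fq n" for a :: "'k alg_closure"
    using that by (simp add: Fq_def)
  \<comment> \<open>The Legendre symbol is congruent to the field size modulo 3, hence its
    \<open>n\<close>-th power to \<open>Q\<close>. So the sign \<open>e\<close> decides whether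
    \<open>Fq n\<close> contains a primitive cube root of unity.\<close>
  have e: "e = 1 \<or> e = - 1" "[e = Q] (mod 3)"
    using Legendre_3[OF assms(1)] cong_pow[of "Legendre (int CARD('k)) 3" "int CARD('k)" 3 n]
    unfolding Q e by (auto simp: minus_one_power_iff split: if_splits)
  show ?thesis
  proof (cases "e = 1")
    case True
    then have "Q mod 3 = 1" using e(2) by (simp add: cong_def)
    then have "CARD('k) ^ n mod 3 = 1" unfolding Q by presburger
    then obtain m where m: "CARD('k) ^ n = 3 * m + 1" by (metis mod_eqE mult.commute mult_div_mod_eq)
    obtain w :: "'k alg_closure" where "poly [:1, 1, 1:] w = 0"
      using alg_closed_imp_poly_has_root[of "[:1, 1, 1 :: 'k alg_closure:]"] by auto
    then have w: "w ^ 2 + w + 1 = 0" by (simp add: power2_eq_square algebra_simps)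
    have "w ^ 3 = 1" using w by Groebner_Basis.algebra
    then have "w ^ (CARD('k) ^ n) = w" unfolding m by (simp add: power_mult)
    then have "w \<in> Fq n" by (simp add: Fq_def)
    from card_blowup_split[OF this w] show ?thesis
      unfolding cL True by simp
  next
    case False
    with e have e1: "e = - 1" by simp
    then have "Q mod 3 = 2" using e(2) by (simp add: cong_def)
    then have "CARD('k) ^ n mod 3 = 2" unfolding Q by presburger
    then obtain m where m: "CARD('k) ^ n = 3 * m + 2" by (metis mod_eqE mult.commute mult_div_mod_eq)
    \<comment> \<open>\<open>2 * m + 1\<close> inverts 3 in the exponent:
      \<open>3 * (2 * m + 1) = 2 * (Q - 1) + 1\<close>, and \<open>Q\<close>-th powers act trivially
      on \<open>Fq n\<close>.\<close>
    have root: "(a ^ (2 * m + 1)) ^ 3 = a" "(a ^ 3) ^ (2 * m + 1) = a" if "a \<in> Fq n" for a :: "'k alg_closure"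
    proof -
      have "a ^ (3 * (2 * m + 1)) = a ^ (3 * m + 2) * a ^ (3 * m + 1)"
        unfolding power_add[symmetric] by (rule arg_cong[of _ _ "power a"]) simp
      also have "\<dots> = a * a ^ (3 * m + 1)"
        using frob_fix[OF that] by (simp only: m)
      also have "\<dots> = a ^ (3 * m + 2)" by simp
      also have "\<dots> = a" using frob_fix[OF that] by (simp add: m)
      finally show "(a ^ (2 * m + 1)) ^ 3 = a" "(a ^ 3) ^ (2 * m + 1) = a"
        by (simp_all only: power_mult[symmetric] mult.commute)
    qed
    have "\<exists>!b. b \<in> Fq n \<and> b ^ 3 = a" if "a \<in> Fq n" for a :: "'k alg_closure"
    proof (rule ex1I[of _ "a ^ (2 * m + 1)"])
      show "a ^ (2 * m + 1) \<in> Fq n \<and> (a ^ (2 * m + 1)) ^ 3 = a"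
        using root(1)[OF that] power_L[OF that] by blast
      show "b = a ^ (2 * m + 1)" if "b \<in> Fq n \<and> b ^ 3 = a" for b
        using root(2)[of b] that by metis
    qed
    from card_blowup_nonsplit[OF this] show ?thesis
      unfolding cL e1 by simp
  qed
qed

theorem corollary2p3:
  fixes q :: nat and \<epsilon> :: int
  assumes "CARD('k::{field, finite}) = q"
    and "\<not> 3 dvd q"
    and "\<epsilon> = Legendre (int q) 3"
  shows "zeta (\<lambda>n. sing_blowup_points (burkhardt :: (5, 'k) mpoly) (Fq n)) =
    1 / ((1 - fps_X)
       * (1 - fps_const (of_nat q) * fps_X) ^ 36
       * (1 - fps_const (of_int \<epsilon> * of_nat q) * fps_X) ^ 25
       * (1 - fps_const (of_int \<epsilon> * of_nat q ^ 2) * fps_X) ^ 25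
       * (1 - fps_const (of_nat q ^ 2) * fps_X) ^ 36
       * (1 - fps_const (of_nat q ^ 3) * fps_X))"
proof -
  define c :: "nat \<Rightarrow> nat" where "c i = [1, 36, 25, 25, 36, 1] ! i" for i
  define a :: "nat \<Rightarrow> rat" where "a i = [1, of_nat q, of_int \<epsilon> * of_nat q, of_int \<epsilon> * of_nat q ^ 2,
    of_nat q ^ 2, of_nat q ^ 3] ! i" for i
  have set6: "{..<6 :: nat} = {0, 1, 2, 3, 4, 5}" by auto
  have vals: "c 0 = 1" "c 1 = 36" "c 2 = 25" "c 3 = 25" "c 4 = 36" "c 5 = 1"
    "a 0 = 1" "a 1 = of_nat q" "a 2 = of_int \<epsilon> * of_nat q" "a 3 = of_int \<epsilon> * of_nat q ^ 2"
    "a 4 = of_nat q ^ 2" "a 5 = of_nat q ^ 3"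
    by (simp_all add: c_def a_def eval_nat_numeral)
  have "zeta (\<lambda>n. sing_blowup_points (burkhardt :: (5, 'k) mpoly) (Fq n)) =
    1 / (\<Prod>i<6. (1 - fps_const (a i) * fps_X) ^ c i)"
  proof (rule zeta_power_sums)
    fix n :: nat assume "n > 0"
    have "int (card (sing_blowup_points (burkhardt :: (5, 'k) mpoly) (Fq n))) =
      1 + 36 * int (q ^ n) + 25 * \<epsilon> ^ n * int (q ^ n) + 25 * \<epsilon> ^ n * int (q ^ n) ^ 2 + 36 * int (q ^ n) ^ 2 + int (q ^ n) ^ 3"
      using card_points[where 'k = 'k, OF _ \<open>n > 0\<close> refl refl] assms by simp
    then have "rat_of_int (int (card (sing_blowup_points (burkhardt :: (5, 'k) mpoly) (Fq n)))) =
      rat_of_int (1 + 36 * int (q ^ n) + 25 * \<epsilon> ^ n * int (q ^ n) + 25 * \<epsilon> ^ n * int (q ^ n) ^ 2 + 36 * int (q ^ n) ^ 2 + int (q ^ n) ^ 3)"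
      by simp
    then show "rat_of_nat (card (sing_blowup_points (burkhardt :: (5, 'k) mpoly) (Fq n))) = (\<Sum>i<6. of_nat (c i) * a i ^ n)"
      by (simp add: set6 vals[unfolded One_nat_def] power_mult_distrib algebra_simps flip: power_mult)
  qed simp
  also have "(\<Prod>i<6. (1 - fps_const (a i) * fps_X) ^ c i) = (1 - fps_X)
       * (1 - fps_const (of_nat q) * fps_X) ^ 36
       * (1 - fps_const (of_int \<epsilon> * of_nat q) * fps_X) ^ 25
       * (1 - fps_const (of_int \<epsilon> * of_nat q ^ 2) * fps_X) ^ 25
       * (1 - fps_const (of_nat q ^ 2) * fps_X) ^ 36
       * (1 - fps_const (of_nat q ^ 3) * fps_X)"
    by (simp add: set6 vals[unfolded One_nat_def] mult.assoc)
  finally show ?thesis .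
qed

end
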